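(* Let $k\ge0$ be an integer, $\delta\in(-1,\infty)$, $b_m:=k-m+1+\delta(k-m)$ for $m=0,\dots,k$, and $\tau:=k+2+\delta(k+1)$. Let $(D_\infty^{(0)},\dots,D_\infty^{(k)})$ be a random vector with $\mathbb P(D_\infty^{(m)}=i_m,\ m=0,\dots,k)=p_{i_0,\dots,i_k}$, $1\le i_k<\cdots<i_0$, where $(p_{i_0,\dots,i_k})$ is the probability mass function given by the recursion in the context, and let $\mathbf X^{(m)}=(X^{(m)}_0,\dots,X^{(m)}_k)$, $m=0,\dots,k$, be the random vectors defined in the context. Let $E_k=[0,\infty]^{k+1}\setminus\{\mathbf 0\}$. Then, as $h\to\infty$, $$ h\,\mathbb P\bigg(\Big(\frac{D_\infty^{(m)}}{h^{b_m/\tau}}\Big)_{m=0}^k\in\cdot\bigg)\ \stackrel{v}{\to}\ m_{\rm tail}\quad\text{in } M_+(E_k), $$ where $$ m_{\rm tail}(\cdot):=\Big(\nu_{\tau/b_0}\otimes\mathbb P\circ\Big(\sum_{m=0}^k\mathbf X^{(m)}\Big)^{-1}\Big)\circ\chi^{-1}(\cdot), $$ $\nu_{\tau/b_0}$ is the measure on $(0,\infty)$ with $\nu_{\tau/b_0}((x,\infty))=x^{-\tau/b_0}$ for $x>0$, and $\chi(x,y_0,y_1,\dots,y_k)=(xy_0,x^{b_1/b_0}y_1,\dots,x^{b_k/b_0}y_k)$. In particular, for every $(x_0,\dots,x_k)\in[0,\infty)^{k+1}\setminus\{\mathbf 0\}$, $$ m_{\rm tail}\Big(\prod_{i=0}^k(x_i,\infty]\Big)=\frac{\tau}{b_0}\int_0^\infty\mathbb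 P\Big(\sum_{m=0}^kX^{(m)}_i>\frac{x_i}{u^{b_i/b_0}},\ i=0,\dots,k\Big)\,u^{-(1+\tau/b_0)}\,du . $$
   Context: Recursion: $(p_{i_0,\dots,i_k})_{1\le i_k<\cdots<i_0}$ is the probability mass function determined by $$ \begin{aligned} p_{i_0,\dots,i_k} &= \frac{i_k-1+\delta}{\tau}\, p_{i_0-1,\dots,i_k-1} +\sum_{m=0}^{k-1}\frac{(i_m-1-k+m)b_m-(i_{m+1}-k+m+1)b_{m+1}}{\tau}\,p_{i_0-1,\dots,i_m-1,i_{m+1},\dots,i_k}\\ &\quad-\frac{(i_0-k)b_0+\delta}{\tau}\,p_{i_0,\dots,i_k}+\mathbf 1\{i_\ell=k-\ell+1,\ \ell=0,\dots,k\}, \end{aligned} $$ with $p_{j_0,\dots,j_k}:=0$ whenever $1\le j_k<\cdots<j_0$ fails. Vague convergence: $M_+(E_k)$ is the space of Radon measures on $E_k$ (compact sets of $E_k$ are the closed sets bounded away from the origin). $\xi_n\stackrel{v}{\to}\xi$ in $M_+(E_k)$ means $\int g\,d\xi_n\to\int g\,d\xi$ for every nonnegative continuous function $g$ on $E_k$ with compact support. The map $\chi$ is considered on $(0,\infty)\times([0,\infty)^{k+1}\setminus\{\mathbf 0\})$ with values in $E_k$. Random vectors $\mathbf X^{(m)}$. Let $\Gamma^{(m)}_{(1+\delta)/b_m}$, $m=0,\dots,k$, be independent Gamma random variables with shape $(1+\delta)/b_m$ and unit scale. Let $(W_\infty^{(m,i)}(t),\,t\ge0)$, $1\le i\le m\le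 k$, be independent positive L\'evy processes (subordinators), independent of the Gamma variables, with $$\mathbb E\big[e^{-\theta W_\infty^{(m,i)}(t)}\big]=\exp\Big\{-t\int_0^\infty(1-e^{-\theta x})g_i(x)\,dx\Big\},\quad\theta,t\ge0,\qquad g_i(x)=\frac{b_i}{b_{i-1}\Gamma(1-b_i/b_{i-1})}x^{-1-b_i/b_{i-1}}e^{-x},\ x>0.$$ For $m=0,\dots,k$ define $\mathbf X^{(m)}\in[0,\infty)^{k+1}$ by $X^{(m)}_m=\Gamma^{(m)}_{(1+\delta)/b_m}$, $X^{(m)}_i=W_\infty^{(m,i+1)}(X^{(m)}_{i+1})$ for $i=m-1,m-2,\dots,0$, and $X^{(m)}_i\equiv0$ for $i=m+1,\dots,k$. *)

theory Defs
  imports "HOL-Probability.Probability"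
begin

section \<open>The parameters and the recursion\<close>

definition bpar :: "nat \<Rightarrow> real \<Rightarrow> nat \<Rightarrow> real" where
  "bpar k \<delta> m = real k - real m + 1 + \<delta> * (real k - real m)"

definition tau :: "nat \<Rightarrow> real \<Rightarrow> real" where
  "tau k \<delta> = real k + 2 + \<delta> * (real k + 1)"

text \<open>A multi-index \<open>(i\<^sub>0, \<dots>, i\<^sub>k)\<close> is a function on the naturals of which only the
  values at \<open>0, \<dots>, k\<close> matter.\<close>

definition admissible :: "nat \<Rightarrow> (nat \<Rightarrow> nat) \<Rightarrow> bool" where
  "admissible k i \<longleftrightarrow> 1 \<le> i k \<and> (\<forall>l<k. i (Suc l) < i l)"

text \<open>\<open>lower m i\<close> is \<open>(i\<^sub>0 - 1, \<dots>, i\<^sub>m - 1, i\<^sub>m\<^sub>+\<^sub>1, \<dots>, i\<^sub>k)\<close>. It is only applied to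
  admissible \<open>i\<close> and \<open>m \<le> k\<close>, where the subtraction does not truncate.\<close>

definition lower :: "nat \<Rightarrow> (nat \<Rightarrow> nat) \<Rightarrow> nat \<Rightarrow> nat" where
  "lower m i = (\<lambda>l. if l \<le> m then i l - 1 else i l)"

text \<open>The recursion determines \<open>p\<close>: the coefficient \<open>1 + ((i\<^sub>0 - k) b\<^sub>0 + \<delta>) / \<tau>\<close> of
  \<open>p i\<close> is positive for admissible \<open>i\<close>, and every other index that occurs has a smaller
  first entry.\<close>

definition satisfies_recursion :: "nat \<Rightarrow> real \<Rightarrow> ((nat \<Rightarrow> nat) \<Rightarrow> real) \<Rightarrow> bool" where
  "satisfies_recursion k \<delta> p \<longleftrightarrow>
    (\<forall>i. \<not> admissible k i \<longrightarrow> p i = 0) \<and>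
    (\<forall>i. admissible k i \<longrightarrow>
      p i = (real (i k) - 1 + \<delta>) / tau k \<delta> * p (lower k i)
        + (\<Sum>m<k. ((real (i m) - 1 - real k + real m) * bpar k \<delta> m
                   - (real (i (m + 1)) - real k + real m + 1) * bpar k \<delta> (m + 1)) / tau k \<delta>
                 * p (lower m i))
        - ((real (i 0) - real k) * bpar k \<delta> 0 + \<delta>) / tau k \<delta> * p i
        + of_bool (\<forall>l\<le>k. i l = k - l + 1))"

section \<open>Radon measures and vague convergence\<close>

definition borel_of :: "'a topology \<Rightarrow> 'a measure" where
  "borel_of X = sigma (topspace X) {U. openin X U}"

text \<open>On a locally compact second countable Hausdorff space, such as \<open>E k\<close> below, a Borel
  measure that is finite on compact sets is automatically regular, so this is the usual notion
  of a Radon measure there.\<close>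

definition radon_measure_on :: "'a topology \<Rightarrow> 'a measure \<Rightarrow> bool" where
  "radon_measure_on X \<mu> \<longleftrightarrow>
    sets \<mu> = sets (borel_of X) \<and> (\<forall>K. compactin X K \<longrightarrow> emeasure \<mu> K < \<infinity>)"

definition vaguely_converges ::
    "'a topology \<Rightarrow> ('i \<Rightarrow> 'a measure) \<Rightarrow> 'a measure \<Rightarrow> 'i filter \<Rightarrow> bool" where
  "vaguely_converges X \<xi> \<xi>' F \<longleftrightarrow>
    (\<forall>\<^sub>F h in F. radon_measure_on X (\<xi> h)) \<and> radon_measure_on X \<xi>' \<and>
    (\<forall>g. continuous_map X euclideanreal g \<and> (\<forall>x\<in>topspace X. 0 \<le> g x) \<and>
         compactin X (X closure_of {x \<in> topspace X. g x \<noteq> 0}) \<longrightarrow>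
       ((\<lambda>h. \<integral>\<^sup>+x. ennreal (g x) \<partial>\<xi> h) \<longlongrightarrow> (\<integral>\<^sup>+x. ennreal (g x) \<partial>\<xi>')) F)"

text \<open>\<open>[0,\<infinity>]\<^sup>k\<^sup>+\<^sup>1\<close> with the product topology; its points are the extensional functions on
  \<open>{..k}\<close>.\<close>

definition cube :: "nat \<Rightarrow> (nat \<Rightarrow> ennreal) topology" where
  "cube k = product_topology (\<lambda>_. euclidean) {..k}"

definition E :: "nat \<Rightarrow> (nat \<Rightarrow> ennreal) topology" where
  "E k = subtopology (cube k) (topspace (cube k) - {\<lambda>i\<in>{..k}. 0})"

section \<open>The limiting random vectors\<close>

definition gamma_density :: "real \<Rightarrow> real \<Rightarrow> real" where
  "gamma_density a x = (if x > 0 then x powr (a - 1) * exp (- x) / Gamma a else 0)"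

text \<open>Paths are cadlag for every outcome rather than almost surely, so that evaluating the
  process at a random time gives a random variable without completing the measure.\<close>

definition levy_process :: "'a measure \<Rightarrow> (real \<Rightarrow> 'a \<Rightarrow> real) \<Rightarrow> bool" where
  "levy_process M W \<longleftrightarrow> prob_space M \<and>
    (\<forall>t\<ge>0. W t \<in> borel_measurable M) \<and>
    (AE \<omega> in M. W 0 \<omega> = 0) \<and>
    (\<forall>(n::nat) t. 0 \<le> t 0 \<and> mono_on {..n} t \<longrightarrow>
       prob_space.indep_vars M (\<lambda>_. borel) (\<lambda>j \<omega>. W (t (Suc j)) \<omega> - W (t j) \<omega>) {..<n}) \<and>
    (\<forall>s\<ge>0. \<forall>t\<ge>0. distr M borel (\<lambda>\<omega>. W (s + t) \<omega> - W s \<omega>) = distr M borel (W t)) \<and>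
    (\<forall>\<omega>\<in>space M. (\<forall>t\<ge>0. continuous (at_right t) (\<lambda>u. W u \<omega>)) \<and>
       (\<forall>t>0. \<exists>l. ((\<lambda>u. W u \<omega>) \<longlongrightarrow> l) (at_left t)))"

definition subordinator :: "'a measure \<Rightarrow> (real \<Rightarrow> 'a \<Rightarrow> real) \<Rightarrow> bool" where
  "subordinator M W \<longleftrightarrow> levy_process M W \<and> (\<forall>t\<ge>0. \<forall>\<omega>\<in>space M. 0 \<le> W t \<omega>)"

definition levy_density :: "nat \<Rightarrow> real \<Rightarrow> nat \<Rightarrow> real \<Rightarrow> real" where
  "levy_density k \<delta> i x =
    bpar k \<delta> i / (bpar k \<delta> (i - 1) * Gamma (1 - bpar k \<delta> i / bpar k \<delta> (i - 1)))
      * x powr (- 1 - bpar k \<delta> i / bpar k \<delta> (i - 1)) * exp (- x)"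

text \<open>The sigma-algebras generated by the Gamma variables and by the processes; a process is
  regarded as a random element of the space of functions on \<open>[0,\<infinity>)\<close> with the product
  sigma-algebra. These families live on different types, hence the sum type.\<close>

definition generated_sigma ::
    "'a measure \<Rightarrow> (nat \<Rightarrow> 'a \<Rightarrow> real) \<Rightarrow> (nat \<Rightarrow> nat \<Rightarrow> real \<Rightarrow> 'a \<Rightarrow> real)
      \<Rightarrow> nat + nat \<times> nat \<Rightarrow> 'a set set" where
  "generated_sigma N G W j = (case j of
      Inl m \<Rightarrow> sets (vimage_algebra (space N) (G m) borel)
    | Inr (m, i) \<Rightarrow> sets (vimage_algebra (space N) (\<lambda>\<omega>. \<lambda>t\<in>{0..}. W m i t \<omega>)
                        (\<Pi>\<^sub>M t\<in>{0..}. borel)))"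

text \<open>\<open>Xvec G W m i\<close> is the \<open>i\<close>-th coordinate of \<open>\<^bold>X\<^sup>(\<^sup>m\<^sup>)\<close>.\<close>

function Xvec :: "(nat \<Rightarrow> 'a \<Rightarrow> real) \<Rightarrow> (nat \<Rightarrow> nat \<Rightarrow> real \<Rightarrow> 'a \<Rightarrow> real)
      \<Rightarrow> nat \<Rightarrow> nat \<Rightarrow> 'a \<Rightarrow> real" where
  "Xvec G W m i \<omega> =
    (if i = m then G m \<omega>
     else if i < m then W m (i + 1) (Xvec G W m (i + 1) \<omega>) \<omega>
     else 0)"
  by auto
termination by (relation "Wellfounded.measure (\<lambda>(G, W, m, i, \<omega>). m - i)") auto

declare Xvec.simps [simp del]

definition Xsum :: "nat \<Rightarrow> (nat \<Rightarrow> 'a \<Rightarrow> real) \<Rightarrow> (nat \<Rightarrow> nat \<Rightarrow> real \<Rightarrow> 'a \<Rightarrow> real)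
      \<Rightarrow> 'a \<Rightarrow> nat \<Rightarrow> real" where
  "Xsum k G W \<omega> = (\<lambda>i\<in>{..k}. \<Sum>m\<le>k. Xvec G W m i \<omega>)"

section \<open>The two measures\<close>

text \<open>\<open>h \<cdot> \<P>((D\<^sub>m / h\<^bsup>b\<^sub>m/\<tau>\<^esup>)\<^sub>m \<in> \<cdot>)\<close> on the Borel sets of \<open>E k\<close>. Taking the law on the cube
  first allows the vector to be zero on a null set.\<close>

definition scaled_law :: "nat \<Rightarrow> real \<Rightarrow> 'a measure \<Rightarrow> (nat \<Rightarrow> 'a \<Rightarrow> nat) \<Rightarrow> real
      \<Rightarrow> (nat \<Rightarrow> ennreal) measure" where
  "scaled_law k \<delta> M D h = scale_measure (ennreal h)
    (restrict_space
      (distr M (borel_of (cube k))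
        (\<lambda>\<omega>. \<lambda>m\<in>{..k}. ennreal (real (D m \<omega>) / h powr (bpar k \<delta> m / tau k \<delta>))))
      (topspace (E k)))"

definition chi :: "nat \<Rightarrow> real \<Rightarrow> real \<times> (nat \<Rightarrow> real) \<Rightarrow> nat \<Rightarrow> ennreal" where
  "chi k \<delta> = (\<lambda>(x, y). \<lambda>i\<in>{..k}. ennreal (x powr (bpar k \<delta> i / bpar k \<delta> 0) * y i))"

definition punctured_orthant :: "nat \<Rightarrow> (nat \<Rightarrow> real) set" where
  "punctured_orthant k = (\<Pi>\<^sub>E i\<in>{..k}. {0..}) - {\<lambda>i\<in>{..k}. 0}"

text \<open>The law of the sum does not charge the origin, so restricting it to the domain of
  \<open>chi\<close> loses no mass.\<close>

definition m_tail :: "nat \<Rightarrow> real \<Rightarrow> real measure \<Rightarrow> 'a measure \<Rightarrow> (nat \<Rightarrow> 'a \<Rightarrow> real)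
      \<Rightarrow> (nat \<Rightarrow> nat \<Rightarrow> real \<Rightarrow> 'a \<Rightarrow> real) \<Rightarrow> (nat \<Rightarrow> ennreal) measure" where
  "m_tail k \<delta> \<nu> N G W =
    distr
      (\<nu> \<Otimes>\<^sub>M restrict_space (distr N (\<Pi>\<^sub>M i\<in>{..k}. borel) (Xsum k G W)) (punctured_orthant k))
      (borel_of (E k)) (chi k \<delta>)"

end

theory Submission
  imports Defs "HOL-Real_Asymp.Real_Asymp"
begin

text \<open>The recursion says that \<open>D\<^sub>\<infinity>\<close> is the value, at an independent exponential time of rate
  \<open>\<tau>\<close>, of a Markov chain with affine jump rates started at \<open>(k + 1, \<dots>, 1)\<close>. The generating function
  of the chain at time \<open>t\<close> is explicit: put \<open>Y\<^sub>0 = 1\<close>, \<open>V\<^sub>l = r\<^sub>l Y\<^sub>l + (1 - r\<^sub>l) exp (b\<^sub>l t)\<close> and let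
  \<open>Y\<^sub>l\<^sub>+\<^sub>1\<close> be the power of \<open>V\<^sub>l\<close> with exponent \<open>b\<^sub>l\<^sub>+\<^sub>1 / b\<^sub>l\<close>; it is the product of the powers of \<open>V\<^sub>m\<close> with
  exponents \<open>- (1 + \<delta>) / b\<^sub>m\<close>. No chain is needed: this function is tested against the recursion and
  integrated in \<open>t\<close>. The Laplace transform of \<open>\<Sum>\<^sub>m \<^bold>X\<^sup>(\<^sup>m\<^sup>)\<close> is the same product with
  \<open>V\<^sub>l = Y\<^sub>l + \<theta>\<^sub>l\<close>, so the shift \<open>t = s + ln h / \<tau>\<close> produces the limit, an integral against
  \<open>\<tau> exp (- \<tau> s) ds\<close>, which is \<open>\<nu>\<close> in the coordinate \<open>x = exp (b\<^sub>0 s)\<close>. Laplace transforms themselves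
  are not integrable near the origin; their \<open>n\<close>-th differences with \<open>n > \<tau>\<close> are, and they are dominated
  because the generating functions have nonnegative coefficients. Finally the Stone-Weierstrass theorem
  in the variables \<open>y\<^sub>i = exp (- x\<^sub>i)\<close> on the compact cube reaches every continuous test function
  that vanishes near the origin.\<close>

section \<open>Characteristics of the generating function\<close>

text \<open>The recursion is a resolvent equation: if L is the generator of the chain acting on
  functions f of the excess x over the starting index, it says that \<open>\<tau>\<close> E f - E (L
  f) = \<open>\<tau>\<close> f(0) under the law \<open>p\<close>. With f = \<open>flow_fun r\<close>
  at time \<open>t\<close>, on which L acts as the time derivative, the integrand weighted by
  \<open>exp (- (\<tau> * t))\<close> is a total derivative; this is how an unknown law is tested
  against an explicit function. The obstacle is the infinite mass of the limit as \<open>s\<close>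
  tends to minus infinity, where the weight \<open>exp (- (\<tau> * s))\<close> explodes. What is
  needed there is in effect an \<open>n\<close>-th moment bound at time \<open>t\<close>, uniform in
  \<open>h\<close>. It comes from comparing the \<open>n\<close>-th difference with the generating
  function at a point whose \<open>j\<close>-th coordinate exceeds 1 by an amount of order
  \<open>exp (- (b j * t))\<close>. Nothing identifies the explicit function with an expectation at
  such a point, so the comparison uses only positivity, in the dual form \<open>pos_on\<close>. A
  single \<open>n\<close> above \<open>\<tau>\<close> serves every coordinate because each
  \<open>b j\<close> is at least 1.\<close>

locale tree_params =
  fixes k :: nat and \<delta> :: real
  assumes delta: "-1 < \<delta>"
begin

abbreviation b :: "nat \<Rightarrow> real" where "b \<equiv> bpar k \<delta>"
abbreviation \<tau> :: real where "\<tau> \<equiv> tau k \<delta>"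

lemma b_Suc: "b m = b (Suc m) + (1 + \<delta>)"
  by (simp add: bpar_def algebra_simps)

lemma tau_eq: "\<tau> = b 0 + (1 + \<delta>)"
  by (simp add: bpar_def tau_def algebra_simps)

lemma b_ge_1: "m \<le> k \<Longrightarrow> 1 \<le> b m"
  using delta mult_nonneg_nonneg[of "1 + \<delta>" "real k - real m"]
  by (simp add: bpar_def algebra_simps)

lemma b_pos: "m \<le> k \<Longrightarrow> 0 < b m"
  using b_ge_1[of m] by linarith

lemma b_k: "b k = 1"
  by (simp add: bpar_def)

lemma tau_pos: "0 < \<tau>"
  using b_pos[of 0] delta by (simp add: tau_eq)

lemma beta_bounds:
  assumes "Suc l \<le> k" shows "0 < b (Suc l) / b l" "b (Suc l) / b l < 1"
  using b_pos[of l] b_pos[of "Suc l"] b_Suc[of l] delta assms by auto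

text \<open>With \<open>c = 1\<close> and \<open>d = \<theta>\<close>, \<open>transf c d\<close> is the Laplace transform of the limit vector; with
  \<open>c = r\<close> and \<open>d = flow_arg r t\<close> it is the generating function at \<open>r\<close> of the chain at time \<open>t\<close>. The
  characteristic through \<open>r\<close> is \<open>flow r\<close>, and the generator multiplies the monomial with base \<open>u\<close> by
  \<open>gen_mult u\<close>.\<close>

primrec iter :: "(nat \<Rightarrow> real) \<Rightarrow> (nat \<Rightarrow> real) \<Rightarrow> nat \<Rightarrow> real" where
  "iter c d 0 = 1"
| "iter c d (Suc l) = (c l * iter c d l + d l) powr (b (Suc l) / b l)"

definition iter_arg :: "(nat \<Rightarrow> real) \<Rightarrow> (nat \<Rightarrow> real) \<Rightarrow> nat \<Rightarrow> real" where
  "iter_arg c d l = c l * iter c d l + d l"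

definition transf :: "(nat \<Rightarrow> real) \<Rightarrow> (nat \<Rightarrow> real) \<Rightarrow> real" where
  "transf c d = (\<Prod>m\<le>k. iter_arg c d m powr (- (1 + \<delta>) / b m))"

lemma iter_Suc: "iter c d (Suc l) = iter_arg c d l powr (b (Suc l) / b l)"
  by (simp add: iter_arg_def)

definition flow_arg :: "(nat \<Rightarrow> real) \<Rightarrow> real \<Rightarrow> nat \<Rightarrow> real" where
  "flow_arg r t l = (1 - r l) * exp (b l * t)"

definition flow :: "(nat \<Rightarrow> real) \<Rightarrow> real \<Rightarrow> nat \<Rightarrow> real" where
  "flow r t l = r l * iter r (flow_arg r t) l / iter_arg r (flow_arg r t) l"

definition head_prod :: "(nat \<Rightarrow> real) \<Rightarrow> nat \<Rightarrow> real" where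
  "head_prod u m = (\<Prod>j<m. u j)"

definition gen_mult :: "(nat \<Rightarrow> real) \<Rightarrow> (nat \<Rightarrow> nat) \<Rightarrow> real" where
  "gen_mult u x = (\<Sum>l\<le>k. real (x l) * b l * (head_prod u (Suc l) - head_prod u l))
     - (1 + \<delta>) * (\<Sum>m\<le>k. 1 - head_prod u (Suc m))"

text \<open>This stands for the expected monomial with base \<open>r\<close> at time
  \<open>t\<close> when the chain starts with excess \<open>x\<close>: \<open>transf\<close> is the
  value for excess 0, and every unit of excess in coordinate \<open>l\<close> adds a factor
  \<open>flow r t l\<close>.\<close>

definition flow_fun :: "(nat \<Rightarrow> real) \<Rightarrow> (nat \<Rightarrow> nat) \<Rightarrow> real \<Rightarrow> real" where
  "flow_fun r x t = transf r (flow_arg r t) * (\<Prod>l\<le>k. flow r t l ^ x l)"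

text \<open>Serves both uses of \<open>iter\<close>: in the limit some \<open>d l\<close> may be 0,
  in the generating function \<open>d l\<close> is 0 where \<open>r l = 1\<close>. Positivity of
  \<open>c l + d l\<close> is what the two cases share.\<close>

lemma iter_pos_general:
  assumes "\<And>j. j \<le> k \<Longrightarrow> 0 \<le> c j" "\<And>j. j \<le> k \<Longrightarrow> 0 \<le> d j" "\<And>j. j \<le> k \<Longrightarrow> 0 < c j + d j"
  shows "l \<le> k \<Longrightarrow> 0 < iter c d l \<and> 0 < iter_arg c d l"
proof (induction l)
  case 0
  then show ?case using assms(3)[of 0] by (simp add: iter_arg_def)
next
  case (Suc l)
  then have "iter_arg c d l \<noteq> 0" by auto
  then have p: "0 < iter c d (Suc l)" unfolding iter_Suc by simp
  moreover have "0 < c (Suc l) * iter c d (Suc l) + d (Suc l)"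
  proof (cases "c (Suc l) = 0")
    case True
    then show ?thesis using assms(3)[OF Suc.prems] by simp
  next
    case False
    then have "0 < c (Suc l)" using assms(1)[OF Suc.prems] by simp
    then show ?thesis using assms(2)[OF Suc.prems] p by (intro add_pos_nonneg mult_pos_pos)
  qed
  ultimately show ?case unfolding iter_arg_def by blast
qed

context
  fixes r :: "nat \<Rightarrow> real"
  assumes r: "\<And>l. l \<le> k \<Longrightarrow> 0 < r l \<and> r l \<le> 1"
begin

lemma iter_pos: "l \<le> k \<Longrightarrow> 0 < iter r (flow_arg r t) l \<and> 0 < iter_arg r (flow_arg r t) l"
  by (rule iter_pos_general) (use r in \<open>force simp: flow_arg_def add_pos_nonneg\<close>)+

lemma head_prod_Suc: "head_prod u (Suc m) = u m * head_prod u m"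
  by (simp add: head_prod_def)

text \<open>Write Y, V, S for \<open>iter\<close>, \<open>iter_arg\<close>,
  \<open>head_prod (flow r t)\<close>. The exponential part of V at \<open>l\<close> grows at rate
  \<open>b l\<close>, the part \<open>r l\<close> Y at rate \<open>b l\<close> (1 - S l), so V' =
  \<open>b l\<close> (V - S l \<open>r l\<close> Y), and \<open>r l\<close> Y =
  \<open>flow r t l\<close> V by the choice of \<open>flow\<close>. Raising V to the power
  \<open>b (Suc l) / b l\<close> then replaces the factor \<open>b l\<close> by
  \<open>b (Suc l)\<close>.\<close>

lemma deriv_iter:
  "l \<le> k \<Longrightarrow>
    ((\<lambda>t. iter r (flow_arg r t) l) has_real_derivative b l * (1 - head_prod (flow r t) l) * iter r (flow_arg r t) l) (at t) \<and>
    ((\<lambda>t. iter_arg r (flow_arg r t) l) has_real_derivative b l * (1 - head_prod (flow r t) (Suc l)) * iter_arg r (flow_arg r t) l) (at t)"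
proof (induction l)
  case 0
  have "iter_arg r (flow_arg r t) 0 > 0" using iter_pos[of 0] by simp
  then show ?case
    by (auto intro!: derivative_eq_intros simp: iter_arg_def flow_arg_def head_prod_def flow_def field_simps)
next
  case (Suc l)
  let ?v = "\<lambda>t. iter_arg r (flow_arg r t) l" and ?s = "head_prod (flow r t) (Suc l)"
  let ?y = "\<lambda>t. iter r (flow_arg r t) (Suc l)"
  have pos: "0 < ?v t" "b l > 0" using iter_pos[of l] b_pos[of l] Suc.prems by auto
  have yp: "0 < ?y t" "0 < iter_arg r (flow_arg r t) (Suc l)" using iter_pos[OF Suc.prems] by auto
  have dv: "(?v has_real_derivative b l * (1 - ?s) * ?v t) (at t)" using Suc by simp
  have dy: "(?y has_real_derivative b (Suc l) * (1 - ?s) * ?y t) (at t)"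
  proof -
    define \<beta> where "\<beta> = b (Suc l) / b l"
    have "((\<lambda>t. ?v t powr \<beta>) has_real_derivative \<beta> * ?v t powr (\<beta> - of_nat 1) * (b l * (1 - ?s) * ?v t)) (at t)"
      by (rule DERIV_fun_powr[OF dv pos(1)])
    also have "\<beta> * ?v t powr (\<beta> - of_nat 1) * (b l * (1 - ?s) * ?v t) = (\<beta> * b l) * (1 - ?s) * ?v t powr \<beta>"
      using pos by (simp add: powr_diff)
    finally show ?thesis using pos unfolding iter_Suc \<beta>_def[symmetric] by (simp add: \<beta>_def)
  qed
  have "((\<lambda>t. r (Suc l) * ?y t + (1 - r (Suc l)) * exp (b (Suc l) * t)) has_real_derivative
      b (Suc l) * (1 - head_prod (flow r t) (Suc (Suc l))) * iter_arg r (flow_arg r t) (Suc l)) (at t)"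
    apply (rule derivative_eq_intros dy refl)+
    using yp unfolding head_prod_Suc[of _ "Suc l"] flow_def
    by (simp add: iter_arg_def flow_arg_def field_simps del: iter.simps)
  then have "((\<lambda>t. iter_arg r (flow_arg r t) (Suc l)) has_real_derivative
      b (Suc l) * (1 - head_prod (flow r t) (Suc (Suc l))) * iter_arg r (flow_arg r t) (Suc l)) (at t)"
    unfolding iter_arg_def by (simp add: flow_arg_def[of _ _ "Suc l"] del: iter.simps)
  with dy show ?case by blast
qed

text \<open>The logarithmic derivative of a quotient is the difference of the two rates in
  \<open>deriv_iter\<close>.\<close>

lemma deriv_flow:
  assumes "l \<le> k"
  shows "((\<lambda>t. flow r t l) has_real_derivative
     b l * (head_prod (flow r t) (Suc l) - head_prod (flow r t) l) * flow r t l) (at t)"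
proof -
  have p: "0 < iter_arg r (flow_arg r t) l" using iter_pos[OF assms] by auto
  define S S' where "S = head_prod (flow r t) l" and "S' = head_prod (flow r t) (Suc l)"
  have "((\<lambda>t. r l * iter r (flow_arg r t) l / iter_arg r (flow_arg r t) l) has_real_derivative
     b l * (S' - S) * (r l * iter r (flow_arg r t) l / iter_arg r (flow_arg r t) l)) (at t)"
    apply (rule derivative_eq_intros deriv_iter[THEN conjunct1] deriv_iter[THEN conjunct2] assms refl)+
    using p by (auto simp: field_simps S_def S'_def)
  then show ?thesis by (simp add: flow_def[of r _ l] S_def S'_def)
qed

text \<open>The exponents \<open>- (1 + \<delta>) / b m\<close> cancel the factor \<open>b m\<close>
  in the growth rate of \<open>iter_arg\<close>, which is why the sum carries no weights.\<close>

lemma deriv_transf: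
  "((\<lambda>t. transf r (flow_arg r t)) has_real_derivative
     - (1 + \<delta>) * (\<Sum>m\<le>k. 1 - head_prod (flow r t) (Suc m)) * transf r (flow_arg r t)) (at t)"
proof -
  have d: "((\<lambda>t. iter_arg r (flow_arg r t) m powr (- (1 + \<delta>) / b m)) has_real_derivative
     - (1 + \<delta>) * (1 - head_prod (flow r t) (Suc m)) * iter_arg r (flow_arg r t) m powr (- (1 + \<delta>) / b m)) (at t)"
    if "m \<in> {..k}" for m
  proof -
    have p: "0 < iter_arg r (flow_arg r t) m" "0 < b m" using iter_pos[of m] b_pos[of m] that by auto
    define \<gamma> where "\<gamma> = - (1 + \<delta>) / b m"
    have "((\<lambda>t. iter_arg r (flow_arg r t) m powr \<gamma>) has_real_derivative
      \<gamma> * iter_arg r (flow_arg r t) m powr (\<gamma> - of_nat 1) * (b m * (1 - head_prod (flow r t) (Suc m)) * iter_arg r (flow_arg r t) m)) (at t)"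
      using that by (intro DERIV_fun_powr deriv_iter[THEN conjunct2] p) auto
    also have "\<gamma> * iter_arg r (flow_arg r t) m powr (\<gamma> - of_nat 1) * (b m * (1 - head_prod (flow r t) (Suc m)) * iter_arg r (flow_arg r t) m)
        = (\<gamma> * b m) * (1 - head_prod (flow r t) (Suc m)) * iter_arg r (flow_arg r t) m powr \<gamma>"
      using p by (simp add: powr_diff)
    finally show ?thesis using p by (simp add: \<gamma>_def)
  qed
  have "((\<lambda>t. transf r (flow_arg r t)) has_real_derivative
     (\<Sum>m\<le>k. - (1 + \<delta>) * (1 - head_prod (flow r t) (Suc m)) * iter_arg r (flow_arg r t) m powr (- (1 + \<delta>) / b m)
        * (\<Prod>j\<in>{..k} - {m}. iter_arg r (flow_arg r t) j powr (- (1 + \<delta>) / b j)))) (at t)"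
    unfolding transf_def by (rule has_field_derivative_prod[OF d])
  also have "(\<Sum>m\<le>k. - (1 + \<delta>) * (1 - head_prod (flow r t) (Suc m)) * iter_arg r (flow_arg r t) m powr (- (1 + \<delta>) / b m)
        * (\<Prod>j\<in>{..k} - {m}. iter_arg r (flow_arg r t) j powr (- (1 + \<delta>) / b j)))
     = (\<Sum>m\<le>k. - (1 + \<delta>) * (1 - head_prod (flow r t) (Suc m)) * transf r (flow_arg r t))"
    unfolding transf_def by (intro sum.cong refl) (simp add: prod.remove[of "{..k}"] mult.assoc)
  finally show ?thesis by (simp add: sum_distrib_left sum_distrib_right)
qed

lemma flow_pos: "l \<le> k \<Longrightarrow> 0 < flow r t l"
  using r[of l] iter_pos[of l t] by (simp add: flow_def)

text \<open>The backward equation of the chain: the contributions of \<open>deriv_transf\<close> and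
  \<open>deriv_flow\<close> add up to the generator multiplier of the monomial with base
  \<open>flow r t\<close>.\<close>

lemma deriv_flow_fun: "((\<lambda>t. flow_fun r x t) has_real_derivative flow_fun r x t * gen_mult (flow r t) x) (at t)"
proof -
  have d: "((\<lambda>t. flow r t l ^ x l) has_real_derivative
     real (x l) * b l * (head_prod (flow r t) (Suc l) - head_prod (flow r t) l) * flow r t l ^ x l) (at t)"
    if "l \<in> {..k}" for l
    by (rule DERIV_cong[OF DERIV_power[OF deriv_flow]]) (use that in \<open>cases "x l"; auto\<close>)+
  have "((\<lambda>t. \<Prod>l\<le>k. flow r t l ^ x l) has_real_derivative
     (\<Sum>l\<le>k. real (x l) * b l * (head_prod (flow r t) (Suc l) - head_prod (flow r t) l) * flow r t l ^ x l
       * (\<Prod>j\<in>{..k} - {l}. flow r t j ^ x j))) (at t)"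
    by (rule has_field_derivative_prod[OF d])
  also have "(\<Sum>l\<le>k. real (x l) * b l * (head_prod (flow r t) (Suc l) - head_prod (flow r t) l) * flow r t l ^ x l
       * (\<Prod>j\<in>{..k} - {l}. flow r t j ^ x j))
     = (\<Sum>l\<le>k. real (x l) * b l * (head_prod (flow r t) (Suc l) - head_prod (flow r t) l)) * (\<Prod>l\<le>k. flow r t l ^ x l)"
    unfolding sum_distrib_right by (intro sum.cong refl) (simp add: prod.remove[of "{..k}"] mult.assoc)
  finally have dp: "((\<lambda>t. \<Prod>l\<le>k. flow r t l ^ x l) has_real_derivative
     (\<Sum>l\<le>k. real (x l) * b l * (head_prod (flow r t) (Suc l) - head_prod (flow r t) l)) * (\<Prod>l\<le>k. flow r t l ^ x l)) (at t)" .
  show ?thesis unfolding flow_fun_def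
    apply (rule derivative_eq_intros deriv_transf dp refl)+
    by (simp add: gen_mult_def algebra_simps)
qed

text \<open>\<open>iter_arg\<close> is a convex combination, with weights \<open>r l\<close> and
  \<open>1 - r l\<close>, of \<open>iter\<close> and \<open>exp (b l * t)\<close>; the power
  \<open>b (Suc l) / b l\<close> carries both bounds to the next index.\<close>

lemma iter_bounds:
  assumes t: "0 \<le> t"
  shows "l \<le> k \<Longrightarrow> 1 \<le> iter r (flow_arg r t) l \<and> iter r (flow_arg r t) l \<le> exp (b l * t)
     \<and> 1 \<le> iter_arg r (flow_arg r t) l \<and> iter_arg r (flow_arg r t) l \<le> exp (b l * t) \<and> iter r (flow_arg r t) l \<le> iter_arg r (flow_arg r t) l"
proof (induction l)
  have v: "1 \<le> iter_arg r (flow_arg r t) l \<and> iter_arg r (flow_arg r t) l \<le> exp (b l * t) \<and> iter r (flow_arg r t) l \<le> iter_arg r (flow_arg r t) l"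
    if "l \<le> k" "1 \<le> iter r (flow_arg r t) l" "iter r (flow_arg r t) l \<le> exp (b l * t)" for l
  proof -
    let ?y = "iter r (flow_arg r t) l" and ?e = "exp (b l * t)"
    have "0 \<le> r l" "0 \<le> 1 - r l" using r[of l] that by auto
    then have "0 \<le> (1 - r l) * (?e - ?y)" "0 \<le> r l * (?e - ?y)" using that by auto
    then show ?thesis using that unfolding iter_arg_def flow_arg_def by (simp add: algebra_simps)
  qed
  {
    case 0
    have "0 \<le> b 0 * t" using b_pos[of 0] t by simp
    then show ?case using v[of 0] by simp
  next
    case (Suc l)
    let ?v = "iter_arg r (flow_arg r t) l"
    have IH: "1 \<le> ?v" "?v \<le> exp (b l * t)" using Suc by auto
    have bb: "0 < b (Suc l) / b l" "b l > 0" using beta_bounds[of l] b_pos[of l] Suc.prems by auto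
    have "1 \<le> iter r (flow_arg r t) (Suc l)" unfolding iter_Suc using IH bb by (simp add: ge_one_powr_ge_zero)
    moreover have "iter r (flow_arg r t) (Suc l) \<le> exp (b l * t) powr (b (Suc l) / b l)"
      unfolding iter_Suc using IH bb by (intro powr_mono2) auto
    moreover have "exp (b l * t) powr (b (Suc l) / b l) = exp (b (Suc l) * t)"
      using bb by (simp add: powr_def)
    ultimately show ?case using v[of "Suc l"] Suc.prems by (auto simp del: iter.simps)
  }
qed

text \<open>The characteristic moves inward, so bounds that are uniform over bases below
  \<open>r\<close> hold along all of it.\<close>

lemma flow_le: "0 \<le> t \<Longrightarrow> l \<le> k \<Longrightarrow> flow r t l \<le> r l"
  using iter_bounds[of t l] r[of l] iter_pos[of l t] by (simp add: flow_def field_simps)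

lemma transf_bounds:
  assumes "0 \<le> t" shows "0 \<le> transf r (flow_arg r t)" "transf r (flow_arg r t) \<le> 1"
proof -
  show "0 \<le> transf r (flow_arg r t)" by (simp add: transf_def prod_nonneg)
  show "transf r (flow_arg r t) \<le> 1" unfolding transf_def
  proof (rule prod_le_1, intro conjI)
    fix m assume "m \<in> {..k}"
    then have "1 \<le> iter_arg r (flow_arg r t) m" "0 < b m" using iter_bounds[OF assms] b_pos by auto
    then show "iter_arg r (flow_arg r t) m powr (- (1 + \<delta>) / b m) \<le> 1"
      using powr_mono[of "- (1 + \<delta>) / b m" 0 "iter_arg r (flow_arg r t) m"] delta
      by (auto simp: divide_nonpos_pos)
  qed simp
qed

end

lemma flow_at_0:
  shows "iter r (flow_arg r 0) l = 1" "iter_arg r (flow_arg r 0) l = 1" "transf r (flow_arg r 0) = 1" "flow r 0 l = r l"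
proof -
  have y: "iter r (flow_arg r 0) l = 1" for l
    by (induction l) (auto simp: flow_arg_def)
  then have v: "iter_arg r (flow_arg r 0) l = 1" for l by (simp add: iter_arg_def flow_arg_def)
  show "iter r (flow_arg r 0) l = 1" "iter_arg r (flow_arg r 0) l = 1" "transf r (flow_arg r 0) = 1" "flow r 0 l = r l"
    using y v by (simp_all add: transf_def flow_def)
qed

lemma flow_fun_0: "flow_fun r x 0 = (\<Prod>l\<le>k. r l ^ x l)"
  by (simp add: flow_fun_def flow_at_0)

end

no_notation Infinite_Sum.abs_summable_on (infixr \<open>abs'_summable'_on\<close> 46)

section \<open>The recursion as an adjoint equation\<close>

text \<open>Passes from jump rates, which are differences in \<open>m\<close>, to the form of
  \<open>gen_mult\<close>, where the head products are differenced instead.\<close>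

lemma summation_by_parts:
  fixes B \<sigma> :: "nat \<Rightarrow> real"
  shows "(\<Sum>m<n. (B m - B (Suc m)) * \<sigma> (Suc m)) + B n * \<sigma> (Suc n)
     = (\<Sum>m\<le>n. B m * (\<sigma> (Suc m) - \<sigma> m)) + B 0 * \<sigma> 0"
  by (induction n) (auto simp: algebra_simps)

definition mono_x :: "nat \<Rightarrow> (nat \<Rightarrow> real) \<Rightarrow> (nat \<Rightarrow> nat) \<Rightarrow> real" where
  "mono_x k u x = (\<Prod>l\<le>k. u l ^ x l)"

lemma mono_x_bounds:
  assumes "\<And>l. l \<le> k \<Longrightarrow> 0 \<le> u l \<and> u l \<le> 1"
  shows "0 \<le> mono_x k u x" "mono_x k u x \<le> 1"
  using assms by (auto simp: mono_x_def intro!: prod_nonneg prod_le_1 power_le_one)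

lemma mono_x_add: "mono_x k r (\<lambda>l. x l + y l) = mono_x k r x * mono_x k r y"
  by (simp add: mono_x_def power_add prod.distrib)

lemma mono_x_unit:
  assumes "j \<le> k" shows "mono_x k r (\<lambda>l. if l = j then 1 else 0) = r j"
proof -
  have "mono_x k r (\<lambda>l. if l = j then 1 else 0) = (\<Prod>l\<le>k. if l = j then r l else 1)"
    unfolding mono_x_def by (intro prod.cong) auto
  then show ?thesis using assms by simp
qed

text \<open>The jump rates grow linearly in the index, and a base strictly below 1 absorbs this
  growth because n u^n tends to 0. Uniformity in \<open>v\<close> is needed because the base will
  move along a characteristic.\<close>

lemma linear_mono_x_bounded:
  assumes u: "\<And>l. l \<le> k \<Longrightarrow> 0 \<le> u l \<and> u l < 1"
  shows "\<exists>B. \<forall>v x. (\<forall>l\<le>k. 0 \<le> v l \<and> v l \<le> u l) \<longrightarrow> (\<forall>j\<le>k. real (x j) * mono_x k v x \<le> B)"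
proof -
  have "\<exists>B. \<forall>n::nat. real n * u j ^ n \<le> B" if "j \<le> k" for j
  proof -
    have "(\<lambda>n. real n * u j ^ n) \<longlonglongrightarrow> 0"
      using powser_times_n_limit_0[of "u j"] u[OF that] by simp
    then have "Bseq (\<lambda>n. real n * u j ^ n)" by (rule convergent_imp_Bseq[OF convergentI])
    then obtain B where "\<forall>n. norm (real n * u j ^ n) \<le> B" by (auto simp: Bseq_def)
    then have "\<forall>n. real n * u j ^ n \<le> B" by (metis abs_le_D1 real_norm_def)
    then show ?thesis by blast
  qed
  then obtain C where C: "\<And>j n. j \<le> k \<Longrightarrow> real n * u j ^ n \<le> C j" by metis
  have C0: "0 \<le> C j" if "j \<le> k" for j using C[OF that, of 0] by simp
  show ?thesis
  proof (intro exI[of _ "\<Sum>j\<le>k. C j"] allI impI)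
    fix v :: "nat \<Rightarrow> real" and x :: "nat \<Rightarrow> nat" and j
    assume v: "\<forall>l\<le>k. 0 \<le> v l \<and> v l \<le> u l" and j: "j \<le> k"
    have "mono_x k v x = v j ^ x j * (\<Prod>l\<in>{..k}-{j}. v l ^ x l)"
      unfolding mono_x_def using j by (simp add: prod.remove)
    also have "\<dots> \<le> v j ^ x j * 1"
      using v u j by (intro mult_left_mono prod_le_1 conjI power_le_one zero_le_power)
        (auto, meson less_eq_real_def order_trans)
    also have "\<dots> \<le> u j ^ x j" using v j by (auto intro: power_mono)
    finally have "real (x j) * mono_x k v x \<le> real (x j) * u j ^ x j" by (intro mult_left_mono) auto
    also have "\<dots> \<le> C j" by (rule C[OF j])
    also have "\<dots> \<le> (\<Sum>j\<le>k. C j)" using j C0 by (intro member_le_sum) auto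
    finally show "real (x j) * mono_x k v x \<le> (\<Sum>j\<le>k. C j)" .
  qed
qed

section \<open>Jump rates of the chain and their pairing with monomials\<close>

context tree_params
begin

text \<open>Rate of the jump that raises coordinates 0 to \<open>m\<close> by one when the excess is
  \<open>x\<close>. The sum over \<open>m\<close> telescopes to the total rate
  \<open>(1 + real (x 0)) * b 0 + \<delta>\<close>, since \<open>b k = 1\<close>.\<close>

definition rate :: "(nat \<Rightarrow> nat) \<Rightarrow> nat \<Rightarrow> real" where
  "rate x m = (if m < k then (1 + real (x m)) * b m - (1 + real (x (Suc m))) * b (Suc m)
     else 1 + \<delta> + real (x k))"

text \<open>A jump of type \<open>m\<close> multiplies a monomial by
  \<open>head_prod u (Suc m)\<close>, so the left side is minus the generator multiplier. After
  summation by parts the part of the rates that is constant in \<open>x\<close> collapses to an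
  unweighted sum, because consecutive \<open>b m\<close> all differ by
  \<open>1 + \<delta>\<close>.\<close>

lemma gen_mult_eq:
  assumes "head_prod u 0 = 1"
  shows "((1 + real (x 0)) * b 0 + \<delta>) - (\<Sum>m\<le>k. rate x m * head_prod u (Suc m)) = - gen_mult u x"
proof -
  let ?B = "\<lambda>m. (1 + real (x m)) * b m"
  let ?s = "head_prod u"
  have 1: "(\<Sum>m\<le>k. rate x m * ?s (Suc m))
     = (\<Sum>m<k. (?B m - ?B (Suc m)) * ?s (Suc m)) + ?B k * ?s (Suc k) + \<delta> * ?s (Suc k)"
    unfolding lessThan_Suc_atMost[symmetric] by (simp add: rate_def b_k algebra_simps)
  have 2: "(\<Sum>m<k. (b m - b (Suc m)) * ?s (Suc m)) = (1 + \<delta>) * (\<Sum>m<k. ?s (Suc m))"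
    by (subst sum_distrib_left, intro sum.cong refl, subst b_Suc) simp
  have 3: "(\<Sum>m\<le>k. ?B m * (?s (Suc m) - ?s m))
     = (\<Sum>m\<le>k. real (x m) * b m * (?s (Suc m) - ?s m)) + (\<Sum>m\<le>k. b m * (?s (Suc m) - ?s m))"
    by (simp add: sum.distrib[symmetric] algebra_simps)
  have 4: "(\<Sum>m\<le>k. b m * (?s (Suc m) - ?s m)) = (1 + \<delta>) * (\<Sum>m<k. ?s (Suc m)) + ?s (Suc k) - b 0"
    using summation_by_parts[of b ?s k] 2 assms by (simp add: b_k)
  have 5: "(\<Sum>m\<le>k. 1 - ?s (Suc m)) = real k + 1 - ((\<Sum>m<k. ?s (Suc m)) + ?s (Suc k))"
    unfolding lessThan_Suc_atMost[symmetric] by (simp add: sum_subtractf)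
  have 6: "(\<Sum>m<k. (?B m - ?B (Suc m)) * ?s (Suc m)) + ?B k * ?s (Suc k)
     = (\<Sum>m\<le>k. ?B m * (?s (Suc m) - ?s m)) + ?B 0"
    using summation_by_parts[of ?B ?s k] assms by simp
  define A R X S C x0 b0 where "A = (\<Sum>m\<le>k. real (x m) * b m * (?s (Suc m) - ?s m))"
    and "R = (\<Sum>m\<le>k. rate x m * ?s (Suc m))" and "X = (\<Sum>m<k. ?s (Suc m))" and "S = ?s (Suc k)"
    and "C = (\<Sum>m\<le>k. b m * (?s (Suc m) - ?s m))" and "x0 = real (x 0)" and "b0 = b 0"
  have R: "R = A + C + (1 + x0) * b0 + \<delta> * S"
    using 1 6 3 by (simp add: A_def R_def S_def C_def x0_def b0_def)
  have C: "C = (1 + \<delta>) * X + S - b0" using 4 by (simp add: C_def X_def S_def b0_def)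
  have b0: "b0 = (1 + \<delta>) * real k + 1" by (simp add: b0_def bpar_def algebra_simps)
  have "(1 + x0) * b0 + \<delta> - R = - (A - (1 + \<delta>) * (real k + 1 - (X + S)))"
    unfolding R C by (simp add: b0 algebra_simps)
  then show ?thesis
    unfolding gen_mult_def 5 by (simp only: A_def R_def X_def S_def x0_def b0_def)
qed

text \<open>For admissible \<open>i\<close> the subtraction does not truncate, see \<open>admissible_ge\<close>.\<close>

definition excess :: "(nat \<Rightarrow> nat) \<Rightarrow> nat \<Rightarrow> nat" where
  "excess i l = i l - (k - l + 1)"

definition raise :: "nat \<Rightarrow> (nat \<Rightarrow> nat) \<Rightarrow> nat \<Rightarrow> nat" where
  "raise m i = (\<lambda>l. if l \<le> m then i l + 1 else i l)"

text \<open>Entries beyond \<open>k\<close> are pinned to 0, so that every index tuple is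
  represented by exactly one function and sums can be reindexed along
  \<open>raise m\<close>.\<close>

definition adm_indices :: "(nat \<Rightarrow> nat) set" where
  "adm_indices = {i. admissible k i \<and> (\<forall>l>k. i l = 0)}"

lemma admissible_ge:
  assumes "admissible k i" "l \<le> k" shows "k - l + 1 \<le> i l"
  using assms(2)
proof (induction rule: inc_induct)
  case base
  then show ?case using assms(1) by (simp add: admissible_def)
next
  case (step n)
  then have "i (Suc n) < i n" using assms(1) by (simp add: admissible_def)
  then show ?case using step by linarith
qed

lemma raise_adm_indices:
  assumes "j \<in> adm_indices" "m \<le> k"
  shows "raise m j \<in> adm_indices" "lower m (raise m j) = j" "l \<le> k \<Longrightarrow> excess (raise m j) l = excess j l + (if l \<le> m then 1 else 0)"
proof -
  have a: "admissible k j" using assms by (simp add: adm_indices_def)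
  show "raise m j \<in> adm_indices"
    using assms unfolding adm_indices_def admissible_def raise_def
    by (auto simp: less_SucI)
  show "lower m (raise m j) = j" by (auto simp: lower_def raise_def)
  assume "l \<le> k"
  then show "excess (raise m j) l = excess j l + (if l \<le> m then 1 else 0)"
    using admissible_ge[OF a, of l] by (auto simp: excess_def raise_def)
qed

lemma raise_lower:
  assumes "i \<in> adm_indices" "m \<le> k" shows "raise m (lower m i) = i"
proof
  fix l
  have "l \<le> m \<Longrightarrow> 1 \<le> i l" using admissible_ge[of i l] assms by (auto simp: adm_indices_def)
  then show "raise m (lower m i) l = i l" by (auto simp: raise_def lower_def)
qed

lemma mono_x_raise:
  assumes "j \<in> adm_indices" "m \<le> k"
  shows "mono_x k u (excess (raise m j)) = mono_x k u (excess j) * head_prod u (Suc m)"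
proof -
  have "mono_x k u (excess (raise m j)) = (\<Prod>l\<le>k. u l ^ excess j l * (if l \<in> {..<Suc m} then u l else 1))"
    unfolding mono_x_def by (intro prod.cong refl) (use assms raise_adm_indices(3) in \<open>auto simp: power_add\<close>)
  also have "\<dots> = mono_x k u (excess j) * (\<Prod>l\<in>{..k} \<inter> {..<Suc m}. u l)"
    unfolding prod.distrib mono_x_def by (simp add: prod.inter_restrict)
  also have "{..k} \<inter> {..<Suc m} = {..<Suc m}" using assms by auto
  finally show ?thesis by (simp add: head_prod_def)
qed

end

section \<open>The law of the degrees and its resolvent equation\<close>

locale tree_law = tree_params +
  fixes p :: "(nat \<Rightarrow> nat) \<Rightarrow> real" and q :: "(nat \<Rightarrow> nat) pmf"
  assumes rec: "satisfies_recursion k \<delta> p"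
    and q: "\<And>i. pmf q i = (if \<forall>l>k. i l = 0 then p i else 0)"
begin

lemma p_zero: "\<not> admissible k i \<Longrightarrow> p i = 0"
  using rec by (auto simp: satisfies_recursion_def)

lemma set_pmf_q: "set_pmf q \<subseteq> adm_indices"
  using p_zero by (auto simp: set_pmf_eq q adm_indices_def)

lemma pmf_q_adm_indices: "i \<in> adm_indices \<Longrightarrow> pmf q i = p i"
  by (simp add: q adm_indices_def)

lemma expectation_q:
  fixes F :: "(nat \<Rightarrow> nat) \<Rightarrow> real"
  shows "measure_pmf.expectation q F = (\<Sum>\<^sub>ai\<in>adm_indices. p i * F i)"
proof -
  have "measure_pmf.expectation q F = (\<Sum>\<^sub>ai\<in>UNIV. pmf q i * F i)"
    unfolding measure_pmf_eq_density infsetsum_def by (subst integral_density) auto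
  also have "\<dots> = (\<Sum>\<^sub>ai\<in>adm_indices. p i * F i)"
    using set_pmf_q by (intro infsetsum_cong_neutral) (auto simp: pmf_q_adm_indices set_pmf_eq)
  finally show ?thesis .
qed

lemma summable_q:
  fixes F :: "(nat \<Rightarrow> nat) \<Rightarrow> real"
  assumes "\<And>i. i \<in> adm_indices \<Longrightarrow> \<bar>F i\<bar> \<le> B"
  shows "(\<lambda>i. p i * F i) abs_summable_on adm_indices"
proof (rule abs_summable_on_comparison_test)
  show "(\<lambda>i. B * pmf q i) abs_summable_on adm_indices"
    by (intro abs_summable_on_cmult_right pmf_abs_summable)
  fix i assume "i \<in> adm_indices"
  then show "norm (p i * F i) \<le> norm (B * pmf q i)"
    using assms[of i] pmf_nonneg[of q i] by (simp add: pmf_q_adm_indices abs_mult mult.commute)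
      (metis abs_ge_zero abs_of_nonneg mult.commute mult_left_mono order_trans)
qed

text \<open>The offsets in the recursion are the minimal admissible entries: measured by the excess
  of the predecessor \<open>lower m i\<close>, its coefficients are the jump rates out of that
  predecessor.\<close>

lemma recursion_rate:
  assumes i: "i \<in> adm_indices"
  shows "\<tau> * p i = (\<Sum>m\<le>k. rate (excess (lower m i)) m * p (lower m i))
      - ((1 + real (excess i 0)) * b 0 + \<delta>) * p i + \<tau> * of_bool (\<forall>l\<le>k. i l = k - l + 1)"
proof -
  have a: "admissible k i" using i by (simp add: adm_indices_def)
  have "p i = (real (i k) - 1 + \<delta>) / \<tau> * p (lower k i)
        + (\<Sum>m<k. ((real (i m) - 1 - real k + real m) * b m
                   - (real (i (m + 1)) - real k + real m + 1) * b (m + 1)) / \<tau>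
                 * p (lower m i))
        - ((real (i 0) - real k) * b 0 + \<delta>) / \<tau> * p i
        + of_bool (\<forall>l\<le>k. i l = k - l + 1)"
    by (rule rec[unfolded satisfies_recursion_def, THEN conjunct2, rule_format, OF a])
  then have "\<tau> * p i = \<tau> * \<dots>" by simp
  also have "\<dots> = (real (i k) - 1 + \<delta>) * p (lower k i)
        + (\<Sum>m<k. ((real (i m) - 1 - real k + real m) * b m
                   - (real (i (m + 1)) - real k + real m + 1) * b (m + 1))
                 * p (lower m i))
        - ((real (i 0) - real k) * b 0 + \<delta>) * p i
        + \<tau> * of_bool (\<forall>l\<le>k. i l = k - l + 1)"
  proof -
    have "\<tau> * (x / \<tau> * y) = x * y" for x y using tau_pos by simp
    then show ?thesis by (simp only: distrib_left right_diff_distrib sum_distrib_left)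
  qed
  also have "(\<Sum>m<k. ((real (i m) - 1 - real k + real m) * b m
                   - (real (i (m + 1)) - real k + real m + 1) * b (m + 1)) * p (lower m i))
     = (\<Sum>m<k. rate (excess (lower m i)) m * p (lower m i))"
  proof (intro sum.cong refl)
    fix m assume m: "m \<in> {..<k}"
    show "((real (i m) - 1 - real k + real m) * b m
                   - (real (i (m + 1)) - real k + real m + 1) * b (m + 1)) * p (lower m i)
         = rate (excess (lower m i)) m * p (lower m i)"
    \<comment> \<open>For an inadmissible predecessor \<open>excess\<close> may truncate and the two
      coefficients may differ, but \<open>p\<close> vanishes there.\<close>
    proof (cases "admissible k (lower m i)")
      case True
      have "real (excess (lower m i) m) = real (i m) - 2 - real k + real m"
        using admissible_ge[OF True, of m] m by (auto simp: excess_def lower_def of_nat_diff)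
      moreover have "real (excess (lower m i) (Suc m)) = real (i (Suc m)) - real k + real m"
        using admissible_ge[OF True, of "Suc m"] m by (auto simp: excess_def lower_def of_nat_diff)
      ultimately show ?thesis using m by (simp add: rate_def) (simp add: algebra_simps)
    qed (simp add: p_zero)
  qed
  also have "(real (i k) - 1 + \<delta>) * p (lower k i) = rate (excess (lower k i)) k * p (lower k i)"
  proof (cases "admissible k (lower k i)")
    case True
    have "real (excess (lower k i) k) = real (i k) - 2"
      using admissible_ge[OF True, of k] by (auto simp: excess_def lower_def of_nat_diff)
    then show ?thesis by (simp add: rate_def)
  qed (simp add: p_zero)
  also have "real (i 0) - real k = 1 + real (excess i 0)"
    using admissible_ge[OF a, of 0] by (auto simp: excess_def of_nat_diff)
  finally show ?thesis
    unfolding lessThan_Suc_atMost[symmetric] by simp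
qed

text \<open>The recursion paired with a monomial. The inflow is resummed over predecessors, and
  \<open>gen_mult_eq\<close> recognises the outflow minus the inflow. The strict bound
  \<open>u l < 1\<close> makes the linearly growing terms bounded, so every piece is absolutely
  summable and the sum may be split.\<close>

lemma adjoint:
  assumes u: "\<And>l. l \<le> k \<Longrightarrow> 0 \<le> u l \<and> u l < 1"
  shows "measure_pmf.expectation q (\<lambda>i. mono_x k u (excess i) * (\<tau> - gen_mult u (excess i))) = \<tau>"
proof -
  obtain B where B: "\<And>x j. j \<le> k \<Longrightarrow> real (x j) * mono_x k u x \<le> B"
  proof -
    from linear_mono_x_bounded[of k u, OF u] obtain B where
      "\<forall>v x. (\<forall>l\<le>k. 0 \<le> v l \<and> v l \<le> u l) \<longrightarrow> (\<forall>j\<le>k. real (x j) * mono_x k v x \<le> B)" by auto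
    then show ?thesis using that[of B] u by simp
  qed
  have m0: "0 \<le> mono_x k u x" "mono_x k u x \<le> 1" for x
    using mono_x_bounds[of k u x] u by (simp_all add: less_imp_le)
  have Bx: "\<bar>real (x j) * c * mono_x k u x\<bar> \<le> \<bar>c\<bar> * B" if "j \<le> k" for x j c
  proof -
    have "\<bar>real (x j) * c * mono_x k u x\<bar> = \<bar>c\<bar> * (real (x j) * mono_x k u x)"
      using m0(1)[of x] by (simp add: abs_mult)
    then show ?thesis using B[OF that, of x] by (simp add: mult_left_mono)
  qed
  have Bc: "\<bar>c * mono_x k u x\<bar> \<le> \<bar>c\<bar>" for x c
    using m0[of x] by (simp add: abs_mult mult_left_le)
  let ?F = "\<lambda>i. mono_x k u (excess i)"
  have ss1: "\<bar>head_prod u m\<bar> \<le> 1" if "m \<le> Suc k" for m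
  proof -
    have "0 \<le> head_prod u m" "head_prod u m \<le> 1"
      using u that unfolding head_prod_def by (auto intro!: prod_nonneg prod_le_1 simp: less_imp_le)
    then show ?thesis by simp
  qed
  have rb: "\<exists>C. \<forall>x. \<bar>rate x m * mono_x k u x\<bar> \<le> C" if "m \<le> k" for m
  proof (cases "m < k")
    case True
    have "\<bar>rate x m * mono_x k u x\<bar> \<le> \<bar>b m - b (Suc m)\<bar> + \<bar>b m\<bar> * B + \<bar>b (Suc m)\<bar> * B" for x
    proof -
      have "rate x m * mono_x k u x = (b m - b (Suc m)) * mono_x k u x
          + real (x m) * b m * mono_x k u x - real (x (Suc m)) * b (Suc m) * mono_x k u x"
        using True by (simp add: rate_def algebra_simps)
      then show ?thesis
        using Bc[of "b m - b (Suc m)" x] Bx[of m x "b m"] Bx[of "Suc m" x "b (Suc m)"] True by linarith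
    qed
    then show ?thesis by blast
  next
    case False
    then have "m = k" using that by simp
    have "\<bar>rate x m * mono_x k u x\<bar> \<le> \<bar>1 + \<delta>\<bar> + \<bar>1\<bar> * B" for x
    proof -
      have "rate x m * mono_x k u x = (1 + \<delta>) * mono_x k u x + real (x k) * 1 * mono_x k u x"
        using \<open>m = k\<close> by (simp add: rate_def algebra_simps)
      then show ?thesis
        using Bc[of "1 + \<delta>" x] Bx[of k x 1] by linarith
    qed
    then show ?thesis by blast
  qed
  have rb': "\<exists>C. \<forall>x. \<bar>rate x m * (mono_x k u x * head_prod u (Suc m))\<bar> \<le> C" if "m \<le> k" for m
  proof -
    obtain C where C: "\<And>x. \<bar>rate x m * mono_x k u x\<bar> \<le> C" using rb[OF \<open>m \<le> k\<close>] by blast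
    have "\<bar>rate x m * (mono_x k u x * head_prod u (Suc m))\<bar> \<le> C" for x
    proof -
      have "\<bar>rate x m * (mono_x k u x * head_prod u (Suc m))\<bar> = \<bar>rate x m * mono_x k u x\<bar> * \<bar>head_prod u (Suc m)\<bar>"
        by (simp add: abs_mult)
      also have "\<dots> \<le> C * 1" using C[of x] ss1[of "Suc m"] that by (intro mult_mono) auto
      finally show ?thesis by simp
    qed
    then show ?thesis by blast
  qed
  have in_term: "(\<lambda>i. rate (excess (lower m i)) m * p (lower m i) * ?F i) abs_summable_on adm_indices \<and>
      (\<Sum>\<^sub>ai\<in>adm_indices. rate (excess (lower m i)) m * p (lower m i) * ?F i)
        = (\<Sum>\<^sub>aj\<in>adm_indices. p j * (rate (excess j) m * (?F j * head_prod u (Suc m))))" if m: "m \<le> k" for m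
  proof -
    let ?\<phi> = "\<lambda>j. p j * (rate (excess j) m * (?F j * head_prod u (Suc m)))"
    let ?\<psi> = "\<lambda>i. rate (excess (lower m i)) m * p (lower m i) * ?F i"
    have inj: "inj_on (raise m) adm_indices" using raise_adm_indices(2)[OF _ m] by (metis inj_onI)
    have bij: "bij_betw (raise m) adm_indices (raise m ` adm_indices)" using inj by (simp add: bij_betw_def)
    have eq: "?\<psi> (raise m j) = ?\<phi> j" if "j \<in> adm_indices" for j
      using raise_adm_indices[OF that m] mono_x_raise[OF that m] by simp
    obtain C where "\<And>x. \<bar>rate x m * (mono_x k u x * head_prod u (Suc m))\<bar> \<le> C" using rb'[OF m] by blast
    then have "?\<phi> abs_summable_on adm_indices" by (intro summable_q)
    then have "(\<lambda>j. ?\<psi> (raise m j)) abs_summable_on adm_indices"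
      using eq by (simp cong: abs_summable_on_cong)
    then have s: "?\<psi> abs_summable_on (raise m ` adm_indices)"
      using abs_summable_on_reindex_bij_betw[OF bij, of ?\<psi>] by simp
    \<comment> \<open>An index that is not hit by \<open>raise m\<close> has no admissible
      predecessor, so reindexing loses no mass.\<close>
    have z: "?\<psi> i = 0" if "i \<in> adm_indices - raise m ` adm_indices" for i
    proof -
      have "lower m i \<notin> adm_indices" using that raise_lower[of i m] m by force
      moreover have "\<forall>l>k. lower m i l = 0" using that m by (auto simp: adm_indices_def lower_def)
      ultimately have "\<not> admissible k (lower m i)" by (auto simp: adm_indices_def)
      then show ?thesis by (simp add: p_zero)
    qed
    have sub: "raise m ` adm_indices \<subseteq> adm_indices" using raise_adm_indices(1) m by auto
    have "?\<psi> abs_summable_on adm_indices \<longleftrightarrow> ?\<psi> abs_summable_on (raise m ` adm_indices)"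
      using z sub by (intro abs_summable_on_cong_neutral) auto
    moreover have "infsetsum ?\<psi> adm_indices = infsetsum ?\<psi> (raise m ` adm_indices)"
      using z sub by (intro infsetsum_cong_neutral) auto
    moreover have "infsetsum ?\<psi> (raise m ` adm_indices) = (\<Sum>\<^sub>aj\<in>adm_indices. ?\<psi> (raise m j))"
      by (rule infsetsum_reindex_bij_betw[OF bij, symmetric])
    moreover have "(\<Sum>\<^sub>aj\<in>adm_indices. ?\<psi> (raise m j)) = infsetsum ?\<phi> adm_indices"
      by (rule infsetsum_cong) (use eq in auto)
    ultimately show ?thesis using s by simp
  qed
  \<comment> \<open>The starting index of the chain. Its excess is 0 and its monomial is 1, which
    produces the right-hand side \<open>\<tau>\<close>.\<close>
  define st :: "nat \<Rightarrow> nat" where "st l = (if l \<le> k then k - l + 1 else 0)" for l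
  have stA: "st \<in> adm_indices" by (auto simp: adm_indices_def admissible_def st_def)
  have st1: "?F st = 1" by (auto simp: mono_x_def excess_def st_def intro!: prod.neutral)
  let ?S = "\<lambda>i. \<tau> * of_bool (\<forall>l\<le>k. i l = k - l + 1) * ?F i"
  have st_iff: "(\<forall>l\<le>k. i l = k - l + 1) \<longleftrightarrow> i = st" if "i \<in> adm_indices" for i
    using that by (auto simp: adm_indices_def st_def fun_eq_iff)
  have S0: "?S i = (if i = st then \<tau> else 0)" if "i \<in> adm_indices" for i
    using st_iff[OF that] st1 by auto
  have S: "?S abs_summable_on adm_indices" "infsetsum ?S adm_indices = \<tau>"
  proof -
    have "?S abs_summable_on adm_indices \<longleftrightarrow> (\<lambda>i. \<tau>) abs_summable_on {st}"
      using S0 stA by (intro abs_summable_on_cong_neutral) auto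
    then show "?S abs_summable_on adm_indices" by simp
    have "infsetsum ?S adm_indices = infsetsum (\<lambda>i. \<tau>) {st}"
      using S0 stA by (intro infsetsum_cong_neutral) auto
    then show "infsetsum ?S adm_indices = \<tau>" by simp
  qed
  have sF: "(\<lambda>i. p i * (\<tau> * ?F i)) abs_summable_on adm_indices"
    by (rule summable_q[of _ "\<bar>\<tau>\<bar>"]) (rule Bc)
  let ?Q = "\<lambda>i. ((1 + real (excess i 0)) * b 0 + \<delta>) * ?F i"
  have sQ: "(\<lambda>i. p i * ?Q i) abs_summable_on adm_indices"
  proof (rule summable_q)
    fix i
    have "?Q i = (b 0 + \<delta>) * ?F i + real (excess i 0) * b 0 * ?F i" by (simp add: algebra_simps)
    then show "\<bar>?Q i\<bar> \<le> \<bar>b 0 + \<delta>\<bar> + \<bar>b 0\<bar> * B"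
      using Bc[of "b 0 + \<delta>" "excess i"] Bx[of 0 "excess i" "b 0"] by linarith
  qed
  have sR: "(\<lambda>i. p i * (rate (excess i) m * (?F i * head_prod u (Suc m)))) abs_summable_on adm_indices" if "m \<le> k" for m
  proof -
    obtain C where "\<And>x. \<bar>rate x m * (mono_x k u x * head_prod u (Suc m))\<bar> \<le> C" using rb'[OF \<open>m \<le> k\<close>] by blast
    then show ?thesis by (intro summable_q)
  qed
  have sumR: "(\<lambda>i. \<Sum>m\<le>k. h m i) abs_summable_on adm_indices \<and> (\<Sum>\<^sub>ai\<in>adm_indices. \<Sum>m\<le>k. h m i) = (\<Sum>m\<le>k. \<Sum>\<^sub>ai\<in>adm_indices. h m i)"
    if "\<And>m. m \<le> k \<Longrightarrow> h m abs_summable_on adm_indices" for h :: "nat \<Rightarrow> (nat \<Rightarrow> nat) \<Rightarrow> real"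
    using that unfolding Infinite_Set_Sum.abs_summable_on_def infsetsum_def
    by (auto intro!: Bochner_Integration.integrable_sum Bochner_Integration.integral_sum)
  have 1: "(\<Sum>\<^sub>ai\<in>adm_indices. p i * (\<tau> * ?F i))
      = (\<Sum>m\<le>k. \<Sum>\<^sub>ai\<in>adm_indices. rate (excess (lower m i)) m * p (lower m i) * ?F i)
        - (\<Sum>\<^sub>ai\<in>adm_indices. p i * ?Q i) + \<tau>"
  proof -
    have "(\<Sum>\<^sub>ai\<in>adm_indices. p i * (\<tau> * ?F i))
       = (\<Sum>\<^sub>ai\<in>adm_indices. ((\<Sum>m\<le>k. rate (excess (lower m i)) m * p (lower m i) * ?F i) - p i * ?Q i) + ?S i)"
    proof (rule infsetsum_cong[OF _ refl])
      fix i assume "i \<in> adm_indices"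
      then have "p i * (\<tau> * ?F i) = (\<tau> * p i) * ?F i" by simp
      also have "\<dots> = ((\<Sum>m\<le>k. rate (excess (lower m i)) m * p (lower m i)) * ?F i - p i * ?Q i) + ?S i"
        unfolding recursion_rate[OF \<open>i \<in> adm_indices\<close>] by (simp only: algebra_simps)
      finally show "p i * (\<tau> * ?F i) = ((\<Sum>m\<le>k. rate (excess (lower m i)) m * p (lower m i) * ?F i) - p i * ?Q i) + ?S i"
        by (simp only: sum_distrib_right)
    qed
    also have "\<dots> = (\<Sum>m\<le>k. \<Sum>\<^sub>ai\<in>adm_indices. rate (excess (lower m i)) m * p (lower m i) * ?F i)
        - (\<Sum>\<^sub>ai\<in>adm_indices. p i * ?Q i) + \<tau>"
    proof -
      note s = sumR[of "\<lambda>m i. rate (excess (lower m i)) m * p (lower m i) * ?F i"]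
      have s1: "(\<lambda>i. \<Sum>m\<le>k. rate (excess (lower m i)) m * p (lower m i) * ?F i) abs_summable_on adm_indices"
        using s in_term by blast
      have s2: "(\<Sum>\<^sub>ai\<in>adm_indices. \<Sum>m\<le>k. rate (excess (lower m i)) m * p (lower m i) * ?F i)
         = (\<Sum>m\<le>k. \<Sum>\<^sub>ai\<in>adm_indices. rate (excess (lower m i)) m * p (lower m i) * ?F i)"
        using s in_term by blast
      show ?thesis
        by (simp only: infsetsum_add[OF abs_summable_on_diff[OF s1 sQ] S(1)] infsetsum_diff[OF s1 sQ] S(2) s2)
    qed
    finally show ?thesis .
  qed
  have 2: "(\<Sum>m\<le>k. \<Sum>\<^sub>ai\<in>adm_indices. rate (excess (lower m i)) m * p (lower m i) * ?F i)
      = (\<Sum>m\<le>k. \<Sum>\<^sub>ai\<in>adm_indices. p i * (rate (excess i) m * (?F i * head_prod u (Suc m))))"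
    using in_term by (intro sum.cong refl) auto
  note s3 = sumR[of "\<lambda>m i. p i * (rate (excess i) m * (?F i * head_prod u (Suc m)))", OF sR]
  have "measure_pmf.expectation q (\<lambda>i. mono_x k u (excess i) * (\<tau> - gen_mult u (excess i)))
     = (\<Sum>\<^sub>ai\<in>adm_indices. (p i * (\<tau> * ?F i) + p i * ?Q i) - (\<Sum>m\<le>k. p i * (rate (excess i) m * (?F i * head_prod u (Suc m)))))"
    unfolding expectation_q
  proof (rule infsetsum_cong[OF _ refl])
    fix i assume "i \<in> adm_indices"
    have "p i * (?F i * (\<tau> - gen_mult u (excess i))) = p i * (?F i * (\<tau> +
         (((1 + real (excess i 0)) * b 0 + \<delta>) - (\<Sum>m\<le>k. rate (excess i) m * head_prod u (Suc m)))))"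
      by (subst gen_mult_eq) (auto simp: head_prod_def)
    also have "\<dots> = (p i * (\<tau> * ?F i) + p i * ?Q i) - (\<Sum>m\<le>k. p i * (rate (excess i) m * (?F i * head_prod u (Suc m))))"
      by (simp add: algebra_simps sum_distrib_left)
    finally show "p i * (?F i * (\<tau> - gen_mult u (excess i))) = (p i * (\<tau> * ?F i) + p i * ?Q i)
       - (\<Sum>m\<le>k. p i * (rate (excess i) m * (?F i * head_prod u (Suc m))))" .
  qed
  also have "\<dots> = (\<Sum>\<^sub>ai\<in>adm_indices. p i * (\<tau> * ?F i)) + (\<Sum>\<^sub>ai\<in>adm_indices. p i * ?Q i)
      - (\<Sum>m\<le>k. \<Sum>\<^sub>ai\<in>adm_indices. p i * (rate (excess i) m * (?F i * head_prod u (Suc m))))"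
    by (simp only: infsetsum_diff[OF abs_summable_on_add[OF sF sQ] s3[THEN conjunct1]] infsetsum_add[OF sF sQ] s3[THEN conjunct2])
  also have "\<dots> = \<tau>" unfolding 1 2 by simp
  finally show ?thesis .
qed

end

section \<open>The generating function of the degrees\<close>

lemma set_integrable_exp_neg:
  fixes a :: real assumes "0 < a"
  shows "set_integrable lborel {0..} (\<lambda>t. exp (- (a * t)))"
proof -
  have lim: "((\<lambda>t. - exp (- (a * t)) / a) \<longlongrightarrow> 0) at_top"
    using assms by real_asymp
  have "(\<integral>\<^sup>+t. ennreal (exp (- (a * t))) * indicator {0..} t \<partial>lborel) = 0 - (- exp (- (a * 0)) / a)"
    by (rule nn_integral_FTC_atLeast[OF _ _ _ lim]) (use assms in \<open>auto intro!: derivative_eq_intros\<close>)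
  then have "(\<integral>\<^sup>+t. ennreal (indicator {0..} t * exp (- (a * t))) \<partial>lborel) < \<infinity>"
    by (simp add: mult.commute indicator_mult_ennreal)
  then show ?thesis
    unfolding set_integrable_def real_scaleR_def
    by (intro integrableI_nonneg) auto
qed

context tree_params
begin

text \<open>Positivity of the limiting arguments keeps each \<open>powr\<close> in the iteration at
  a point of continuity.\<close>

lemma tendsto_iter_arg:
  assumes c: "\<And>l. l \<le> k \<Longrightarrow> ((\<lambda>n. c n l) \<longlongrightarrow> c' l) F" and d: "\<And>l. l \<le> k \<Longrightarrow> ((\<lambda>n. d n l) \<longlongrightarrow> d' l) F"
    and pos: "\<And>l. l \<le> k \<Longrightarrow> 0 < iter_arg c' d' l"
  shows "l \<le> k \<Longrightarrow> ((\<lambda>n. iter_arg (c n) (d n) l) \<longlongrightarrow> iter_arg c' d' l) F"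
proof (induction l)
  case 0
  show ?case unfolding iter_arg_def iter.simps(1) by (intro tendsto_intros c d) auto
next
  case (Suc l)
  have "((\<lambda>n. iter (c n) (d n) (Suc l)) \<longlongrightarrow> iter c' d' (Suc l)) F"
    unfolding iter_Suc using Suc pos[of l] by (intro tendsto_intros) auto
  then show ?case unfolding iter_arg_def using Suc.prems by (intro tendsto_intros c d) auto
qed

lemma tendsto_transf:
  assumes "\<And>l. l \<le> k \<Longrightarrow> ((\<lambda>n. c n l) \<longlongrightarrow> c' l) F" "\<And>l. l \<le> k \<Longrightarrow> ((\<lambda>n. d n l) \<longlongrightarrow> d' l) F"
    and "\<And>l. l \<le> k \<Longrightarrow> 0 < iter_arg c' d' l"
  shows "((\<lambda>n. transf (c n) (d n)) \<longlongrightarrow> transf c' d') F"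
  unfolding transf_def
proof (intro tendsto_prod tendsto_powr tendsto_const)
  fix i assume "i \<in> {..k}"
  then have i: "i \<le> k" by simp
  show "((\<lambda>x. iter_arg (c x) (d x) i) \<longlongrightarrow> iter_arg c' d' i) F"
    by (rule tendsto_iter_arg[OF assms(1) assms(2) assms(3) i]) auto
  show "iter_arg c' d' i \<noteq> 0" using assms(3)[OF i] by auto
qed

end

text \<open>One constant for all indices and all bases below \<open>u\<close>; it dominates the
  double integral in \<open>gf_open\<close> along the characteristic. Differences of head products
  are bounded by 2, linear factors by \<open>linear_mono_x_bounded\<close>.\<close>

lemma (in tree_params) mono_gen_mult_bounded:
  assumes u: "\<And>l. l \<le> k \<Longrightarrow> 0 \<le> u l \<and> u l < 1"
  shows "\<exists>C. \<forall>v x. (\<forall>l\<le>k. 0 \<le> v l \<and> v l \<le> u l) \<longrightarrow> \<bar>mono_x k v x * (\<tau> - gen_mult v x)\<bar> \<le> C"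
proof -
  obtain B where B: "\<And>v x j. (\<forall>l\<le>k. 0 \<le> v l \<and> v l \<le> u l) \<Longrightarrow> j \<le> k \<Longrightarrow> real (x j) * mono_x k v x \<le> B"
  proof -
    from linear_mono_x_bounded[of k u, OF u] obtain B where
      "\<forall>v x. (\<forall>l\<le>k. 0 \<le> v l \<and> v l \<le> u l) \<longrightarrow> (\<forall>j\<le>k. real (x j) * mono_x k v x \<le> B)" by auto
    then show ?thesis using that[of B] by blast
  qed
  have "\<bar>mono_x k v x * (\<tau> - gen_mult v x)\<bar> \<le> \<tau> + (\<Sum>l\<le>k. b l * 2 * B) + (1 + \<delta>) * (\<Sum>m\<le>k. 2)"
    if v: "\<forall>l\<le>k. 0 \<le> v l \<and> v l \<le> u l" for v x
  proof -
    have v1: "0 \<le> v l \<and> v l \<le> 1" if "l \<le> k" for l using u[OF that] v that by fastforce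
    have m: "0 \<le> mono_x k v x" "mono_x k v x \<le> 1" using mono_x_bounds[of k v x] v1 by auto
    have s: "0 \<le> head_prod v m \<and> head_prod v m \<le> 1" if "m \<le> Suc k" for m
      using v1 that unfolding head_prod_def by (auto intro!: prod_nonneg prod_le_1)
    define M where "M = mono_x k v x"
    have t1: "\<bar>M * \<tau>\<bar> \<le> \<tau>" using m tau_pos by (simp add: M_def abs_mult mult_left_le_one_le)
    have t2: "\<bar>\<Sum>l\<le>k. M * (real (x l) * b l * (head_prod v (Suc l) - head_prod v l))\<bar> \<le> (\<Sum>l\<le>k. b l * 2 * B)"
    proof (rule order_trans[OF sum_abs], rule sum_mono)
      fix l assume "l \<in> {..k}"
      then have l: "l \<le> k" by simp
      have "\<bar>M * (real (x l) * b l * (head_prod v (Suc l) - head_prod v l))\<bar> = b l * \<bar>head_prod v (Suc l) - head_prod v l\<bar> * (real (x l) * M)"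
        using m b_pos[OF l] by (simp add: abs_mult M_def)
      also have "\<dots> \<le> b l * 2 * B"
      proof (rule mult_mono)
        show "b l * \<bar>head_prod v (Suc l) - head_prod v l\<bar> \<le> b l * 2"
          using s[of l] s[of "Suc l"] l b_pos[OF l] by (intro mult_left_mono) auto
      qed (use B[OF v l, of x] m b_pos[OF l] in \<open>auto simp: M_def\<close>)
      finally show "\<bar>M * (real (x l) * b l * (head_prod v (Suc l) - head_prod v l))\<bar> \<le> b l * 2 * B" .
    qed
    have t3: "\<bar>M * ((1 + \<delta>) * (\<Sum>m\<le>k. 1 - head_prod v (Suc m)))\<bar> \<le> (1 + \<delta>) * (\<Sum>m\<le>k. 2)"
    proof -
      have "\<bar>\<Sum>m\<le>k. 1 - head_prod v (Suc m)\<bar> \<le> (\<Sum>m\<le>k. 2)"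
        by (rule order_trans[OF sum_abs], rule sum_mono) (use s in force)
      then have "\<bar>M\<bar> * ((1 + \<delta>) * \<bar>\<Sum>m\<le>k. 1 - head_prod v (Suc m)\<bar>) \<le> 1 * ((1 + \<delta>) * (\<Sum>m\<le>k. 2))"
        using m delta by (intro mult_mono) (auto simp: M_def)
      then show ?thesis using delta by (simp add: abs_mult)
    qed
    have "M * (\<tau> - gen_mult v x) = M * \<tau> - (\<Sum>l\<le>k. M * (real (x l) * b l * (head_prod v (Suc l) - head_prod v l)))
       + M * ((1 + \<delta>) * (\<Sum>m\<le>k. 1 - head_prod v (Suc m)))"
      unfolding gen_mult_def by (simp add: sum_distrib_left right_diff_distrib distrib_left)
    then show ?thesis using t1 t2 t3 unfolding M_def[symmetric] by linarith
  qed
  then show ?thesis by blast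
qed

context tree_params
begin

context
  fixes r :: "nat \<Rightarrow> real" assumes r: "\<And>l. l \<le> k \<Longrightarrow> 0 < r l \<and> r l < 1"
begin

lemma r_le_1: "l \<le> k \<Longrightarrow> 0 < r l \<and> r l \<le> 1"
  using r by force

lemma flow_fun_mono_x: "flow_fun r x t = transf r (flow_arg r t) * mono_x k (flow r t) x"
  by (simp add: flow_fun_def mono_x_def)

lemma continuous_flow_fun [continuous_intros]: "isCont (\<lambda>t. flow_fun r x t) t"
  by (rule DERIV_isCont[OF deriv_flow_fun[OF r_le_1]])

lemma continuous_flow: "l \<le> k \<Longrightarrow> isCont (\<lambda>t. flow r t l) t"
  by (rule DERIV_isCont[OF deriv_flow[OF r_le_1]])

lemma continuous_gen_mult: "isCont (\<lambda>t. gen_mult (flow r t) x) t"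
  unfolding gen_mult_def head_prod_def
  by (intro continuous_intros continuous_flow) auto

lemma flow_fun_gen_mult_bounded: "\<exists>C. \<forall>t x. 0 \<le> t \<longrightarrow> \<bar>flow_fun r x t * (\<tau> - gen_mult (flow r t) x)\<bar> \<le> C"
proof -
  obtain C where C: "\<And>v x. (\<forall>l\<le>k. 0 \<le> v l \<and> v l \<le> r l) \<Longrightarrow> \<bar>mono_x k v x * (\<tau> - gen_mult v x)\<bar> \<le> C"
    using mono_gen_mult_bounded[of r] r by (metis less_imp_le)
  have bound: "\<bar>flow_fun r x t * (\<tau> - gen_mult (flow r t) x)\<bar> \<le> C" if "0 \<le> t" for t x
  proof -
    have "\<forall>l\<le>k. 0 \<le> flow r t l \<and> flow r t l \<le> r l"
      using flow_pos[OF r_le_1] flow_le[OF r_le_1 that] by (auto simp: less_imp_le)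
    from C[OF this, of x] have c: "\<bar>mono_x k (flow r t) x * (\<tau> - gen_mult (flow r t) x)\<bar> \<le> C" .
    have "\<bar>flow_fun r x t * (\<tau> - gen_mult (flow r t) x)\<bar> = transf r (flow_arg r t) * \<bar>mono_x k (flow r t) x * (\<tau> - gen_mult (flow r t) x)\<bar>"
      using transf_bounds[OF r_le_1 that] by (simp add: flow_fun_mono_x abs_mult)
    also have "\<dots> \<le> 1 * \<bar>mono_x k (flow r t) x * (\<tau> - gen_mult (flow r t) x)\<bar>"
      using transf_bounds[OF r_le_1 that] by (intro mult_right_mono) auto
    finally show ?thesis using c by simp
  qed
  then show ?thesis by blast
qed

text \<open>By the backward equation the integrand is the derivative of
  \<open>- (exp (- (\<tau> * t)) * flow_fun r x t)\<close>. Its value at 0 is minus the monomial,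
  and at infinity the exponential kills a factor bounded by 1.\<close>

lemma flow_fun_integral:
  shows "set_integrable lborel {0<..} (\<lambda>t. exp (- (\<tau> * t)) * (flow_fun r x t * (\<tau> - gen_mult (flow r t) x)))"
    (is "set_integrable _ _ ?g")
    and "(LINT t:{0<..}|lborel. exp (- (\<tau> * t)) * (flow_fun r x t * (\<tau> - gen_mult (flow r t) x))) = mono_x k r x"
proof -
  obtain C where bound: "\<And>t x. 0 \<le> t \<Longrightarrow> \<bar>flow_fun r x t * (\<tau> - gen_mult (flow r t) x)\<bar> \<le> C"
    using flow_fun_gen_mult_bounded by blast
  have cont: "isCont ?g t" for t
    by (intro continuous_intros continuous_gen_mult)
  then have meas: "?g \<in> borel_measurable borel"
    by (intro borel_measurable_continuous_onI continuous_at_imp_continuous_on) auto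
  have e: "set_integrable lborel {0..} (\<lambda>t. C * exp (- (\<tau> * t)))"
    using set_integrable_exp_neg[OF tau_pos] by simp
  show int: "set_integrable lborel {0<..} ?g"
  proof (rule set_integrable_bound)
    show "set_integrable lborel {0<..} (\<lambda>t. C * exp (- (\<tau> * t)))"
      by (rule set_integrable_subset[OF e]) auto
    show "set_borel_measurable lborel {0<..} ?g"
      using meas unfolding set_borel_measurable_def by measurable
    show "AE t in lborel. t \<in> {0<..} \<longrightarrow> norm (?g t) \<le> norm (C * exp (- (\<tau> * t)))"
    proof (intro AE_I2 impI)
      fix t :: real assume "t \<in> {0<..}"
      then have "0 \<le> t" by simp
      from bound[OF this, of x] show "norm (?g t) \<le> norm (C * exp (- (\<tau> * t)))"
        by (simp add: abs_mult mult.commute mult_left_mono)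
    qed
  qed
  have lim0: "(((\<lambda>t. - (exp (- (\<tau> * t)) * flow_fun r x t)) \<circ> real_of_ereal) \<longlongrightarrow> - mono_x k r x) (at_right (ereal 0))"
  proof -
    have "isCont (\<lambda>t. - (exp (- (\<tau> * t)) * flow_fun r x t)) 0" by (intro continuous_intros)
    then have "((\<lambda>t. - (exp (- (\<tau> * t)) * flow_fun r x t)) \<longlongrightarrow> - mono_x k r x) (at 0)"
      by (simp add: isCont_def flow_fun_0 mono_x_def)
    then show ?thesis
      unfolding ereal_tendsto_simps by (rule tendsto_within_subset) simp
  qed
  have lim1: "(((\<lambda>t. - (exp (- (\<tau> * t)) * flow_fun r x t)) \<circ> real_of_ereal) \<longlongrightarrow> 0) (at_left \<infinity>)"
    unfolding ereal_tendsto_simps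
  proof (rule Lim_null_comparison)
    show "\<forall>\<^sub>F t in at_top. norm (- (exp (- (\<tau> * t)) * flow_fun r x t)) \<le> exp (- (\<tau> * t))"
    proof (rule eventually_mono[OF eventually_ge_at_top[of 0]])
      fix t :: real assume t: "0 \<le> t"
      have "0 \<le> flow r t l \<and> flow r t l \<le> 1" if "l \<le> k" for l
        using flow_pos[where r = r and t = t, OF r_le_1 that] flow_le[where r = r and t = t, OF r_le_1 t that] r_le_1[OF that] by linarith
      from mono_x_bounds[of k "flow r t" x, OF this]
      have "0 \<le> mono_x k (flow r t) x" "mono_x k (flow r t) x \<le> 1" by auto
      then have "0 \<le> flow_fun r x t" "flow_fun r x t \<le> 1"
        using transf_bounds[OF r_le_1 t] by (auto simp: flow_fun_mono_x intro: mult_le_one)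
      then show "norm (- (exp (- (\<tau> * t)) * flow_fun r x t)) \<le> exp (- (\<tau> * t))"
        by (simp add: abs_mult mult_left_le)
    qed
    show "((\<lambda>t. exp (- (\<tau> * t))) \<longlongrightarrow> 0) at_top" using tau_pos by real_asymp
  qed
  have "(LBINT t=ereal 0..\<infinity>. ?g t) = 0 - (- mono_x k r x)"
  proof (rule interval_integral_FTC_integrable[OF _ _ _ _ lim0 lim1])
    show "ereal 0 < \<infinity>" by simp
    fix t :: real
    show "((\<lambda>t. - (exp (- (\<tau> * t)) * flow_fun r x t)) has_vector_derivative ?g t) (at t)"
      unfolding has_real_derivative_iff_has_vector_derivative[symmetric]
      by (rule derivative_eq_intros deriv_flow_fun[OF r_le_1] refl | simp add: algebra_simps)+
    show "isCont ?g t" by (rule cont)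
  next
    have "einterval (ereal 0) \<infinity> = {0<..}" by (auto simp: einterval_def)
    then show "set_integrable lborel (einterval (ereal 0) \<infinity>) ?g" using int by simp
  qed
  then show "(LINT t:{0<..}|lborel. ?g t) = mono_x k r x"
    by (simp add: interval_lebesgue_integral_0_infty zero_ereal_def[symmetric])
qed

end

end

context tree_law
begin

text \<open>Counting measure on the countable support is sigma-finite, which Fubini requires; on all
  functions it is not.\<close>

lemma expectation_set_pmf:
  fixes F :: "(nat \<Rightarrow> nat) \<Rightarrow> real"
  shows "measure_pmf.expectation q F = (LINT i|count_space (set_pmf q). pmf q i * F i)"
proof -
  have "measure_pmf.expectation q F = (\<Sum>\<^sub>ai\<in>UNIV. pmf q i * F i)"
    unfolding measure_pmf_eq_density infsetsum_def by (subst integral_density) auto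
  also have "\<dots> = (\<Sum>\<^sub>ai\<in>set_pmf q. pmf q i * F i)"
    by (intro infsetsum_cong_neutral) (auto simp: set_pmf_eq)
  finally show ?thesis by (simp add: infsetsum_def)
qed

text \<open>Each monomial is replaced by the integral of \<open>flow_fun_integral\<close>. After the
  exchange, \<open>adjoint\<close> at the base \<open>flow r t\<close> collapses the expectation at
  each time \<open>t\<close> to \<open>\<tau>\<close>.\<close>

lemma gf_open:
  assumes r: "\<And>l. l \<le> k \<Longrightarrow> 0 < r l \<and> r l < 1"
  shows "measure_pmf.expectation q (\<lambda>i. mono_x k r (excess i))
    = (LINT t:{0<..}|lborel. \<tau> * exp (- (\<tau> * t)) * transf r (flow_arg r t))"
proof -
  note r_le = r_le_1[of r, OF r]
  obtain C where bound: "\<And>t x. 0 \<le> t \<Longrightarrow> \<bar>flow_fun r x t * (\<tau> - gen_mult (flow r t) x)\<bar> \<le> C"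
    using flow_fun_gen_mult_bounded[of r] r by blast
  let ?Q = "count_space (set_pmf q)"
  interpret Q: sigma_finite_measure ?Q by (rule sigma_finite_measure_count_space_countable) simp
  interpret P: pair_sigma_finite ?Q lborel ..
  let ?e = "\<lambda>t. indicator {0<..} t * exp (- (\<tau> * t)) :: real"
  have ei: "integrable lborel ?e"
  proof -
    have "set_integrable lborel {0<..} (\<lambda>t. exp (- (\<tau> * t)))"
      by (rule set_integrable_subset[OF set_integrable_exp_neg[OF tau_pos]]) auto
    then show ?thesis by (simp add: set_integrable_def)
  qed
  let ?g = "\<lambda>i t. pmf q i * (?e t * (flow_fun r (excess i) t * (\<tau> - gen_mult (flow r t) (excess i))))"
  have gm: "?g i \<in> borel_measurable lborel" for i
  proof -
    have "continuous_on UNIV (\<lambda>t. flow_fun r (excess i) t * (\<tau> - gen_mult (flow r t) (excess i)))"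
      by (intro continuous_at_imp_continuous_on ballI continuous_intros continuous_flow_fun[OF r] continuous_gen_mult[OF r])
    then have [measurable]: "(\<lambda>t. flow_fun r (excess i) t * (\<tau> - gen_mult (flow r t) (excess i))) \<in> borel_measurable borel"
      by (rule borel_measurable_continuous_onI)
    show ?thesis by measurable
  qed
  have gb: "norm (?g i t) \<le> pmf q i * (C * ?e t)" for i t
  proof -
    have "?e t * \<bar>flow_fun r (excess i) t * (\<tau> - gen_mult (flow r t) (excess i))\<bar> \<le> ?e t * C"
      using bound[of t "excess i"] by (cases "0 < t") auto
    then have "pmf q i * (?e t * \<bar>flow_fun r (excess i) t * (\<tau> - gen_mult (flow r t) (excess i))\<bar>) \<le> pmf q i * (C * ?e t)"
      by (intro mult_left_mono) (auto simp: mult.commute)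
    then show ?thesis by (simp add: abs_mult)
  qed
  have meas: "(\<lambda>(i, t). ?g i t) \<in> borel_measurable (?Q \<Otimes>\<^sub>M lborel)"
    by (rule measurable_pair_measure_countable1) (use gm in auto)
  have gi: "integrable lborel (?g i)" for i
    by (rule Bochner_Integration.integrable_bound[of _ "\<lambda>t. pmf q i * (C * ?e t)"])
      (use ei gm in \<open>auto intro!: AE_I2 order_trans[OF gb abs_ge_self, unfolded real_norm_def]\<close>)
  have qi: "integrable ?Q (pmf q)"
    using pmf_abs_summable[of q "set_pmf q"] by (simp add: Infinite_Set_Sum.abs_summable_on_def)
  have pi: "integrable (?Q \<Otimes>\<^sub>M lborel) (\<lambda>(i, t). ?g i t)"
  proof (rule P.Fubini_integrable)
    show "AE i in ?Q. integrable lborel (\<lambda>t. (\<lambda>(i, t). ?g i t) (i, t))"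
      using gi by simp
    have "integrable ?Q (\<lambda>i. LINT t|lborel. norm (?g i t))"
    proof (rule Bochner_Integration.integrable_bound[of _ "\<lambda>i. pmf q i * (LINT t|lborel. C * ?e t)"])
      show "integrable ?Q (\<lambda>i. pmf q i * (LINT t|lborel. C * ?e t))" using qi by simp
      show "AE i in ?Q. norm (LINT t|lborel. norm (?g i t)) \<le> norm (pmf q i * (LINT t|lborel. C * ?e t))"
      proof (intro AE_I2)
        fix i
        have "(LINT t|lborel. norm (?g i t)) \<le> (LINT t|lborel. pmf q i * (C * ?e t))"
          by (intro integral_mono gb integrable_norm gi integrable_mult_right ei)
        then show "norm (LINT t|lborel. norm (?g i t)) \<le> norm (pmf q i * (LINT t|lborel. C * ?e t))"
          by (simp add: integral_nonneg_AE)
      qed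
    qed simp
    then show "integrable ?Q (\<lambda>i. LINT t|lborel. norm ((\<lambda>(i, t). ?g i t) (i, t)))" by simp
  qed (rule meas)
  have "measure_pmf.expectation q (\<lambda>i. mono_x k r (excess i)) = (LINT i|?Q. LINT t|lborel. ?g i t)"
    unfolding expectation_set_pmf
  proof (rule Bochner_Integration.integral_cong[OF refl])
    fix i
    have "(LINT t|lborel. ?g i t) = pmf q i * (LINT t:{0<..}|lborel. exp (- (\<tau> * t)) * (flow_fun r (excess i) t * (\<tau> - gen_mult (flow r t) (excess i))))"
      unfolding set_lebesgue_integral_def by (simp add: mult.assoc)
    then show "pmf q i * mono_x k r (excess i) = (LINT t|lborel. ?g i t)"
      using flow_fun_integral(2)[where r = r and x = "excess i"] r by auto
  qed
  also have "\<dots> = (LINT t|lborel. LINT i|?Q. ?g i t)"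
    by (rule P.Fubini_integral[OF pi, symmetric])
  also have "\<dots> = (LINT t:{0<..}|lborel. \<tau> * exp (- (\<tau> * t)) * transf r (flow_arg r t))"
    unfolding set_lebesgue_integral_def
  proof (rule Bochner_Integration.integral_cong[OF refl])
    fix t :: real
    show "(LINT i|?Q. ?g i t) = indicat_real {0<..} t *\<^sub>R (\<tau> * exp (- (\<tau> * t)) * transf r (flow_arg r t))"
    proof (cases "0 < t")
      case True
      have rb: "0 \<le> flow r t l \<and> flow r t l < 1" if "l \<le> k" for l
        using flow_pos[where r = r and t = t, OF r_le that] flow_le[where r = r and t = t, OF r_le _ that] r[OF that] True by linarith
      have "(LINT i|?Q. ?g i t) = (LINT i|?Q. (exp (- (\<tau> * t)) * transf r (flow_arg r t)) *
          (pmf q i * (mono_x k (flow r t) (excess i) * (\<tau> - gen_mult (flow r t) (excess i)))))"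
        using True by (intro Bochner_Integration.integral_cong refl) (simp add: flow_fun_mono_x[OF r])
      also have "\<dots> = exp (- (\<tau> * t)) * transf r (flow_arg r t) * \<tau>"
        unfolding integral_mult_right_zero expectation_set_pmf[symmetric] by (subst adjoint) (use rb in auto)
      finally show ?thesis using True by simp
    qed simp
  qed
  finally show ?thesis .
qed

text \<open>Coordinates equal to 1 occur whenever a Laplace variable is 0. There the linear factors
  are no longer bounded, so the formula is reached by approximating \<open>r\<close> from strictly
  inside.\<close>

lemma gf:
  assumes r: "\<And>l. l \<le> k \<Longrightarrow> 0 < r l \<and> r l \<le> 1"
  shows "measure_pmf.expectation q (\<lambda>i. mono_x k r (excess i))
    = (LINT t:{0<..}|lborel. \<tau> * exp (- (\<tau> * t)) * transf r (flow_arg r t))"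
proof -
  define R where "R n l = r l * (1 - 1 / (real n + 2))" for n l
  have Rl: "(\<lambda>n. R n l) \<longlonglongrightarrow> r l" for l
    unfolding R_def by real_asymp
  have R: "0 < R n l \<and> R n l < 1" if "l \<le> k" for n l
  proof -
    have "0 < 1 - 1 / (real n + 2)" "1 - 1 / (real n + 2) < 1" by (auto simp: field_simps)
    then have "0 < R n l" "R n l < r l * 1"
      unfolding R_def using r[OF that] by (simp, intro mult_strict_left_mono, auto)
    then show ?thesis using r[OF that] by linarith
  qed
  have Rw: "l \<le> k \<Longrightarrow> 0 < R n l \<and> R n l \<le> 1" for n l using R[of l n] by force
  have "(\<lambda>n. measure_pmf.expectation q (\<lambda>i. mono_x k (R n) (excess i)))
     \<longlonglongrightarrow> measure_pmf.expectation q (\<lambda>i. mono_x k r (excess i))"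
  proof (rule integral_dominated_convergence[where w = "\<lambda>_. 1"])
    show "AE i in measure_pmf q. (\<lambda>n. mono_x k (R n) (excess i)) \<longlonglongrightarrow> mono_x k r (excess i)"
      unfolding mono_x_def by (intro AE_I2 tendsto_intros Rl)
    show "AE i in measure_pmf q. norm (mono_x k (R n) (excess i)) \<le> 1" for n
      using mono_x_bounds[of k "R n"] R[of _ n] by (intro AE_I2) (auto simp: less_imp_le)
  qed auto
  moreover have "(\<lambda>n. LINT t:{0<..}|lborel. \<tau> * exp (- (\<tau> * t)) * transf (R n) (flow_arg (R n) t))
     \<longlonglongrightarrow> (LINT t:{0<..}|lborel. \<tau> * exp (- (\<tau> * t)) * transf r (flow_arg r t))"
    unfolding set_lebesgue_integral_def
  proof (rule integral_dominated_convergence[where w = "\<lambda>t. indicator {0..} t * (\<tau> * exp (- (\<tau> * t)))"])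
    have cont: "continuous_on UNIV (\<lambda>t. transf r (flow_arg r t))" if "\<And>l. l \<le> k \<Longrightarrow> 0 < r l \<and> r l \<le> 1" for r
      by (intro continuous_at_imp_continuous_on ballI DERIV_isCont[OF deriv_transf[OF that]])
    note [measurable] = borel_measurable_continuous_onI[OF cont]
    show "(\<lambda>t. indicat_real {0<..} t *\<^sub>R (\<tau> * exp (- (\<tau> * t)) * transf r (flow_arg r t))) \<in> borel_measurable lborel"
      using r by measurable
    show "(\<lambda>t. indicat_real {0<..} t *\<^sub>R (\<tau> * exp (- (\<tau> * t)) * transf (R n) (flow_arg (R n) t))) \<in> borel_measurable lborel" for n
      using Rw by measurable
    show "integrable lborel (\<lambda>t. indicator {0..} t * (\<tau> * exp (- (\<tau> * t))))"
      using set_integrable_exp_neg[OF tau_pos] by (simp add: set_integrable_def mult.left_commute)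
    show "AE t in lborel. (\<lambda>n. indicat_real {0<..} t *\<^sub>R (\<tau> * exp (- (\<tau> * t)) * transf (R n) (flow_arg (R n) t)))
        \<longlonglongrightarrow> indicat_real {0<..} t *\<^sub>R (\<tau> * exp (- (\<tau> * t)) * transf r (flow_arg r t))"
    proof (intro AE_I2 tendsto_intros tendsto_transf)
      show "0 < iter_arg r (flow_arg r t) l" if "l \<le> k" for l t using iter_pos[where r = r and l = l and t = t] r that by blast
      show "(\<lambda>n. flow_arg (R n) t l) \<longlonglongrightarrow> flow_arg r t l" for l t unfolding flow_arg_def by (intro tendsto_intros Rl)
    qed (rule Rl)
    show "AE t in lborel. norm (indicat_real {0<..} t *\<^sub>R (\<tau> * exp (- (\<tau> * t)) * transf (R n) (flow_arg (R n) t)))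
        \<le> indicator {0..} t * (\<tau> * exp (- (\<tau> * t)))" for n
    proof (intro AE_I2)
      fix t :: real
      show "norm (indicat_real {0<..} t *\<^sub>R (\<tau> * exp (- (\<tau> * t)) * transf (R n) (flow_arg (R n) t)))
        \<le> indicator {0..} t * (\<tau> * exp (- (\<tau> * t)))"
        using transf_bounds[where r = "R n" and t = t] Rw tau_pos by (auto simp: indicator_def abs_mult mult_left_le)
    qed
  qed
  moreover have "measure_pmf.expectation q (\<lambda>i. mono_x k (R n) (excess i))
      = (LINT t:{0<..}|lborel. \<tau> * exp (- (\<tau> * t)) * transf (R n) (flow_arg (R n) t))" for n
    using R by (intro gf_open)
  ultimately show ?thesis using LIMSEQ_unique by simp blast
qed

end

section \<open>Positivity of coefficients\<close>

text \<open>\<open>pos_on k \<Omega>\<close> is the closed cone generated by the monomials, described by duality; it avoids power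
  series in several variables.\<close>

definition pos_on :: "nat \<Rightarrow> (nat \<Rightarrow> real) set \<Rightarrow> ((nat \<Rightarrow> real) \<Rightarrow> real) \<Rightarrow> bool" where
  "pos_on k \<Omega> F \<longleftrightarrow> (\<forall>(N::nat) pt w. (\<forall>c<N. pt c \<in> \<Omega>) \<longrightarrow>
     (\<forall>x. 0 \<le> (\<Sum>c<N. w c * mono_x k (pt c) x)) \<longrightarrow> 0 \<le> (\<Sum>c<N. w c * F (pt c)))"

lemma pos_onI:
  assumes "\<And>N pt w. (\<And>c. c < N \<Longrightarrow> pt c \<in> \<Omega>) \<Longrightarrow> (\<And>x. 0 \<le> (\<Sum>c<(N::nat). w c * mono_x k (pt c) x)) \<Longrightarrow>
    0 \<le> (\<Sum>c<N. w c * F (pt c))"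
  shows "pos_on k \<Omega> F"
  using assms unfolding pos_on_def by blast

lemma pos_onD:
  assumes "pos_on k \<Omega> F" "\<And>c. c < N \<Longrightarrow> pt c \<in> \<Omega>" "\<And>x. 0 \<le> (\<Sum>c<(N::nat). w c * mono_x k (pt c) x)"
  shows "0 \<le> (\<Sum>c<N. w c * F (pt c))"
  using assms unfolding pos_on_def by blast

lemma pos_on_cong:
  assumes "pos_on k \<Omega> F" "\<And>r. r \<in> \<Omega> \<Longrightarrow> F r = G r"
  shows "pos_on k \<Omega> G"
proof (rule pos_onI)
  fix N pt w assume h: "\<And>c. c < N \<Longrightarrow> pt c \<in> \<Omega>" "\<And>x. 0 \<le> (\<Sum>c<(N::nat). w c * mono_x k (pt c) x)"
  have "0 \<le> (\<Sum>c<N. w c * F (pt c))" by (rule pos_onD[OF assms(1) h])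
  also have "\<dots> = (\<Sum>c<N. w c * G (pt c))" using h assms(2) by (intro sum.cong) auto
  finally show "0 \<le> (\<Sum>c<N. w c * G (pt c))" .
qed

lemma pos_on_mono_x: "pos_on k \<Omega> (\<lambda>r. mono_x k r x)"
  by (rule pos_onI)

lemma pos_on_const:
  assumes "0 \<le> c" shows "pos_on k \<Omega> (\<lambda>r. c)"
proof (rule pos_onI)
  fix N :: nat and pt w assume "\<And>x. 0 \<le> (\<Sum>c<N. w c * mono_x k (pt c) x)"
  from this[of "\<lambda>_. 0"] have "0 \<le> (\<Sum>c<N. w c)" by (simp add: mono_x_def)
  then show "0 \<le> (\<Sum>a<N. w a * c)" using assms by (simp add: sum_distrib_right[symmetric])
qed

lemma pos_on_coord:
  assumes "j \<le> k" shows "pos_on k \<Omega> (\<lambda>r. r j)"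
  using pos_on_mono_x[of k \<Omega> "\<lambda>l. if l = j then 1 else 0"] mono_x_unit[OF assms] by simp

lemma pos_on_add:
  assumes "pos_on k \<Omega> F" "pos_on k \<Omega> G" shows "pos_on k \<Omega> (\<lambda>r. F r + G r)"
proof (rule pos_onI)
  fix N pt w assume h: "\<And>c. c < N \<Longrightarrow> pt c \<in> \<Omega>" "\<And>x. 0 \<le> (\<Sum>c<(N::nat). w c * mono_x k (pt c) x)"
  show "0 \<le> (\<Sum>c<N. w c * (F (pt c) + G (pt c)))"
    using pos_onD[OF assms(1) h] pos_onD[OF assms(2) h] by (simp add: distrib_left sum.distrib)
qed

text \<open>Multiplying the weights by a monomial turns one admissible functional into another, so
  positivity passes to products without any convolution of coefficients.\<close>

lemma pos_on_mult:
  assumes F: "pos_on k \<Omega> F" and G: "pos_on k \<Omega> G" shows "pos_on k \<Omega> (\<lambda>r. F r * G r)"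
proof (rule pos_onI)
  fix N pt w assume h: "\<And>c. c < N \<Longrightarrow> pt c \<in> \<Omega>" "\<And>x. 0 \<le> (\<Sum>c<(N::nat). w c * mono_x k (pt c) x)"
  have "0 \<le> (\<Sum>c<N. (w c * F (pt c)) * mono_x k (pt c) y)" for y
  proof -
    have "0 \<le> (\<Sum>c<N. (w c * mono_x k (pt c) y) * mono_x k (pt c) x)" for x
      using h(2)[of "\<lambda>l. y l + x l"] by (simp add: mono_x_add mult.assoc)
    from pos_onD[where w = "\<lambda>c. w c * mono_x k (pt c) y", OF F h(1) this]
    show ?thesis by (simp add: mult_ac)
  qed
  from pos_onD[where w = "\<lambda>c. w c * F (pt c)", OF G h(1) this]
  show "0 \<le> (\<Sum>c<N. w c * (F (pt c) * G (pt c)))" by (simp add: mult.assoc)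
qed

lemma pos_on_lim:
  assumes F: "\<And>n. pos_on k \<Omega> (F n)" and lim: "\<And>r. r \<in> \<Omega> \<Longrightarrow> (\<lambda>n. F n r) \<longlonglongrightarrow> G r"
  shows "pos_on k \<Omega> G"
proof (rule pos_onI)
  fix N pt w assume h: "\<And>c. c < N \<Longrightarrow> pt c \<in> \<Omega>" "\<And>x. 0 \<le> (\<Sum>c<(N::nat). w c * mono_x k (pt c) x)"
  have "(\<lambda>n. \<Sum>c<N. w c * F n (pt c)) \<longlonglongrightarrow> (\<Sum>c<N. w c * G (pt c))"
    using h(1) by (intro tendsto_intros lim) auto
  then show "0 \<le> (\<Sum>c<N. w c * G (pt c))"
    by (rule LIMSEQ_le_const) (use pos_onD[OF F h] in auto)
qed

lemma pos_on_power:
  assumes "pos_on k \<Omega> F" shows "pos_on k \<Omega> (\<lambda>r. F r ^ n)"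
  by (induction n) (auto intro: pos_on_const pos_on_mult assms)

lemma pos_on_sum:
  assumes "\<And>i. i \<in> I \<Longrightarrow> pos_on k \<Omega> (F i)" shows "pos_on k \<Omega> (\<lambda>r. \<Sum>i\<in>I. F i r)"
  using assms by (induction I rule: infinite_finite_induct) (auto intro: pos_on_const pos_on_add)

lemma pos_on_prod:
  assumes "\<And>i. i \<in> I \<Longrightarrow> pos_on k \<Omega> (F i)" shows "pos_on k \<Omega> (\<lambda>r. \<Prod>i\<in>I. F i r)"
  using assms by (induction I rule: infinite_finite_induct) (auto intro: pos_on_const pos_on_mult)

lemma pos_on_sums:
  assumes F: "pos_on k \<Omega> F" and c: "\<And>n. 0 \<le> c n"
    and s: "\<And>r. r \<in> \<Omega> \<Longrightarrow> (\<lambda>n. c n * F r ^ n) sums G r"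
  shows "pos_on k \<Omega> G"
  by (rule pos_on_lim[where F = "\<lambda>N r. \<Sum>n<N. c n * F r ^ n"])
    (use s in \<open>auto intro!: pos_on_sum pos_on_mult pos_on_const pos_on_power F c simp: sums_def\<close>)

lemma pos_on_nonneg:
  assumes "pos_on k \<Omega> F" "r \<in> \<Omega>" "\<And>l. l \<le> k \<Longrightarrow> 0 \<le> r l" shows "0 \<le> F r"
proof -
  have "0 \<le> mono_x k r x" for x using assms(3) by (auto simp: mono_x_def intro!: prod_nonneg)
  then show ?thesis using pos_onD[OF assms(1), of 1 "\<lambda>_. r" "\<lambda>_. 1"] assms(2) by simp
qed

text \<open>The binomial series in the form whose coefficient signs are visible.\<close>

lemma binomial_neg_sums:
  fixes z c :: real assumes "0 \<le> z" "z < 1"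
  shows "(\<lambda>n. pochhammer (- c) n / fact n * z ^ n) sums (1 - z) powr c"
proof -
  have "(\<lambda>n. (c gchoose n) * (- z) ^ n) sums (1 + - z) powr c"
    using assms by (intro gen_binomial_real) auto
  moreover have "(c gchoose n) * (- z) ^ n = pochhammer (- c) n / fact n * z ^ n" for n
    by (simp add: gbinomial_pochhammer power_minus[of z] field_simps)
  ultimately show ?thesis by simp
qed

context
  fixes k \<Omega> and F :: "(nat \<Rightarrow> real) \<Rightarrow> real"
  assumes \<Omega>: "\<And>r l. r \<in> \<Omega> \<Longrightarrow> l \<le> k \<Longrightarrow> 0 \<le> r l"
    and F: "pos_on k \<Omega> F" "\<And>r. r \<in> \<Omega> \<Longrightarrow> F r < 1"
begin

lemma pos_on_powr_neg:
  assumes c: "0 \<le> c" shows "pos_on k \<Omega> (\<lambda>r. (1 - F r) powr (- c))"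
proof (rule pos_on_sums[OF F(1), where c = "\<lambda>n. pochhammer c n / fact n"])
  show "0 \<le> pochhammer c n / fact n" for n
  proof -
    have "0 \<le> pochhammer c n"
      using c by (cases "c = 0") (auto simp: pochhammer_0_left intro!: less_imp_le pochhammer_pos)
    then show ?thesis by simp
  qed
  fix r assume r: "r \<in> \<Omega>"
  show "(\<lambda>n. pochhammer c n / fact n * F r ^ n) sums (1 - F r) powr (- c)"
    using binomial_neg_sums[of "F r" "- c"] pos_on_nonneg[OF F(1) r] \<Omega>[OF r] F(2)[OF r] by simp
qed

text \<open>For \<open>n > 0\<close> exactly one factor of \<open>pochhammer (- \<beta>) n\<close>,
  the first, is not positive-or-zero by \<open>\<beta> \<le> 1\<close>; hence subtracting the series
  from 1 leaves nonnegative coefficients. This is where the decrease of \<open>b\<close> enters,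
  through exponents \<open>b (Suc l) / b l\<close> below 1.\<close>

lemma pos_on_one_minus_powr:
  assumes \<beta>: "0 \<le> \<beta>" "\<beta> \<le> 1" shows "pos_on k \<Omega> (\<lambda>r. 1 - (1 - F r) powr \<beta>)"
proof (rule pos_on_sums[OF F(1), where c = "\<lambda>n. if n = 0 then 0 else - (pochhammer (- \<beta>) n / fact n)"])
  show "0 \<le> (if n = 0 then 0 else - (pochhammer (- \<beta>) n / fact n))" for n
  proof (cases n)
    case (Suc m)
    have "0 \<le> pochhammer (1 - \<beta>) m"
      using \<beta> by (cases "\<beta> = 1") (auto simp: pochhammer_0_left intro!: less_imp_le pochhammer_pos)
    then have "pochhammer (- \<beta>) n \<le> 0" using \<beta> by (simp add: Suc pochhammer_rec mult_nonneg_nonneg)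
    then show ?thesis using Suc by (simp add: divide_nonpos_pos)
  qed simp
  fix r assume r: "r \<in> \<Omega>"
  have s: "(\<lambda>n. pochhammer (- \<beta>) n / fact n * F r ^ n) sums (1 - F r) powr \<beta>"
    using binomial_neg_sums[of "F r" \<beta>] pos_on_nonneg[OF F(1) r] \<Omega>[OF r] F(2)[OF r] by simp
  have "(\<lambda>n. (if n = 0 then 1 else 0) - pochhammer (- \<beta>) n / fact n * F r ^ n) sums (1 - (1 - F r) powr \<beta>)"
    by (intro sums_diff s) (use sums_single[of 0 "\<lambda>_. 1::real"] in simp)
  moreover have "(if n = 0 then 1 else 0) - pochhammer (- \<beta>) n / fact n * F r ^ n
     = (if n = 0 then 0 else - (pochhammer (- \<beta>) n / fact n)) * F r ^ n" for n
    by simp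
  ultimately show "(\<lambda>n. (if n = 0 then 0 else - (pochhammer (- \<beta>) n / fact n)) * F r ^ n)
      sums (1 - (1 - F r) powr \<beta>)" by simp
qed

end

section \<open>Finite differences of the generating function: sign and growth\<close>

lemma power_le_fact_exp:
  fixes x :: real assumes "0 \<le> x" shows "x ^ n \<le> fact n * exp x"
proof -
  have "(\<Sum>i\<in>{n}. x ^ i / fact i) \<le> (\<Sum>i. x ^ i / fact i)"
    using summable_exp_generic[of x] assms by (intro sum_le_suminf) (auto simp: field_simps)
  also have "\<dots> = exp x" unfolding exp_def by (simp add: field_simps)
  finally show ?thesis by (simp add: field_simps)
qed

context tree_params
begin

text \<open>Coordinates above 1 are allowed as long as the arguments of the powers stay positive;
  \<open>alt_sum_degree_gf_le\<close> needs such a point.\<close>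

definition gf_domain :: "real \<Rightarrow> (nat \<Rightarrow> real) set" where
  "gf_domain t = {r. \<forall>l\<le>k. 0 \<le> r l \<and> 0 < iter_arg r (flow_arg r t) l}"

text \<open>The iteration is followed through the normalised deficit \<open>Q\<close>, which stays
  in the cone: \<open>iter_arg\<close> equals \<open>exp (b l * t) * (1 - r l * Q r l)\<close>, so
  one step of the iteration is one application of \<open>pos_on_one_minus_powr\<close>, and the
  factors of \<open>transf\<close> are negative powers of \<open>1 - r l * Q r l\<close>.\<close>

lemma pos_on_transf:
  assumes t: "0 \<le> t" shows "pos_on k (gf_domain t) (\<lambda>r. transf r (flow_arg r t))"
proof -
  define Q where "Q r l = 1 - iter r (flow_arg r t) l * exp (- (b l * t))" for r l
  have vQ: "iter_arg r (flow_arg r t) l = exp (b l * t) * (1 - r l * Q r l)" for r l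
    by (simp add: iter_arg_def flow_arg_def Q_def algebra_simps exp_minus)
  have \<Omega>: "r \<in> gf_domain t \<Longrightarrow> l \<le> k \<Longrightarrow> 0 \<le> r l" for r l by (simp add: gf_domain_def)
  have lt1: "r l * Q r l < 1" if "r \<in> gf_domain t" "l \<le> k" for r l
  proof -
    have "0 < exp (b l * t) * (1 - r l * Q r l)" using that by (simp add: gf_domain_def vQ)
    then show ?thesis by (simp add: zero_less_mult_iff)
  qed
  have Q: "pos_on k (gf_domain t) (\<lambda>r. Q r l)" if "l \<le> k" for l
    using that
  proof (induction l)
    case 0
    have "0 \<le> 1 - exp (- (b 0 * t))" using b_pos[of 0] t by simp
    then show ?case by (simp add: Q_def pos_on_const)
  next
    case (Suc l)
    let ?\<beta> = "b (Suc l) / b l"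
    have bl: "0 < b l" using b_pos Suc.prems by simp
    have pos: "pos_on k (gf_domain t) (\<lambda>r. r l * Q r l)"
      using Suc by (intro pos_on_mult pos_on_coord) auto
    have "pos_on k (gf_domain t) (\<lambda>r. 1 - (1 - r l * Q r l) powr ?\<beta>)"
      by (rule pos_on_one_minus_powr[where F = "\<lambda>r. r l * Q r l"])
        (use pos lt1[of _ l] \<Omega> beta_bounds[OF Suc.prems] Suc.prems in auto)
    moreover have "1 - (1 - r l * Q r l) powr ?\<beta> = Q r (Suc l)" if r: "r \<in> gf_domain t" for r
    proof -
      have "iter r (flow_arg r t) (Suc l) = (exp (b l * t) * (1 - r l * Q r l)) powr ?\<beta>"
        by (simp only: iter_Suc vQ)
      also have "\<dots> = exp (b (Suc l) * t) * (1 - r l * Q r l) powr ?\<beta>"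
        using lt1[OF r, of l] Suc.prems bl by (subst powr_mult) (auto simp: powr_def)
      finally show ?thesis by (simp add: Q_def exp_minus del: iter.simps)
    qed
    ultimately show ?case by (rule pos_on_cong)
  qed
  have "pos_on k (gf_domain t) (\<lambda>r. exp (b m * t) powr (- (1 + \<delta>) / b m) * (1 - r m * Q r m) powr (- ((1 + \<delta>) / b m)))"
    if m: "m \<le> k" for m
  proof -
    have "pos_on k (gf_domain t) (\<lambda>r. (1 - r m * Q r m) powr (- ((1 + \<delta>) / b m)))"
      by (rule pos_on_powr_neg[where F = "\<lambda>r. r m * Q r m"])
        (use pos_on_mult[OF pos_on_coord[OF m] Q[OF m]] lt1[OF _ m] \<Omega> b_pos[OF m] delta in auto)
    then show ?thesis by (intro pos_on_mult pos_on_const) simp_all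
  qed
  then have "pos_on k (gf_domain t) (\<lambda>r. \<Prod>m\<le>k. exp (b m * t) powr (- (1 + \<delta>) / b m) * (1 - r m * Q r m) powr (- ((1 + \<delta>) / b m)))"
    by (intro pos_on_prod) simp
  then show ?thesis
  proof (rule pos_on_cong)
    fix r assume r: "r \<in> gf_domain t"
    show "(\<Prod>m\<le>k. exp (b m * t) powr (- (1 + \<delta>) / b m) * (1 - r m * Q r m) powr (- ((1 + \<delta>) / b m))) = transf r (flow_arg r t)"
      unfolding transf_def vQ
    proof (intro prod.cong refl)
      fix m assume "m \<in> {..k}"
      then have "0 < 1 - r m * Q r m" using lt1[OF r, of m] by simp
      then show "exp (b m * t) powr (- (1 + \<delta>) / b m) * (1 - r m * Q r m) powr (- ((1 + \<delta>) / b m))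
          = (exp (b m * t) * (1 - r m * Q r m)) powr (- (1 + \<delta>) / b m)"
        by (subst powr_mult) (simp_all add: minus_divide_left)
    qed
  qed
qed

text \<open>The exponents \<open>k - l + 1\<close> are the starting values, so this is the
  generating function of the index itself and not of its excess.\<close>

definition degree_gf :: "(nat \<Rightarrow> real) \<Rightarrow> real \<Rightarrow> real" where
  "degree_gf r t = mono_x k r (\<lambda>l. k - l + 1) * transf r (flow_arg r t)"

text \<open>Equally spaced Laplace variables in direction \<open>j\<close>, with step
  \<open>\<mu>\<close>. Differencing in \<open>c\<close> inserts the factor
  \<open>(1 - exp (- (\<mu> * real (x j)))) ^ n\<close>, which is small near the origin.\<close>

definition grid_pt :: "nat \<Rightarrow> real \<Rightarrow> (nat \<Rightarrow> real) \<Rightarrow> nat \<Rightarrow> nat \<Rightarrow> real" where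
  "grid_pt j \<mu> a c l = exp (- (a l + (if l = j then \<mu> * real c else 0)))"

definition alt_sum :: "nat \<Rightarrow> (nat \<Rightarrow> real) \<Rightarrow> real" where
  "alt_sum n f = (\<Sum>c\<le>n. (-1) ^ c * real (n choose c) * f c)"

lemma alt_sum_mono_x:
  assumes j: "j \<le> k"
  shows "alt_sum n (\<lambda>c. mono_x k (grid_pt j \<mu> a c) x) = (\<Prod>l\<le>k. exp (- (a l * real (x l)))) * (1 - exp (- (\<mu> * real (x j)))) ^ n"
proof -
  have m: "mono_x k (grid_pt j \<mu> a c) x = (\<Prod>l\<le>k. exp (- (a l * real (x l)))) * exp (- (\<mu> * real (x j))) ^ c" for c
  proof -
    have "mono_x k (grid_pt j \<mu> a c) x = (\<Prod>l\<le>k. exp (- (a l * real (x l))) * (if l = j then exp (- (\<mu> * real (x j))) ^ c else 1))"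
      unfolding mono_x_def grid_pt_def
      by (intro prod.cong refl) (auto simp: exp_of_nat_mult[symmetric] exp_add[symmetric] algebra_simps)
    then show ?thesis using j by (simp add: prod.distrib)
  qed
  have "(1 - exp (- (\<mu> * real (x j)))) ^ n = (- exp (- (\<mu> * real (x j))) + 1) ^ n" by simp
  also have "\<dots> = (\<Sum>c\<le>n. (-1) ^ c * real (n choose c) * exp (- (\<mu> * real (x j))) ^ c)"
    by (subst binomial_ring) (simp add: power_minus[of "exp _"] mult_ac)
  finally show ?thesis by (simp add: alt_sum_def m sum_distrib_left mult_ac)
qed

text \<open>\<open>fact n\<close> comes from \<open>power_le_fact_exp\<close>, \<open>4 ^ n\<close>
  from the choice of \<open>\<eta>\<close> below, \<open>exp (real k + 1)\<close> bounds the
  starting monomial, and the product bounds \<open>transf\<close> at a point where every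
  \<open>iter_arg\<close> is at least 1/2.\<close>

definition diff_bound :: "nat \<Rightarrow> real" where
  "diff_bound n = fact n * 4 ^ n * (exp (real k + 1) * (\<Prod>m\<le>k. (1 / 2) powr (- (1 + \<delta>) / b m)))"

context
  fixes j :: nat and \<mu> t :: real and a :: "nat \<Rightarrow> real"
  assumes j: "j \<le> k" and lam: "0 \<le> \<mu>" and t: "0 \<le> t" and a: "\<And>l. l \<le> k \<Longrightarrow> 0 \<le> a l"
begin

lemma grid_pt_bounds: "l \<le> k \<Longrightarrow> 0 < grid_pt j \<mu> a c l \<and> grid_pt j \<mu> a c l \<le> 1"
proof -
  assume "l \<le> k"
  then have "0 \<le> a l + (if l = j then \<mu> * real c else 0)" using a[of l] lam by simp
  then show ?thesis by (simp add: grid_pt_def del: minus_add_distrib)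
qed

lemma degree_gf_bounds: "0 \<le> degree_gf (grid_pt j \<mu> a c) t" "degree_gf (grid_pt j \<mu> a c) t \<le> 1"
proof -
  have "0 \<le> mono_x k (grid_pt j \<mu> a c) x" "mono_x k (grid_pt j \<mu> a c) x \<le> 1" for x
    using mono_x_bounds[of k "grid_pt j \<mu> a c"] grid_pt_bounds by (auto simp: less_imp_le)
  moreover have "0 \<le> transf (grid_pt j \<mu> a c) (flow_arg (grid_pt j \<mu> a c) t)" "transf (grid_pt j \<mu> a c) (flow_arg (grid_pt j \<mu> a c) t) \<le> 1"
    using transf_bounds[where r = "grid_pt j \<mu> a c" and t = t] grid_pt_bounds t by auto
  ultimately show "0 \<le> degree_gf (grid_pt j \<mu> a c) t" "degree_gf (grid_pt j \<mu> a c) t \<le> 1"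
    unfolding degree_gf_def by (auto intro: mult_le_one)
qed

lemma alt_sum_abs_le:
  assumes "\<And>c. \<bar>f c\<bar> \<le> 1" shows "\<bar>alt_sum n f\<bar> \<le> 2 ^ n"
proof -
  have "\<bar>alt_sum n f\<bar> \<le> (\<Sum>c\<le>n. \<bar>(-1) ^ c * real (n choose c) * f c\<bar>)" unfolding alt_sum_def by (rule sum_abs)
  also have "\<dots> \<le> (\<Sum>c\<le>n. real (n choose c))"
    using assms by (intro sum_mono) (simp add: abs_mult mult_left_le)
  also have "\<dots> = 2 ^ n" using choose_row_sum[of n] by (metis of_nat_sum of_nat_numeral of_nat_power)
  finally show ?thesis .
qed

lemma pos_on_degree_gf: "pos_on k (gf_domain t) (\<lambda>r. degree_gf r t)"
  unfolding degree_gf_def by (intro pos_on_mult pos_on_mono_x pos_on_transf t)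

lemma grid_pt_domain: "grid_pt j \<mu> a c \<in> gf_domain t"
  using grid_pt_bounds iter_pos[where r = "grid_pt j \<mu> a c" and t = t] by (auto simp: gf_domain_def less_imp_le)

text \<open>The difference weights give a nonnegative functional on each monomial by
  \<open>alt_sum_mono_x\<close>, and the cone property extends this to \<open>degree_gf\<close>
  without expanding it.\<close>

lemma alt_sum_degree_gf_nonneg: "0 \<le> alt_sum n (\<lambda>c. degree_gf (grid_pt j \<mu> a c) t)"
proof -
  have "0 \<le> alt_sum n (\<lambda>c. mono_x k (grid_pt j \<mu> a c) x)" for x
    unfolding alt_sum_mono_x[OF j] using lam by (intro mult_nonneg_nonneg prod_nonneg) auto
  then have "0 \<le> (\<Sum>c<Suc n. ((-1) ^ c * real (n choose c)) * mono_x k (grid_pt j \<mu> a c) x)" for x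
    by (simp only: alt_sum_def lessThan_Suc_atMost)
  from pos_onD[OF pos_on_degree_gf grid_pt_domain this] show ?thesis
    by (simp only: alt_sum_def lessThan_Suc_atMost)
qed

text \<open>On monomials, (1 - exp(-z))^n is at most z^n, and this is at most a multiple of an
  exponential, that is, of a monomial whose base has \<open>exp \<eta>\<close> in place
  \<open>j\<close> and 1 elsewhere. \<open>pos_on\<close> turns this comparison of monomials into
  one of generating functions.\<close>

lemma alt_sum_degree_gf_le: "alt_sum n (\<lambda>c. degree_gf (grid_pt j \<mu> a c) t) \<le> diff_bound n * (\<mu> * exp (b j * t)) ^ n"
proof -
  \<comment> \<open>Small enough that \<open>2 * \<eta> * exp (b j * t)\<close> is 1/2, which keeps
    the arguments of the powers away from 0; its inverse supplies the growth
    \<open>exp (b j * t)\<close> in the bound.\<close>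
  define \<eta> where "\<eta> = 1 / (4 * exp (b j * t))"
  have bj: "1 \<le> exp (b j * t)" using b_pos[OF j] t by simp
  have \<eta>: "0 < \<eta>" "\<eta> \<le> 1 / 4" using bj by (auto simp: \<eta>_def field_simps)
  have exp_eta: "exp \<eta> - 1 \<le> 2 * \<eta>"
    using exp_bound_half[of \<eta>] \<eta> exp_bound_lemma[of \<eta>] by simp
  have vj: "1 / 2 \<le> exp \<eta> + (1 - exp \<eta>) * exp (b j * t) \<and> exp \<eta> + (1 - exp \<eta>) * exp (b j * t) \<le> 1"
  proof -
    define X Y where "X = exp \<eta>" and "Y = exp (b j * t)"
    have "(X - 1) * Y \<le> 2 * \<eta> * Y" unfolding X_def Y_def using exp_eta by (intro mult_right_mono) auto
    also have "\<dots> = 1 / 2" by (simp add: \<eta>_def Y_def)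
    finally have "(X - 1) * Y \<le> 1 / 2" .
    moreover have "1 < X" "0 \<le> (X - 1) * (Y - 1)" using \<eta> bj by (simp_all add: X_def Y_def)
    ultimately show ?thesis unfolding X_def[symmetric] Y_def[symmetric] by (auto simp: algebra_simps)
  qed
  define R where "R l = (if l = j then exp \<eta> else 1)" for l :: nat
  \<comment> \<open>Before index \<open>j\<close> the iteration stays at 1, at \<open>j\<close> the
    argument drops into [1/2, 1], and afterwards exponents in (0, 1) only push such numbers towards
    1.\<close>
  have vR: "1 / 2 \<le> iter R (flow_arg R t) l \<and> iter R (flow_arg R t) l \<le> 1 \<and> 1 / 2 \<le> iter_arg R (flow_arg R t) l
     \<and> iter_arg R (flow_arg R t) l \<le> 1 \<and> (l \<le> j \<longrightarrow> iter R (flow_arg R t) l = 1)" if "l \<le> k" for l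
    using that
  proof (induction l)
    case 0
    show ?case
    proof (cases "j = 0")
      case True
      then show ?thesis using vj by (simp add: iter_arg_def flow_arg_def R_def)
    next
      case False
      then show ?thesis by (simp add: iter_arg_def flow_arg_def R_def)
    qed
  next
    case (Suc l)
    let ?y = "iter R (flow_arg R t) (Suc l)" and ?v = "iter_arg R (flow_arg R t) l" and ?\<beta> = "b (Suc l) / b l"
    have IH: "1 / 2 \<le> ?v" "?v \<le> 1" using Suc by auto
    have be: "0 < ?\<beta>" "?\<beta> < 1" using beta_bounds[OF Suc.prems] by auto
    have y1: "?y \<le> 1"
      unfolding iter_Suc using IH be powr_mono2[of ?\<beta> ?v 1] by simp
    have "?v powr 1 \<le> ?v powr ?\<beta>"
      using IH be by (intro powr_mono') auto
    then have y2: "1 / 2 \<le> ?y" unfolding iter_Suc using IH by simp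
    have yj: "?y = 1" if "Suc l \<le> j"
    proof -
      have "iter R (flow_arg R t) l = 1" using Suc that by auto
      then have "?v = 1" using that by (simp add: iter_arg_def flow_arg_def R_def)
      then show ?thesis unfolding iter_Suc by simp
    qed
    have "1 / 2 \<le> iter_arg R (flow_arg R t) (Suc l) \<and> iter_arg R (flow_arg R t) (Suc l) \<le> 1"
    proof (cases "Suc l = j")
      case True
      have "iter_arg R (flow_arg R t) (Suc l) = exp \<eta> + (1 - exp \<eta>) * exp (b j * t)"
        using yj True unfolding iter_arg_def by (simp add: flow_arg_def R_def del: iter.simps)
      then show ?thesis using vj by simp
    next
      case False
      then have "iter_arg R (flow_arg R t) (Suc l) = ?y" unfolding iter_arg_def by (simp add: flow_arg_def R_def del: iter.simps)
      then show ?thesis using y1 y2 by simp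
    qed
    then show ?case using y1 y2 yj by blast
  qed
  have R\<Omega>: "R \<in> gf_domain t"
    using vR by (force simp: gf_domain_def R_def)
  have mR: "mono_x k R x = exp (\<eta> * real (x j))" for x
  proof -
    have "mono_x k R x = (\<Prod>l\<le>k. if l = j then exp (\<eta> * real (x l)) else 1)"
      unfolding mono_x_def R_def by (intro prod.cong refl) (auto simp: exp_of_nat_mult[symmetric] mult.commute)
    then show ?thesis using j by simp
  qed
  define K1 where "K1 = fact n * (\<mu> / \<eta>) ^ n"
  have K1: "0 \<le> K1" using lam \<eta> by (simp add: K1_def)
  have mb: "alt_sum n (\<lambda>c. mono_x k (grid_pt j \<mu> a c) x) \<le> K1 * mono_x k R x" for x
  proof -
    let ?X = "real (x j)"
    have "0 \<le> 1 - exp (- (\<mu> * ?X))" "1 - exp (- (\<mu> * ?X)) \<le> \<mu> * ?X"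
      using lam exp_ge_add_one_self[of "- (\<mu> * ?X)"] by auto
    then have "(1 - exp (- (\<mu> * ?X))) ^ n \<le> (\<mu> * ?X) ^ n" by (intro power_mono) auto
    also have "(\<mu> * ?X) ^ n = (\<mu> / \<eta>) ^ n * (\<eta> * ?X) ^ n"
      using \<eta> by (simp add: power_mult_distrib[symmetric])
    also have "\<dots> \<le> (\<mu> / \<eta>) ^ n * (fact n * exp (\<eta> * ?X))"
      using \<eta> lam by (intro mult_left_mono power_le_fact_exp) auto
    finally have 1: "(1 - exp (- (\<mu> * ?X))) ^ n \<le> K1 * mono_x k R x" by (simp add: K1_def mR mult_ac)
    have "(\<Prod>l\<le>k. exp (- (a l * real (x l)))) \<le> 1"
      using a by (intro prod_le_1) auto
    then have "(\<Prod>l\<le>k. exp (- (a l * real (x l)))) * (1 - exp (- (\<mu> * ?X))) ^ n \<le> 1 * (1 - exp (- (\<mu> * ?X))) ^ n"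
      using lam by (intro mult_right_mono) auto
    then show ?thesis using 1 by (simp add: alt_sum_mono_x[OF j])
  qed
  \<comment> \<open>The functional "\<open>K1\<close> times evaluation at \<open>R\<close> minus the
    \<open>n\<close>-th difference": nodes 0 to \<open>n\<close> are the grid points, node
    \<open>n + 1\<close> is \<open>R\<close>.\<close>
  define P where "P c = (if c \<le> n then grid_pt j \<mu> a c else R)" for c
  define w where "w c = (if c \<le> n then - ((-1) ^ c * real (n choose c)) else K1)" for c
  have split: "(\<Sum>c<Suc (Suc n). w c * F (P c)) = K1 * F R - alt_sum n (\<lambda>c. F (grid_pt j \<mu> a c))" for F
  proof -
    have "(\<Sum>c<Suc n. w c * F (P c)) = - alt_sum n (\<lambda>c. F (grid_pt j \<mu> a c))"
      unfolding alt_sum_def lessThan_Suc_atMost sum_negf[symmetric]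
      by (intro sum.cong refl) (auto simp: w_def P_def)
    then show ?thesis unfolding sum.lessThan_Suc[of _ "Suc n"] by (simp add: w_def P_def)
  qed
  have "0 \<le> (\<Sum>c<Suc (Suc n). w c * degree_gf (P c) t)"
  proof (rule pos_onD[OF pos_on_degree_gf])
    show "P c \<in> gf_domain t" for c using grid_pt_domain R\<Omega> by (simp add: P_def)
    show "0 \<le> (\<Sum>c<Suc (Suc n). w c * mono_x k (P c) x)" for x
      unfolding split[of "\<lambda>r. mono_x k r x"] using mb[of x] by simp
  qed
  then have 1: "alt_sum n (\<lambda>c. degree_gf (grid_pt j \<mu> a c) t) \<le> K1 * degree_gf R t"
    unfolding split[of "\<lambda>r. degree_gf r t"] by simp
  have "mono_x k R (\<lambda>l. k - l + 1) \<le> exp (real k + 1)"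
  proof -
    have "\<eta> * real (k - j + 1) \<le> 1 * (real k + 1)" using \<eta> by (intro mult_mono) auto
    then show ?thesis unfolding mR by simp
  qed
  moreover have "transf R (flow_arg R t) \<le> (\<Prod>m\<le>k. (1 / 2) powr (- (1 + \<delta>) / b m))"
    unfolding transf_def
  proof (intro prod_mono conjI)
    fix m assume "m \<in> {..k}"
    then have "1 / 2 \<le> iter_arg R (flow_arg R t) m" "0 < b m" using vR b_pos by auto
    then show "iter_arg R (flow_arg R t) m powr (- (1 + \<delta>) / b m) \<le> (1 / 2) powr (- (1 + \<delta>) / b m)"
      using delta by (intro powr_mono2') (auto simp: divide_nonpos_pos)
  qed auto
  ultimately have "degree_gf R t \<le> exp (real k + 1) * (\<Prod>m\<le>k. (1 / 2) powr (- (1 + \<delta>) / b m))"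
    unfolding degree_gf_def by (intro mult_mono) (auto simp: transf_def prod_nonneg)
  then have "K1 * degree_gf R t \<le> K1 * (exp (real k + 1) * (\<Prod>m\<le>k. (1 / 2) powr (- (1 + \<delta>) / b m)))"
    using K1 by (intro mult_left_mono)
  also have "\<dots> = diff_bound n * (\<mu> * exp (b j * t)) ^ n"
    by (simp add: K1_def diff_bound_def \<eta>_def power_mult_distrib mult_ac)
  finally show ?thesis using 1 by simp
qed

end

end

section \<open>The scaling limit of the differences\<close>

lemma set_integrable_exp_pos:
  fixes a :: real assumes "0 < a"
  shows "set_integrable lborel {..0} (\<lambda>t. exp (a * t))"
proof -
  have "integrable lborel (\<lambda>t. indicator {0..} t * exp (- (a * t)))"
    using set_integrable_exp_neg[OF assms] by (simp add: set_integrable_def)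
  then have "integrable lborel (\<lambda>t. indicator {0..} (0 + (-1) * t) * exp (- (a * (0 + (-1) * t))))"
    by (subst lborel_integrable_real_affine_iff) auto
  moreover have "indicator {0..} (0 + (-1) * t) = (indicator {..0} t :: real)" for t :: real
    by (auto simp: indicator_def)
  ultimately show ?thesis by (simp add: set_integrable_def)
qed

text \<open>A difference quotient of the exponential at 0, along
  \<open>h powr (- c)\<close>.\<close>

lemma one_minus_exp_scaled:
  fixes \<theta> c :: real assumes "0 < c"
  shows "((\<lambda>h. (1 - exp (- (\<theta> * h powr (- c)))) * h powr c) \<longlongrightarrow> \<theta>) at_top"
proof -
  have "((\<lambda>y. exp (- (\<theta> * y))) has_real_derivative - \<theta>) (at 0)"
    by (auto intro!: derivative_eq_intros)
  then have "((\<lambda>y. (exp (- (\<theta> * y)) - 1) / y) \<longlongrightarrow> - \<theta>) (at 0)"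
    by (simp add: DERIV_def)
  then have "((\<lambda>y. - ((exp (- (\<theta> * y)) - 1) / y)) \<longlongrightarrow> \<theta>) (at 0)"
    using tendsto_minus by fastforce
  moreover have "filterlim (\<lambda>h. h powr (- c)) (at 0) at_top"
  proof (rule filterlim_atI)
    show "((\<lambda>h. h powr (- c)) \<longlongrightarrow> (0::real)) at_top" using assms by real_asymp
    show "\<forall>\<^sub>F h in at_top. h powr (- c) \<noteq> (0::real)"
      using eventually_gt_at_top[of "0::real"] by eventually_elim simp
  qed
  ultimately have "((\<lambda>h. - ((exp (- (\<theta> * h powr (- c))) - 1) / h powr (- c))) \<longlongrightarrow> \<theta>) at_top"
    by (rule filterlim_compose)
  then show ?thesis by (simp add: powr_minus field_simps)
qed

context tree_params
begin

text \<open>The same \<open>n\<close>-th difference for the Laplace transform of the limit vector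
  with arguments scaled by \<open>exp (b l * s)\<close>; see
  \<open>expectation_limit_diff\<close>.\<close>

definition limit_diff :: "nat \<Rightarrow> nat \<Rightarrow> (nat \<Rightarrow> real) \<Rightarrow> real \<Rightarrow> real" where
  "limit_diff j n a s = alt_sum n (\<lambda>c. transf (\<lambda>_. 1) (\<lambda>l. (a l + (if l = j then real c else 0)) * exp (b l * s)))"

definition deg_scale :: "real \<Rightarrow> nat \<Rightarrow> real" where
  "deg_scale h l = h powr (- (b l / \<tau>))"

text \<open>This shift makes \<open>deg_scale h l * exp (b l * shift_time h s)\<close> equal to
  \<open>exp (b l * s)\<close> for every \<open>l\<close> at once, free of \<open>h\<close>.\<close>

definition shift_time :: "real \<Rightarrow> real \<Rightarrow> real" where
  "shift_time h s = s + ln h / \<tau>"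

lemma exp_shift_time: "0 < h \<Longrightarrow> exp (b l * shift_time h s) = exp (b l * s) * h powr (b l / \<tau>)"
  using tau_pos by (simp add: shift_time_def powr_def exp_add[symmetric] algebra_simps)

lemma grid_pt_deg_scale: "grid_pt j (deg_scale h j) (\<lambda>l. a l * deg_scale h l) c l = exp (- ((a l + (if l = j then real c else 0)) * deg_scale h l))"
  by (simp add: grid_pt_def algebra_simps)

text \<open>The grid points tend to 1, so the starting monomial disappears and \<open>c\<close>
  becomes 1, while 1 minus a grid coordinate, multiplied by the growing exponential, tends to the
  scaled Laplace variable.\<close>

lemma degree_gf_tendsto:
  assumes a: "\<And>l. l \<le> k \<Longrightarrow> 0 \<le> a l"
  shows "((\<lambda>h. degree_gf (grid_pt j (deg_scale h j) (\<lambda>l. a l * deg_scale h l) c) (shift_time h s)) \<longlongrightarrow>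
     transf (\<lambda>_. 1) (\<lambda>l. (a l + (if l = j then real c else 0)) * exp (b l * s))) at_top"
proof -
  let ?p = "\<lambda>h. grid_pt j (deg_scale h j) (\<lambda>l. a l * deg_scale h l) c"
  let ?\<theta> = "\<lambda>l. a l + (if l = j then real c else 0)"
  have p1: "((\<lambda>h. ?p h l) \<longlongrightarrow> 1) at_top" if "l \<le> k" for l
  proof -
    have c: "0 < b l / \<tau>" using b_pos[OF that] tau_pos by simp
    have "((\<lambda>h. h powr (- (b l / \<tau>))) \<longlongrightarrow> 0) at_top" using c by real_asymp
    then have "((\<lambda>h. exp (- (?\<theta> l * deg_scale h l))) \<longlongrightarrow> exp (- (?\<theta> l * 0))) at_top"
      unfolding deg_scale_def by (intro tendsto_intros)
    then show ?thesis unfolding grid_pt_deg_scale by simp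
  qed
  have d: "((\<lambda>h. flow_arg (?p h) (shift_time h s) l) \<longlongrightarrow> ?\<theta> l * exp (b l * s)) at_top" if "l \<le> k" for l
  proof -
    have c: "0 < b l / \<tau>" using b_pos[OF that] tau_pos by simp
    have "((\<lambda>h. ((1 - exp (- (?\<theta> l * deg_scale h l))) * h powr (b l / \<tau>)) * exp (b l * s)) \<longlongrightarrow> ?\<theta> l * exp (b l * s)) at_top"
      unfolding deg_scale_def by (intro tendsto_intros one_minus_exp_scaled c)
    moreover have "\<forall>\<^sub>F h in at_top. ((1 - exp (- (?\<theta> l * deg_scale h l))) * h powr (b l / \<tau>)) * exp (b l * s)
        = flow_arg (?p h) (shift_time h s) l"
      using eventually_gt_at_top[of "0::real"]
      by eventually_elim (simp add: flow_arg_def grid_pt_deg_scale exp_shift_time)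
    ultimately show ?thesis by (rule Lim_transform_eventually)
  qed
  have pos: "0 < iter_arg (\<lambda>_. 1) (\<lambda>l. ?\<theta> l * exp (b l * s)) l" if "l \<le> k" for l
  proof -
    have "0 \<le> ?\<theta> j * exp (b j * s)" if "j \<le> k" for j using a[OF that] by simp
    then show ?thesis using iter_pos_general[of "\<lambda>_. 1" "\<lambda>l. ?\<theta> l * exp (b l * s)" l] that
      by (fastforce simp: add_pos_nonneg)
  qed
  have "((\<lambda>h. mono_x k (?p h) (\<lambda>l. k - l + 1) * transf (?p h) (flow_arg (?p h) (shift_time h s)))
     \<longlongrightarrow> mono_x k (\<lambda>_. 1) (\<lambda>l. k - l + 1) * transf (\<lambda>_. 1) (\<lambda>l. ?\<theta> l * exp (b l * s))) at_top"
    unfolding mono_x_def by (intro tendsto_intros tendsto_transf p1 d pos) auto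
  then show ?thesis by (simp add: degree_gf_def mono_x_def)
qed

lemma continuous_degree_gf:
  assumes "\<And>l. l \<le> k \<Longrightarrow> 0 < r l \<and> r l \<le> 1"
  shows "continuous_on UNIV (\<lambda>t. degree_gf r t)"
  unfolding degree_gf_def
  by (intro continuous_at_imp_continuous_on ballI continuous_intros DERIV_isCont[OF deriv_transf[OF assms]])

text \<open>After the shift \<open>t = s + ln h / \<tau>\<close> the \<open>n\<close>-th difference is at most a multiple of
  \<open>exp (n b\<^sub>j s)\<close>, which for \<open>n > \<tau>\<close> beats the exponential weight as \<open>s \<rightarrow> -\<infinity>\<close>.\<close>

lemma alt_sum_integral_limit:
  assumes j: "j \<le> k" and a: "\<And>l. l \<le> k \<Longrightarrow> 0 \<le> a l" and n: "\<tau> < real n"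
  defines "S \<equiv> \<lambda>h s. indicator {0<..} (shift_time h s) * (\<tau> * exp (- (\<tau> * s)))
       * alt_sum n (\<lambda>c. degree_gf (grid_pt j (deg_scale h j) (\<lambda>l. a l * deg_scale h l) c) (shift_time h s))"
  shows "((\<lambda>h. LINT s|lborel. S h s) \<longlongrightarrow> (LINT s|lborel. \<tau> * exp (- (\<tau> * s)) * limit_diff j n a s)) at_top"
    and "integrable lborel (\<lambda>s. \<tau> * exp (- (\<tau> * s)) * limit_diff j n a s)"
    and "0 \<le> limit_diff j n a s"
proof -
  let ?D = "\<lambda>h s. alt_sum n (\<lambda>c. degree_gf (grid_pt j (deg_scale h j) (\<lambda>l. a l * deg_scale h l) c) (shift_time h s))"
  have pt01: "0 < grid_pt j (deg_scale h j) (\<lambda>l. a l * deg_scale h l) c l \<and> grid_pt j (deg_scale h j) (\<lambda>l. a l * deg_scale h l) c l \<le> 1"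
    if "l \<le> k" for h c l
    using a by (intro grid_pt_bounds that) (auto simp: deg_scale_def j)
  have D: "0 \<le> ?D h s" "\<bar>?D h s\<bar> \<le> 2 ^ n" "?D h s \<le> diff_bound n * exp (b j * s) ^ n"
    if "0 < h" "0 < shift_time h s" for h s
  proof -
    have sc0: "0 \<le> deg_scale h j" and T: "0 \<le> shift_time h s" and a': "\<And>l. l \<le> k \<Longrightarrow> 0 \<le> a l * deg_scale h l"
      using that a by (auto simp: deg_scale_def)
    show "0 \<le> ?D h s" by (rule alt_sum_degree_gf_nonneg[OF j sc0 T a'])
    show "\<bar>?D h s\<bar> \<le> 2 ^ n"
      using degree_gf_bounds[where a = "\<lambda>l. a l * deg_scale h l", OF j sc0 T a']
      by (intro alt_sum_abs_le[OF j sc0 T a']) (auto simp: abs_le_iff intro: order_trans[of _ 0])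
    have "?D h s \<le> diff_bound n * (deg_scale h j * exp (b j * shift_time h s)) ^ n"
      by (rule alt_sum_degree_gf_le[OF j sc0 T a'])
    also have "deg_scale h j * exp (b j * shift_time h s) = exp (b j * s)"
      using that by (simp add: exp_shift_time deg_scale_def powr_minus)
    finally show "?D h s \<le> diff_bound n * exp (b j * s) ^ n" .
  qed
  have lim: "((\<lambda>h. ?D h s) \<longlongrightarrow> limit_diff j n a s) at_top" for s
    unfolding alt_sum_def limit_diff_def by (intro tendsto_intros degree_gf_tendsto a)
  have ev: "\<forall>\<^sub>F h in at_top. 0 < shift_time h s" for s
    unfolding shift_time_def using tau_pos by real_asymp
  show "0 \<le> limit_diff j n a s"
  proof (rule tendsto_lowerbound[OF lim])
    show "\<forall>\<^sub>F h in at_top. 0 \<le> ?D h s"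
      using ev[of s] eventually_gt_at_top[of "0::real"] by eventually_elim (rule D)
  qed simp
  have KK0: "0 \<le> diff_bound n" by (simp add: diff_bound_def prod_nonneg)
  \<comment> \<open>The place where \<open>b j \<ge> 1\<close> lets the condition on
    \<open>n\<close> be independent of \<open>j\<close>.\<close>
  have nb: "0 < real n * b j - \<tau>"
  proof -
    have "real n * 1 \<le> real n * b j" by (intro mult_left_mono b_ge_1 j) simp
    then show ?thesis using n by linarith
  qed
  \<comment> \<open>A dominating function free of \<open>h\<close>: the trivial bound
    \<open>2 ^ n\<close> for \<open>s \<ge> 0\<close>, and \<open>diff_bound\<close> with the
    positive exponent \<open>real n * b j - \<tau>\<close> for \<open>s \<le> 0\<close>.\<close>
  let ?w = "\<lambda>s. \<tau> * 2 ^ n * (indicator {0..} s * exp (- (\<tau> * s)))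
       + \<tau> * diff_bound n * (indicator {..0} s * exp ((real n * b j - \<tau>) * s)) :: real"
  have w: "integrable lborel ?w"
    using set_integrable_exp_neg[OF tau_pos] set_integrable_exp_pos[OF nb]
    by (intro Bochner_Integration.integrable_add integrable_mult_right) (auto simp: set_integrable_def)
  have bound: "norm (S h s) \<le> ?w s" if h: "0 < h" for h s
  proof (cases "0 < shift_time h s")
    case True
    have S: "norm (S h s) = \<tau> * exp (- (\<tau> * s)) * ?D h s"
      unfolding S_def using True D(1)[OF h True] tau_pos by (simp add: abs_mult)
    show ?thesis
    proof (cases "0 \<le> s")
      case s: True
      have "norm (S h s) \<le> \<tau> * exp (- (\<tau> * s)) * 2 ^ n"
        unfolding S using D(2)[OF h True] tau_pos by (intro mult_left_mono) auto
      moreover have "0 \<le> \<tau> * diff_bound n * (indicator {..0} s * exp ((real n * b j - \<tau>) * s))"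
        using tau_pos KK0 by simp
      ultimately show ?thesis using s by (simp add: mult_ac)
    next
      case s: False
      have "norm (S h s) \<le> \<tau> * exp (- (\<tau> * s)) * (diff_bound n * exp (b j * s) ^ n)"
        unfolding S using D(3)[OF h True] tau_pos by (intro mult_left_mono) auto
      also have "\<dots> = \<tau> * diff_bound n * exp ((real n * b j - \<tau>) * s)"
        by (simp add: exp_of_nat_mult[symmetric] exp_add[symmetric] exp_diff exp_minus field_simps)
      finally show ?thesis using s by simp
    qed
  next
    case False
    have "0 \<le> ?w s" using tau_pos KK0 by simp
    then show ?thesis using False by (simp add: S_def)
  qed
  have [measurable]: "shift_time h \<in> borel_measurable borel" for h unfolding shift_time_def by measurable
  have [measurable]: "(\<lambda>s. degree_gf (grid_pt j (deg_scale h j) (\<lambda>l. a l * deg_scale h l) c) s) \<in> borel_measurable borel" for h c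
    by (intro borel_measurable_continuous_onI continuous_degree_gf pt01)
  have Sm: "S h \<in> borel_measurable lborel" for h
    unfolding S_def alt_sum_def by measurable
  have Slim: "((\<lambda>h. S h s) \<longlongrightarrow> \<tau> * exp (- (\<tau> * s)) * limit_diff j n a s) at_top" for s
  proof (rule Lim_transform_eventually)
    show "((\<lambda>h. \<tau> * exp (- (\<tau> * s)) * ?D h s) \<longlongrightarrow> \<tau> * exp (- (\<tau> * s)) * limit_diff j n a s) at_top"
      by (intro tendsto_intros lim)
    show "\<forall>\<^sub>F h in at_top. \<tau> * exp (- (\<tau> * s)) * ?D h s = S h s"
      using ev[of s] by eventually_elim (simp add: S_def)
  qed
  have fm: "(\<lambda>s. \<tau> * exp (- (\<tau> * s)) * limit_diff j n a s) \<in> borel_measurable lborel"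
  proof (rule borel_measurable_LIMSEQ_real)
    show "(\<lambda>i. S (real i) s) \<longlonglongrightarrow> \<tau> * exp (- (\<tau> * s)) * limit_diff j n a s" for s
      by (rule filterlim_compose[OF Slim filterlim_real_sequentially])
  qed (rule Sm)
  have evb: "\<forall>\<^sub>F h in at_top. AE s in lborel. norm (S h s) \<le> ?w s"
    using eventually_gt_at_top[of "0::real"] by eventually_elim (intro AE_I2 bound)
  have AElim: "AE s in lborel. ((\<lambda>h. S h s) \<longlongrightarrow> \<tau> * exp (- (\<tau> * s)) * limit_diff j n a s) at_top"
    by (intro AE_I2 Slim)
  show "((\<lambda>h. LINT s|lborel. S h s) \<longlongrightarrow> (LINT s|lborel. \<tau> * exp (- (\<tau> * s)) * limit_diff j n a s)) at_top"
    by (rule integral_dominated_convergence_at_top[OF fm Sm w AElim evb])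
  show "integrable lborel (\<lambda>s. \<tau> * exp (- (\<tau> * s)) * limit_diff j n a s)"
    by (rule integrable_dominated_convergence_at_top[OF fm Sm w AElim evb])
qed

end

context tree_law
begin

text \<open>The test function is an \<open>n\<close>-th difference of monomials in the degrees, so
  \<open>gf\<close> writes its mean as one integral in \<open>t\<close>, to which
  \<open>alt_sum_integral_limit\<close> applies after the time shift.\<close>

lemma expectation_limit:
  assumes j: "j \<le> k" and a: "\<And>l. l \<le> k \<Longrightarrow> 0 \<le> a l" and n: "\<tau> < real n"
  shows "((\<lambda>h. h * measure_pmf.expectation q (\<lambda>i. (\<Prod>l\<le>k. exp (- (a l * (deg_scale h l * real (i l)))))
         * (1 - exp (- (deg_scale h j * real (i j)))) ^ n))
     \<longlongrightarrow> (LINT s|lborel. \<tau> * exp (- (\<tau> * s)) * limit_diff j n a s)) at_top"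
proof (rule Lim_transform_eventually[OF alt_sum_integral_limit(1)[OF j a n]])
  show "\<forall>\<^sub>F h in at_top. (LINT s|lborel. indicator {0<..} (shift_time h s) * (\<tau> * exp (- (\<tau> * s)))
       * alt_sum n (\<lambda>c. degree_gf (grid_pt j (deg_scale h j) (\<lambda>l. a l * deg_scale h l) c) (shift_time h s)))
     = h * measure_pmf.expectation q (\<lambda>i. (\<Prod>l\<le>k. exp (- (a l * (deg_scale h l * real (i l)))))
         * (1 - exp (- (deg_scale h j * real (i j)))) ^ n)"
    using eventually_gt_at_top[of "0::real"]
  proof eventually_elim
    fix h :: real assume h: "0 < h"
    let ?p = "grid_pt j (deg_scale h j) (\<lambda>l. a l * deg_scale h l)"
    have p01: "0 < ?p c l \<and> ?p c l \<le> 1" if "l \<le> k" for c l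
      using a by (intro grid_pt_bounds that) (auto simp: deg_scale_def j)
    have mb: "\<bar>mono_x k (?p c) x\<bar> \<le> 1" for c x
    proof -
      have "0 \<le> mono_x k (?p c) x" "mono_x k (?p c) x \<le> 1"
        using mono_x_bounds[of k "?p c" x] p01 by (auto simp: less_imp_le)
      then show ?thesis by simp
    qed
    let ?g = "\<lambda>c t. \<tau> * exp (- (\<tau> * t)) * degree_gf (?p c) t"
    have gm: "(\<lambda>t. degree_gf (?p c) t) \<in> borel_measurable borel" for c
      by (intro borel_measurable_continuous_onI continuous_degree_gf p01)
    have gi: "integrable lborel (\<lambda>t. indicator {0<..} t * ?g c t)" for c
    proof (rule Bochner_Integration.integrable_bound)
      show "integrable lborel (\<lambda>t. \<tau> * (indicator {0..} t * exp (- (\<tau> * t))))"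
        using set_integrable_exp_neg[OF tau_pos] by (simp add: set_integrable_def)
      show "(\<lambda>t. indicator {0<..} t * ?g c t) \<in> borel_measurable lborel" using gm by measurable
      show "AE t in lborel. norm (indicator {0<..} t * ?g c t) \<le> norm (\<tau> * (indicator {0..} t * exp (- (\<tau> * t))))"
      proof (intro AE_I2)
        fix t :: real
        have "0 \<le> degree_gf (?p c) t \<and> degree_gf (?p c) t \<le> 1" if "0 < t"
          using degree_gf_bounds[where j = j and \<mu> = "deg_scale h j" and t = t and a = "\<lambda>l. a l * deg_scale h l" and c = c] j that a
          by (auto simp: deg_scale_def)
        then show "norm (indicator {0<..} t * ?g c t) \<le> norm (\<tau> * (indicator {0..} t * exp (- (\<tau> * t))))"
          using tau_pos by (auto simp: indicator_def abs_mult mult_left_le)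
      qed
    qed
    have mc: "measure_pmf.expectation q (\<lambda>i. mono_x k (?p c) i) = (LINT t|lborel. indicator {0<..} t * ?g c t)" for c
    proof -
      have "measure_pmf.expectation q (\<lambda>i. mono_x k (?p c) i)
         = measure_pmf.expectation q (\<lambda>i. mono_x k (?p c) (\<lambda>l. k - l + 1) * mono_x k (?p c) (excess i))"
      proof (rule integral_cong_AE)
        have "mono_x k (?p c) i = mono_x k (?p c) (\<lambda>l. k - l + 1) * mono_x k (?p c) (excess i)" if "i \<in> adm_indices" for i
          unfolding mono_x_add[symmetric] unfolding mono_x_def
        proof (intro prod.cong refl)
          fix l assume "l \<in> {..k}"
          then have "i l = k - l + 1 + excess i l" using that admissible_ge[of i l] by (auto simp: adm_indices_def excess_def)
          then show "?p c l ^ i l = ?p c l ^ (k - l + 1 + excess i l)" by (rule arg_cong)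
        qed
        then show "AE i in measure_pmf q. mono_x k (?p c) i = mono_x k (?p c) (\<lambda>l. k - l + 1) * mono_x k (?p c) (excess i)"
          using set_pmf_q by (auto simp: AE_measure_pmf_iff)
      qed auto
      also have "\<dots> = mono_x k (?p c) (\<lambda>l. k - l + 1) * (LINT t:{0<..}|lborel. \<tau> * exp (- (\<tau> * t)) * transf (?p c) (flow_arg (?p c) t))"
        by (simp add: gf[OF p01])
      also have "\<dots> = (LINT t|lborel. indicator {0<..} t * ?g c t)"
        unfolding set_lebesgue_integral_def integral_mult_right_zero[symmetric]
        by (intro Bochner_Integration.integral_cong refl) (simp add: degree_gf_def)
      finally show ?thesis .
    qed
    have "measure_pmf.expectation q (\<lambda>i. (\<Prod>l\<le>k. exp (- (a l * (deg_scale h l * real (i l)))))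
         * (1 - exp (- (deg_scale h j * real (i j)))) ^ n)
       = measure_pmf.expectation q (\<lambda>i. alt_sum n (\<lambda>c. mono_x k (?p c) i))"
      unfolding alt_sum_mono_x[OF j] by (simp add: mult.assoc)
    also have "\<dots> = alt_sum n (\<lambda>c. measure_pmf.expectation q (\<lambda>i. mono_x k (?p c) i))"
      unfolding alt_sum_def
      by (subst Bochner_Integration.integral_sum)
        (use mb in \<open>auto intro!: measure_pmf.integrable_const_bound[where B = 1] integrable_mult_right\<close>)
    also have "\<dots> = alt_sum n (\<lambda>c. LINT t|lborel. indicator {0<..} t * ?g c t)" by (simp only: mc)
    also have "\<dots> = (LINT t|lborel. alt_sum n (\<lambda>c. indicator {0<..} t * ?g c t))"
      unfolding alt_sum_def
      by (subst Bochner_Integration.integral_sum) (use gi in \<open>auto intro!: integrable_mult_right\<close>)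
    also have "\<dots> = (LINT t|lborel. indicator {0<..} t * (\<tau> * exp (- (\<tau> * t))) * alt_sum n (\<lambda>c. degree_gf (?p c) t))"
      by (intro Bochner_Integration.integral_cong refl) (simp add: alt_sum_def sum_distrib_left mult_ac)
    \<comment> \<open>Substituting \<open>t = shift_time h s\<close> produces the factor
      \<open>1 / h\<close> out of \<open>exp (- (\<tau> * t))\<close>; it cancels the prefactor
      \<open>h\<close>.\<close>
    also have "\<dots> = (LINT s|lborel. indicator {0<..} (shift_time h s) * (\<tau> * exp (- (\<tau> * shift_time h s))) * alt_sum n (\<lambda>c. degree_gf (?p c) (shift_time h s)))"
      by (subst lborel_integral_real_affine[of 1 _ "ln h / \<tau>"]) (simp_all add: shift_time_def add.commute)
    also have "\<dots> = (LINT s|lborel. (1 / h) * (indicator {0<..} (shift_time h s) * (\<tau> * exp (- (\<tau> * s))) * alt_sum n (\<lambda>c. degree_gf (?p c) (shift_time h s))))"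
    proof (intro Bochner_Integration.integral_cong refl)
      fix s
      have "exp (- (\<tau> * shift_time h s)) = exp (- (\<tau> * s)) / h"
      proof -
        have "- (\<tau> * shift_time h s) = - (\<tau> * s) - ln h" using tau_pos by (simp add: shift_time_def field_simps)
        then show ?thesis using h by (simp only: exp_diff exp_ln)
      qed
      then show "indicator {0<..} (shift_time h s) * (\<tau> * exp (- (\<tau> * shift_time h s))) * alt_sum n (\<lambda>c. degree_gf (?p c) (shift_time h s))
        = (1 / h) * (indicator {0<..} (shift_time h s) * (\<tau> * exp (- (\<tau> * s))) * alt_sum n (\<lambda>c. degree_gf (?p c) (shift_time h s)))"
        by simp
    qed
    finally show "(LINT s|lborel. indicator {0<..} (shift_time h s) * (\<tau> * exp (- (\<tau> * s)))
       * alt_sum n (\<lambda>c. degree_gf (?p c) (shift_time h s)))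
     = h * measure_pmf.expectation q (\<lambda>i. (\<Prod>l\<le>k. exp (- (a l * (deg_scale h l * real (i l)))))
         * (1 - exp (- (deg_scale h j * real (i j)))) ^ n)"
      using h by (simp add: integral_mult_right_zero)
  qed
qed

end

section \<open>The Laplace transform of the limit vector\<close>

lemma nn_integral_gamma:
  fixes a c :: real assumes a: "0 < a" and c: "0 < c"
  shows "(\<integral>\<^sup>+x\<in>{0<..}. ennreal (x powr (a - 1) * exp (- (c * x))) \<partial>lborel) = ennreal (Gamma a * c powr (- a))"
proof -
  let ?f = "\<lambda>x. ennreal (indicator {0..} x * x powr (a - 1) / exp x)"
  have "ennreal (Gamma a) = (\<integral>\<^sup>+x. ?f x \<partial>lborel)" by (rule Gamma_conv_nn_integral_real[OF a])
  also have "\<dots> = \<bar>c\<bar> * (\<integral>\<^sup>+x. ?f (0 + c * x) \<partial>lborel)"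
    by (rule nn_integral_real_affine) (use c in auto)
  also have "(\<integral>\<^sup>+x. ?f (0 + c * x) \<partial>lborel) = (\<integral>\<^sup>+x. ennreal (c powr (a - 1)) * (ennreal (x powr (a - 1) * exp (- (c * x))) * indicator {0<..} x) \<partial>lborel)"
  proof (intro nn_integral_cong)
    fix x :: real
    show "?f (0 + c * x) = ennreal (c powr (a - 1)) * (ennreal (x powr (a - 1) * exp (- (c * x))) * indicator {0<..} x)"
    proof (cases "0 < x")
      case True
      then have "(c * x) powr (a - 1) / exp (c * x) = c powr (a - 1) * (x powr (a - 1) * exp (- (c * x)))"
        using c by (simp add: powr_mult exp_minus field_simps)
      then show ?thesis using True c by (simp add: ennreal_mult'[symmetric])
    next
      case False
      then show ?thesis using c by (cases "x = 0") (auto simp: indicator_def zero_le_mult_iff)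
    qed
  qed
  also have "\<dots> = ennreal (c powr (a - 1)) * (\<integral>\<^sup>+x\<in>{0<..}. ennreal (x powr (a - 1) * exp (- (c * x))) \<partial>lborel)"
    by (rule nn_integral_cmult) auto
  finally have e: "ennreal (Gamma a) = ennreal (c powr a) * (\<integral>\<^sup>+x\<in>{0<..}. ennreal (x powr (a - 1) * exp (- (c * x))) \<partial>lborel)"
    using c by (simp add: mult.assoc[symmetric] ennreal_mult'[symmetric] powr_mult_base)
  have "ennreal (Gamma a * c powr (- a)) = ennreal (c powr (- a)) * ennreal (Gamma a)"
    by (subst ennreal_mult'[symmetric]) (auto simp: mult.commute)
  also have "\<dots> = ennreal (c powr (- a) * c powr a) * (\<integral>\<^sup>+x\<in>{0<..}. ennreal (x powr (a - 1) * exp (- (c * x))) \<partial>lborel)"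
    unfolding e by (simp add: mult.assoc[symmetric] ennreal_mult'[symmetric])
  finally show ?thesis using c by (simp add: powr_minus)
qed

text \<open>Writing \<open>1 - exp (-\<theta> x)\<close> as the integral of \<open>x exp (-u x)\<close> over \<open>0 < u < \<theta>\<close> turns the
  exponent of the subordinator into Gamma integrals.\<close>

lemma stable_exponent:
  fixes \<beta> \<theta> :: real assumes \<beta>: "0 < \<beta>" "\<beta> < 1" and \<theta>: "0 \<le> \<theta>"
  shows "(LINT x:{0<..}|lborel. (1 - exp (- \<theta> * x)) * (\<beta> / Gamma (1 - \<beta>) * x powr (- 1 - \<beta>) * exp (- x)))
     = (1 + \<theta>) powr \<beta> - 1"
proof -
  let ?K = "\<beta> / Gamma (1 - \<beta>)"
  have K: "0 < ?K" using \<beta> by (simp add: Gamma_real_pos)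
  let ?h = "\<lambda>x. (1 - exp (- \<theta> * x)) * (?K * x powr (- 1 - \<beta>) * exp (- x))"
  have inner: "ennreal (1 - exp (- \<theta> * x)) = (\<integral>\<^sup>+u\<in>{0..\<theta>}. ennreal (x * exp (- (u * x))) \<partial>lborel)" if "0 < x" for x
  proof -
    have "(\<integral>\<^sup>+u. ennreal (x * exp (- (u * x))) * indicator {0..\<theta>} u \<partial>lborel) = ennreal (- exp (- (\<theta> * x)) - (- exp (- (0 * x))))"
      by (rule nn_integral_FTC_Icc[OF _ _ _ \<theta>]) (use that in \<open>auto intro!: derivative_eq_intros\<close>)
    then show ?thesis by simp
  qed
  have "(\<integral>\<^sup>+x\<in>{0<..}. ennreal (?h x) \<partial>lborel)
      = (\<integral>\<^sup>+x. (\<integral>\<^sup>+u. ennreal (?K * (x powr ((1 - \<beta>) - 1) * exp (- ((1 + u) * x)))) * indicator {0<..} x * indicator {0..\<theta>} u \<partial>lborel) \<partial>lborel)"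
  proof (rule nn_integral_cong)
    fix x :: real
    show "ennreal (?h x) * indicator {0<..} x = (\<integral>\<^sup>+u. ennreal (?K * (x powr ((1 - \<beta>) - 1) * exp (- ((1 + u) * x)))) * indicator {0<..} x * indicator {0..\<theta>} u \<partial>lborel)"
    proof (cases "0 < x")
      case True
      have "0 \<le> ?K * x powr (- 1 - \<beta>) * exp (- x)" using K by (intro mult_nonneg_nonneg) auto
      then have "ennreal (?h x) = ennreal (?K * x powr (- 1 - \<beta>) * exp (- x)) * (\<integral>\<^sup>+u. ennreal (x * exp (- (u * x))) * indicator {0..\<theta>} u \<partial>lborel)"
        unfolding inner[OF True, symmetric] by (subst ennreal_mult'[symmetric]) (simp_all only: mult.commute)
      also have "\<dots> = (\<integral>\<^sup>+u. ennreal (?K * x powr (- 1 - \<beta>) * exp (- x)) * (ennreal (x * exp (- (u * x))) * indicator {0..\<theta>} u) \<partial>lborel)"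
        by (rule nn_integral_cmult[symmetric]) auto
      also have "\<dots> = (\<integral>\<^sup>+u. ennreal (?K * (x powr ((1 - \<beta>) - 1) * exp (- ((1 + u) * x)))) * indicator {0<..} x * indicator {0..\<theta>} u \<partial>lborel)"
      proof (rule nn_integral_cong)
        fix u :: real
        have "?K * x powr (- 1 - \<beta>) * exp (- x) * (x * exp (- (u * x))) = ?K * (x powr ((1 - \<beta>) - 1) * exp (- ((1 + u) * x)))"
        proof -
          have "x powr (- \<beta>) = x * x powr (- 1 - \<beta>)" using True by (simp add: powr_mult_base)
          then show ?thesis by (simp add: exp_add[symmetric] algebra_simps)
        qed
        moreover have "0 \<le> ?K * x powr (- 1 - \<beta>) * exp (- x)" using K by (intro mult_nonneg_nonneg) auto
        ultimately have "ennreal (?K * x powr (- 1 - \<beta>) * exp (- x)) * ennreal (x * exp (- (u * x))) = ennreal (?K * (x powr ((1 - \<beta>) - 1) * exp (- ((1 + u) * x))))"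
          by (simp only: ennreal_mult'[symmetric])
        then show "ennreal (?K * x powr (- 1 - \<beta>) * exp (- x)) * (ennreal (x * exp (- (u * x))) * indicator {0..\<theta>} u)
          = ennreal (?K * (x powr ((1 - \<beta>) - 1) * exp (- ((1 + u) * x)))) * indicator {0<..} x * indicator {0..\<theta>} u"
          using True by (simp add: mult.assoc[symmetric])
      qed
      finally show ?thesis using True by simp
    qed simp
  qed
  also have "\<dots> = (\<integral>\<^sup>+u. (\<integral>\<^sup>+x. ennreal (?K * (x powr ((1 - \<beta>) - 1) * exp (- ((1 + u) * x)))) * indicator {0<..} x * indicator {0..\<theta>} u \<partial>lborel) \<partial>lborel)"
    by (rule lborel_pair.Fubini') measurable
  also have "\<dots> = (\<integral>\<^sup>+u. ennreal (\<beta> * (1 + u) powr (\<beta> - 1)) * indicator {0..\<theta>} u \<partial>lborel)"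
  proof (rule nn_integral_cong)
    fix u :: real
    show "(\<integral>\<^sup>+x. ennreal (?K * (x powr ((1 - \<beta>) - 1) * exp (- ((1 + u) * x)))) * indicator {0<..} x * indicator {0..\<theta>} u \<partial>lborel)
        = ennreal (\<beta> * (1 + u) powr (\<beta> - 1)) * indicator {0..\<theta>} u"
    proof (cases "u \<in> {0..\<theta>}")
      case True
      have "(\<integral>\<^sup>+x. ennreal (?K * (x powr ((1 - \<beta>) - 1) * exp (- ((1 + u) * x)))) * indicator {0<..} x * indicator {0..\<theta>} u \<partial>lborel)
         = (\<integral>\<^sup>+x. ennreal ?K * (ennreal (x powr ((1 - \<beta>) - 1) * exp (- ((1 + u) * x))) * indicator {0<..} x) \<partial>lborel)"
        using True by (intro nn_integral_cong, subst ennreal_mult'[OF less_imp_le[OF K]]) (simp add: mult.assoc)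
      also have "\<dots> = ennreal ?K * ennreal (Gamma (1 - \<beta>) * (1 + u) powr (- (1 - \<beta>)))"
        by (subst nn_integral_cmult, simp, subst nn_integral_gamma) (use \<beta> True in auto)
      also have "\<dots> = ennreal (\<beta> * (1 + u) powr (\<beta> - 1))"
        using K \<beta> by (subst ennreal_mult'[symmetric]) (auto simp: Gamma_real_pos less_imp_neq[symmetric])
      finally show ?thesis using True by simp
    qed simp
  qed
  also have "\<dots> = ennreal ((1 + \<theta>) powr \<beta> - (1 + 0) powr \<beta>)"
    by (rule nn_integral_FTC_Icc[OF _ _ _ \<theta>]) (use \<beta> in \<open>auto intro!: derivative_eq_intros\<close>)
  finally have nn: "(\<integral>\<^sup>+x\<in>{0<..}. ennreal (?h x) \<partial>lborel) = ennreal ((1 + \<theta>) powr \<beta> - 1)" by simp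
  have ge: "0 \<le> (1 + \<theta>) powr \<beta> - 1" using \<theta> \<beta> by (simp add: ge_one_powr_ge_zero)
  have "(LINT x|lborel. indicator {0<..} x * ?h x) = enn2real (\<integral>\<^sup>+x. ennreal (indicator {0<..} x * ?h x) \<partial>lborel)"
  proof (rule integral_eq_nn_integral)
    have "0 \<le> ?h x" if "0 < x" for x
      using that \<theta> by (intro mult_nonneg_nonneg less_imp_le[OF K]) auto
    then show "AE x in lborel. 0 \<le> indicator {0<..} x * ?h x" by (intro AE_I2) (simp add: indicator_def)
  qed simp
  also have "(\<integral>\<^sup>+x. ennreal (indicator {0<..} x * ?h x) \<partial>lborel) = (\<integral>\<^sup>+x\<in>{0<..}. ennreal (?h x) \<partial>lborel)"
    by (intro nn_integral_cong) (simp add: indicator_def)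
  finally have "(LINT x|lborel. indicator {0<..} x * ?h x) = (1 + \<theta>) powr \<beta> - 1"
    using nn ge by simp
  then show ?thesis by (simp add: set_lebesgue_integral_def)
qed

section \<open>Processes evaluated at independent random times\<close>

lemma measurable_sub_sigma:
  assumes "f \<in> measurable A L" "space A = space B" "sets A \<subseteq> sets B"
  shows "f \<in> measurable B L"
  using assms unfolding measurable_def by auto

text \<open>Adding 1 to the floor makes the approximation strictly larger than \<open>z\<close>, so
  right continuity of paths suffices.\<close>

lemma dyadic_approx:
  fixes z :: real
  assumes "0 \<le> z"
  shows "filterlim (\<lambda>n. real (nat \<lfloor>2 ^ n * z\<rfloor> + 1) / 2 ^ n) (at_right z) sequentially"
proof (rule tendsto_imp_filterlim_at_right)
  let ?a = "\<lambda>n. real (nat \<lfloor>2 ^ n * z\<rfloor> + 1) / 2 ^ n"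
  have fl: "real (nat \<lfloor>2 ^ n * z\<rfloor>) = of_int \<lfloor>2 ^ n * z\<rfloor>" for n :: nat using assms by simp
  have gt: "z < ?a n" for n
  proof -
    have "2 ^ n * z < real (nat \<lfloor>2 ^ n * z\<rfloor> + 1)" 
      using fl[of n] real_of_int_floor_add_one_gt[of "2 ^ n * z"] by (simp only: of_nat_add of_nat_1)
    then show ?thesis by (simp add: field_simps)
  qed
  have le: "?a n \<le> z + (1 / 2) ^ n" for n
  proof -
    have "real (nat \<lfloor>2 ^ n * z\<rfloor> + 1) \<le> 2 ^ n * z + 1" using fl[of n] by simp
    then show ?thesis by (simp add: field_simps)
  qed
  show "\<forall>\<^sub>F n in sequentially. z < ?a n" using gt by simp
  show "?a \<longlonglongrightarrow> z"
  proof (rule tendsto_sandwich[of "\<lambda>_. z" _ _ "\<lambda>n. z + (1 / 2) ^ n"])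
    have "(\<lambda>n. z + (1 / 2) ^ n) \<longlonglongrightarrow> z + 0" by (intro tendsto_intros LIMSEQ_power_zero) simp
    then show "(\<lambda>n. z + (1 / 2) ^ n) \<longlonglongrightarrow> z" by simp
  qed (use gt le in \<open>auto intro!: always_eventually less_imp_le\<close>)
qed

definition dyadic :: "nat \<Rightarrow> real \<Rightarrow> real" where
  "dyadic n z = real (nat \<lfloor>2 ^ n * z\<rfloor> + 1) / 2 ^ n"

lemma right_continuous_dyadic:
  assumes "0 \<le> z" "continuous (at_right z) f"
  shows "(\<lambda>n. f (dyadic n z)) \<longlonglongrightarrow> f z"
  using filterlim_compose[OF _ dyadic_approx[OF assms(1)]] assms(2)
  unfolding dyadic_def by (simp add: continuous_within)

text \<open>A dyadic time takes countably many values, which gives measurability at that time; the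
  general time is a pointwise limit from the right.\<close>

lemma measurable_random_time:
  fixes V :: "real \<Rightarrow> 'a \<Rightarrow> real"
  assumes Z: "Z \<in> borel_measurable A" "\<And>\<omega>. \<omega> \<in> space A \<Longrightarrow> 0 \<le> Z \<omega>"
    and V: "\<And>t. 0 \<le> t \<Longrightarrow> V t \<in> borel_measurable A"
    and rc: "\<And>\<omega> t. \<omega> \<in> space A \<Longrightarrow> 0 \<le> t \<Longrightarrow> continuous (at_right t) (\<lambda>u. V u \<omega>)"
  shows "(\<lambda>\<omega>. V (dyadic n (Z \<omega>)) \<omega>) \<in> borel_measurable A" "(\<lambda>\<omega>. V (Z \<omega>) \<omega>) \<in> borel_measurable A"
proof -
  note [measurable] = Z(1)
  show m: "(\<lambda>\<omega>. V (dyadic n (Z \<omega>)) \<omega>) \<in> borel_measurable A" for n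
    unfolding dyadic_def
  proof (rule measurable_compose_countable[where f = "\<lambda>(j::nat) \<omega>. V (real (j + 1) / 2 ^ n) \<omega>"])
    show "(\<lambda>\<omega>. nat \<lfloor>2 ^ n * Z \<omega>\<rfloor>) \<in> measurable A (count_space UNIV)" by measurable
  qed (rule V, simp)
  show "(\<lambda>\<omega>. V (Z \<omega>) \<omega>) \<in> borel_measurable A"
  proof (rule borel_measurable_LIMSEQ_real)
    show "(\<lambda>n. V (dyadic n (Z \<omega>)) \<omega>) \<longlonglongrightarrow> V (Z \<omega>) \<omega>" if "\<omega> \<in> space A" for \<omega>
      using that by (intro right_continuous_dyadic[where f = "\<lambda>u. V u \<omega>"] Z(2) rc)
  qed (rule m)
qed

context prob_space
begin

text \<open>Phrased with sigma-algebras because the weight and the random time will both be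
  functions of the first one.\<close>

lemma indep_set_expectation:
  fixes X Y :: "'a \<Rightarrow> real"
  assumes ind: "indep_set (sets A) (sets B)"
    and sp: "space A = space M" "space B = space M"
    and X: "X \<in> borel_measurable A" and Y: "Y \<in> borel_measurable B"
    and bX: "\<And>\<omega>. \<omega> \<in> space M \<Longrightarrow> \<bar>X \<omega>\<bar> \<le> c" and bY: "\<And>\<omega>. \<omega> \<in> space M \<Longrightarrow> \<bar>Y \<omega>\<bar> \<le> d"
  shows "expectation (\<lambda>\<omega>. X \<omega> * Y \<omega>) = expectation X * expectation Y"
proof -
  have sub: "sets A \<subseteq> sets M" "sets B \<subseteq> sets M"
    using ind unfolding indep_set_def indep_sets_def by (auto split: bool.splits)
  have XM: "random_variable borel X" by (rule measurable_sub_sigma[OF X sp(1) sub(1)])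
  have YM: "random_variable borel Y" by (rule measurable_sub_sigma[OF Y sp(2) sub(2)])
  have "indep_var borel X borel Y"
    unfolding indep_var_eq
  proof (intro conjI XM YM)
    have 1: "sigma_sets (space M) {X -` S \<inter> space M |S. S \<in> sets borel} \<subseteq> sets A"
      using measurable_sets[OF X] sp by (intro sets.sigma_sets_subset[of _ A, unfolded sp]) auto
    have 2: "sigma_sets (space M) {Y -` S \<inter> space M |S. S \<in> sets borel} \<subseteq> sets B"
      using measurable_sets[OF Y] sp by (intro sets.sigma_sets_subset[of _ B, unfolded sp]) auto
    show "indep_set (sigma_sets (space M) {X -` S \<inter> space M |S. S \<in> sets borel})
        (sigma_sets (space M) {Y -` S \<inter> space M |S. S \<in> sets borel})"
      using ind unfolding indep_set_def by (rule indep_sets_mono_sets) (use 1 2 in \<open>auto split: bool.split\<close>)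
  qed
  then show ?thesis
  proof (rule indep_var_lebesgue_integral)
    show "integrable M X" by (rule integrable_const_bound[of _ c]) (use XM bX in auto)
    show "integrable M Y" by (rule integrable_const_bound[of _ d]) (use YM bY in auto)
  qed
qed

text \<open>A right-continuous process at an independent random time: at dyadic approximations from
  above, independence applies on each of the countably many events on which the time is constant.\<close>

lemma expectation_random_time:
  fixes V :: "real \<Rightarrow> 'a \<Rightarrow> real" and F Z :: "'a \<Rightarrow> real"
  assumes ind: "indep_set (sets A) (sets B)"
    and sp: "space A = space M" "space B = space M"
    and Z: "Z \<in> borel_measurable A" "\<And>\<omega>. \<omega> \<in> space M \<Longrightarrow> 0 \<le> Z \<omega>"
    and F: "F \<in> borel_measurable A" "\<And>\<omega>. \<omega> \<in> space M \<Longrightarrow> 0 \<le> F \<omega> \<and> F \<omega> \<le> 1"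
    and V: "\<And>t. 0 \<le> t \<Longrightarrow> V t \<in> borel_measurable B" "\<And>t \<omega>. 0 \<le> t \<Longrightarrow> \<omega> \<in> space M \<Longrightarrow> 0 \<le> V t \<omega>"
    and rc: "\<And>\<omega> t. \<omega> \<in> space M \<Longrightarrow> 0 \<le> t \<Longrightarrow> continuous (at_right t) (\<lambda>u. V u \<omega>)"
    and \<theta>: "0 \<le> \<theta>" and \<psi>: "0 \<le> \<psi>"
    and L: "\<And>t. 0 \<le> t \<Longrightarrow> expectation (\<lambda>\<omega>. exp (- (\<theta> * V t \<omega>))) = exp (- (\<psi> * t))"
  shows "expectation (\<lambda>\<omega>. F \<omega> * exp (- (\<theta> * V (Z \<omega>) \<omega>))) = expectation (\<lambda>\<omega>. F \<omega> * exp (- (\<psi> * Z \<omega>)))"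
proof -
  have sub: "sets A \<subseteq> sets M" "sets B \<subseteq> sets M"
    using ind unfolding indep_set_def indep_sets_def by (auto split: bool.splits)
  note AM = measurable_sub_sigma[OF _ sp(1) sub(1)]
  have ZM [measurable]: "Z \<in> borel_measurable M" and FM [measurable]: "F \<in> borel_measurable M"
    by (rule AM[OF Z(1)], rule AM[OF F(1)])
  have VM: "V t \<in> borel_measurable M" if "0 \<le> t" for t
    by (rule measurable_sub_sigma[OF V(1)[OF that] sp(2) sub(2)])
  note mt = measurable_random_time[OF ZM Z(2) VM rc]
  have dy0: "0 \<le> dyadic n z" for n z unfolding dyadic_def by simp
  have step: "expectation (\<lambda>\<omega>. F \<omega> * exp (- (\<theta> * V (dyadic n (Z \<omega>)) \<omega>)))
      = expectation (\<lambda>\<omega>. F \<omega> * exp (- (\<psi> * dyadic n (Z \<omega>))))" for n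
  proof -
    define J where "J \<omega> = nat \<lfloor>2 ^ n * Z \<omega>\<rfloor>" for \<omega>
    define t where "t j = real (j + 1) / 2 ^ n" for j :: nat
    have t0: "0 \<le> t j" for j by (simp add: t_def)
    have dy: "dyadic n (Z \<omega>) = t (J \<omega>)" for \<omega> by (simp add: dyadic_def t_def J_def)
    \<comment> \<open>The weight localised to the event that the approximate time equals
      \<open>t j\<close>. It is still measurable for \<open>A\<close>, so the process at the fixed
      time \<open>t j\<close> is independent of it.\<close>
    define F' where "F' j \<omega> = F \<omega> * indicator {\<omega>. J \<omega> = j} \<omega>" for j \<omega>
    have F'A: "F' j \<in> borel_measurable A" for j
    proof -
      note [measurable] = Z(1) F(1)
      have "{\<omega> \<in> space A. J \<omega> = j} \<in> sets A" unfolding J_def by measurable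
      then have m: "(\<lambda>\<omega>. F \<omega> * indicator {\<omega> \<in> space A. J \<omega> = j} \<omega>) \<in> borel_measurable A" by measurable
      have "F' j \<in> borel_measurable A \<longleftrightarrow> (\<lambda>\<omega>. F \<omega> * indicator {\<omega> \<in> space A. J \<omega> = j} \<omega>) \<in> borel_measurable A"
        by (rule measurable_cong) (simp add: F'_def indicator_def)
      then show ?thesis using m by simp
    qed
    have F'1: "0 \<le> F' j \<omega>" "F' j \<omega> \<le> 1" if "\<omega> \<in> space M" for j \<omega>
      using F(2)[OF that] by (auto simp: F'_def indicator_def)
    note [measurable] = AM[OF F'A] VM[OF t0]
    have sum_id: "ennreal (F \<omega> * g (J \<omega>)) = (\<Sum>j. ennreal (F' j \<omega> * g j))" for g :: "nat \<Rightarrow> real" and \<omega>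
    proof -
      have "(\<Sum>j. ennreal (F' j \<omega> * g j)) = (\<Sum>j\<in>{J \<omega>}. ennreal (F' j \<omega> * g j))"
        by (rule suminf_finite) (auto simp: F'_def)
      then show ?thesis by (simp add: F'_def)
    qed
    have each: "(\<integral>\<^sup>+\<omega>. ennreal (F' j \<omega> * exp (- (\<theta> * V (t j) \<omega>))) \<partial>M) = (\<integral>\<^sup>+\<omega>. ennreal (F' j \<omega> * exp (- (\<psi> * t j))) \<partial>M)" for j
    proof -
      have e1: "exp (- (\<theta> * V (t j) \<omega>)) \<le> 1" if "\<omega> \<in> space M" for \<omega>
        using V(2)[OF t0 that] \<theta> by simp
      have i1: "integrable M (\<lambda>\<omega>. F' j \<omega> * exp (- (\<theta> * V (t j) \<omega>)))"
        by (rule integrable_const_bound[of _ 1]) (use F'1 e1 in \<open>auto intro!: AE_I2 mult_le_one simp: abs_mult\<close>)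
      have i2: "integrable M (\<lambda>\<omega>. F' j \<omega> * exp (- (\<psi> * t j)))"
        by (intro integrable_mult_left integrable_const_bound[of _ 1]) (use F'1 in \<open>auto intro!: AE_I2\<close>)
      have "expectation (\<lambda>\<omega>. F' j \<omega> * exp (- (\<theta> * V (t j) \<omega>))) = expectation (F' j) * expectation (\<lambda>\<omega>. exp (- (\<theta> * V (t j) \<omega>)))"
      proof (rule indep_set_expectation[where c = 1 and d = 1, OF ind sp F'A])
        note [measurable] = V(1)[OF t0]
        show "(\<lambda>\<omega>. exp (- (\<theta> * V (t j) \<omega>))) \<in> borel_measurable B" by measurable
      qed (use F'1 e1 in auto)
      also have "\<dots> = expectation (\<lambda>\<omega>. F' j \<omega> * exp (- (\<psi> * t j)))" using L[OF t0] by simp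
      finally show ?thesis
        using i1 i2 F'1 by (simp add: nn_integral_eq_integral)
    qed
    have "(\<integral>\<^sup>+\<omega>. ennreal (F \<omega> * exp (- (\<theta> * V (dyadic n (Z \<omega>)) \<omega>))) \<partial>M)
        = (\<integral>\<^sup>+\<omega>. (\<Sum>j. ennreal (F' j \<omega> * exp (- (\<theta> * V (t j) \<omega>)))) \<partial>M)"
      unfolding dy by (intro nn_integral_cong) (rule sum_id)
    also have "\<dots> = (\<Sum>j. \<integral>\<^sup>+\<omega>. ennreal (F' j \<omega> * exp (- (\<theta> * V (t j) \<omega>))) \<partial>M)"
      by (rule nn_integral_suminf) measurable
    also have "\<dots> = (\<Sum>j. \<integral>\<^sup>+\<omega>. ennreal (F' j \<omega> * exp (- (\<psi> * t j))) \<partial>M)" unfolding each ..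
    also have "\<dots> = (\<integral>\<^sup>+\<omega>. (\<Sum>j. ennreal (F' j \<omega> * exp (- (\<psi> * t j)))) \<partial>M)"
      by (rule nn_integral_suminf[symmetric]) measurable
    also have "\<dots> = (\<integral>\<^sup>+\<omega>. ennreal (F \<omega> * exp (- (\<psi> * dyadic n (Z \<omega>)))) \<partial>M)"
      unfolding dy by (intro nn_integral_cong) (rule sum_id[symmetric])
    finally have eq: "(\<integral>\<^sup>+\<omega>. ennreal (F \<omega> * exp (- (\<theta> * V (dyadic n (Z \<omega>)) \<omega>))) \<partial>M)
        = (\<integral>\<^sup>+\<omega>. ennreal (F \<omega> * exp (- (\<psi> * dyadic n (Z \<omega>)))) \<partial>M)" .
    have [measurable]: "(\<lambda>\<omega>. V (dyadic n (Z \<omega>)) \<omega>) \<in> borel_measurable M" by (rule mt(1))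
    have [measurable]: "(\<lambda>\<omega>. dyadic n (Z \<omega>)) \<in> borel_measurable M" unfolding dyadic_def by measurable
    show ?thesis
      by (subst (1 2) integral_eq_nn_integral) (use F(2) eq in \<open>auto intro!: AE_I2 mult_nonneg_nonneg\<close>)
  qed
  have [measurable]: "(\<lambda>\<omega>. V (dyadic n (Z \<omega>)) \<omega>) \<in> borel_measurable M" for n by (rule mt(1))
  have [measurable]: "(\<lambda>\<omega>. V (Z \<omega>) \<omega>) \<in> borel_measurable M" by (rule mt(2))
  have [measurable]: "(\<lambda>\<omega>. dyadic n (Z \<omega>)) \<in> borel_measurable M" for n unfolding dyadic_def by measurable
  have "(\<lambda>n. expectation (\<lambda>\<omega>. F \<omega> * exp (- (\<theta> * V (dyadic n (Z \<omega>)) \<omega>))))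
     \<longlonglongrightarrow> expectation (\<lambda>\<omega>. F \<omega> * exp (- (\<theta> * V (Z \<omega>) \<omega>)))"
  proof (rule integral_dominated_convergence[where w = "\<lambda>_. 1"])
    show "AE \<omega> in M. (\<lambda>n. F \<omega> * exp (- (\<theta> * V (dyadic n (Z \<omega>)) \<omega>))) \<longlonglongrightarrow> F \<omega> * exp (- (\<theta> * V (Z \<omega>) \<omega>))"
      using right_continuous_dyadic[OF Z(2) rc[OF _ Z(2)]] by (intro AE_I2 tendsto_intros) auto
    show "AE \<omega> in M. norm (F \<omega> * exp (- (\<theta> * V (dyadic n (Z \<omega>)) \<omega>))) \<le> 1" for n
      using F(2) V(2)[OF dy0] \<theta> by (intro AE_I2) (auto simp: abs_mult intro!: mult_le_one)
  qed auto
  moreover have "(\<lambda>n. expectation (\<lambda>\<omega>. F \<omega> * exp (- (\<psi> * dyadic n (Z \<omega>)))))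
     \<longlonglongrightarrow> expectation (\<lambda>\<omega>. F \<omega> * exp (- (\<psi> * Z \<omega>)))"
  proof (rule integral_dominated_convergence[where w = "\<lambda>_. 1"])
    have "(\<lambda>n. dyadic n (Z \<omega>)) \<longlonglongrightarrow> Z \<omega>" if "\<omega> \<in> space M" for \<omega>
      using right_continuous_dyadic[OF Z(2)[OF that], of "\<lambda>z. z"] by simp
    then show "AE \<omega> in M. (\<lambda>n. F \<omega> * exp (- (\<psi> * dyadic n (Z \<omega>)))) \<longlonglongrightarrow> F \<omega> * exp (- (\<psi> * Z \<omega>))"
      by (intro AE_I2 tendsto_intros) auto
    show "AE \<omega> in M. norm (F \<omega> * exp (- (\<psi> * dyadic n (Z \<omega>)))) \<le> 1" for n
      using F(2) dy0 \<psi> by (intro AE_I2) (auto simp: abs_mult intro!: mult_le_one)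
  qed auto
  ultimately show ?thesis unfolding step by (rule LIMSEQ_unique)
qed

end

section \<open>Laplace transforms of the limit vectors\<close>

locale limit_vars = tree_params k \<delta> + prob_space N
  for k :: nat and \<delta> :: real and N :: "'c measure" +
  fixes G :: "nat \<Rightarrow> 'c \<Rightarrow> real" and W :: "nat \<Rightarrow> nat \<Rightarrow> real \<Rightarrow> 'c \<Rightarrow> real"
  assumes G_distr: "\<And>m. m \<le> k \<Longrightarrow>
           distributed N lborel (G m) (\<lambda>x. ennreal (gamma_density ((1 + \<delta>) / bpar k \<delta> m) x))"
    and G_nonneg: "\<And>m \<omega>. m \<le> k \<Longrightarrow> \<omega> \<in> space N \<Longrightarrow> 0 \<le> G m \<omega>"
    and W_sub: "\<And>m i. 1 \<le> i \<Longrightarrow> i \<le> m \<Longrightarrow> m \<le> k \<Longrightarrow> subordinator N (W m i)"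
    and W_laplace: "\<And>m i \<theta> t. 1 \<le> i \<Longrightarrow> i \<le> m \<Longrightarrow> m \<le> k \<Longrightarrow> 0 \<le> \<theta> \<Longrightarrow> 0 \<le> t \<Longrightarrow>
           (LINT \<omega>|N. exp (- \<theta> * W m i t \<omega>))
             = exp (- t * (LINT x:{0<..}|lborel. (1 - exp (- \<theta> * x)) * levy_density k \<delta> i x))"
    and indep: "prob_space.indep_sets N (generated_sigma N G W)
           ({..k} <+> {(m, i). 1 \<le> i \<and> i \<le> m \<and> m \<le> k})"
begin

abbreviation "gsig \<equiv> generated_sigma N G W"
abbreviation idx :: "(nat + nat \<times> nat) set" where
  "idx \<equiv> {..k} <+> {(m, i). 1 \<le> i \<and> i \<le> m \<and> m \<le> k}"

text \<open>Groups of the independent sources; disjoint groups generate independent sigma-algebras,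
  see \<open>indep_gen_alg\<close>.\<close>

definition gen_alg :: "(nat + nat \<times> nat) set \<Rightarrow> 'c measure" where
  "gen_alg S = sigma (space N) (\<Union>j\<in>S. gsig j)"

lemma gsig_events: "j \<in> idx \<Longrightarrow> gsig j \<subseteq> sets N"
  using indep unfolding indep_sets_def by blast

lemma Int_stable_gsig: "Int_stable (gsig j)"
  unfolding generated_sigma_def Int_stable_def
  by (auto split: sum.split prod.split intro: sets.Int)

lemma gen_alg:
  assumes "S \<subseteq> idx"
  shows "space (gen_alg S) = space N" "sets (gen_alg S) = sigma_sets (space N) (\<Union>j\<in>S. gsig j)" "sets (gen_alg S) \<subseteq> sets N"
proof -
  have sub: "(\<Union>j\<in>S. gsig j) \<subseteq> sets N" using gsig_events assms by blast
  then have "(\<Union>j\<in>S. gsig j) \<subseteq> Pow (space N)" using sets.space_closed by blast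
  then show "space (gen_alg S) = space N" "sets (gen_alg S) = sigma_sets (space N) (\<Union>j\<in>S. gsig j)"
    by (simp_all add: gen_alg_def)
  then show "sets (gen_alg S) \<subseteq> sets N" using sets.sigma_sets_subset[OF sub] by simp
qed

lemma gen_alg_mono: "S \<subseteq> T \<Longrightarrow> T \<subseteq> idx \<Longrightarrow> sets (gen_alg S) \<subseteq> sets (gen_alg T)"
  by (subst (1 2) gen_alg(2)) (auto intro!: sigma_sets_mono' )

lemma measurable_gen_alg_mono:
  "f \<in> measurable (gen_alg S) L \<Longrightarrow> S \<subseteq> T \<Longrightarrow> T \<subseteq> idx \<Longrightarrow> f \<in> measurable (gen_alg T) L"
  using gen_alg(1)[of S] gen_alg(1)[of T] gen_alg_mono[of S T] by (intro measurable_sub_sigma[of f "gen_alg S" L "gen_alg T"]) auto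

lemma gsig_gen_alg: "j \<in> S \<Longrightarrow> S \<subseteq> idx \<Longrightarrow> gsig j \<subseteq> sets (gen_alg S)"
  by (subst gen_alg(2)) (auto intro: sigma_sets.Basic)

lemma indep_gen_alg:
  assumes "S \<subseteq> idx" "T \<subseteq> idx" "S \<inter> T = {}"
  shows "indep_set (sets (gen_alg S)) (sets (gen_alg T))"
proof -
  have "indep_sets (\<lambda>j. sigma_sets (space N) (\<Union>i\<in>case_bool S T j. gsig i)) (UNIV :: bool set)"
  proof (rule indep_sets_collect_sigma)
    show "indep_sets gsig (\<Union>j\<in>UNIV. case_bool S T j)"
      by (rule indep_sets_mono_index[OF _ indep]) (use assms in \<open>auto split: bool.splits\<close>)
    show "disjoint_family_on (case_bool S T) UNIV"
      using assms(3) by (auto simp: disjoint_family_on_def split: bool.split)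
  qed (rule Int_stable_gsig)
  then show ?thesis
    unfolding indep_set_def
    using gen_alg(2)[OF assms(1)] gen_alg(2)[OF assms(2)] by (elim indep_sets_mono_sets) (auto split: bool.split)
qed

lemma measurable_G:
  assumes "Inl m \<in> S" "S \<subseteq> idx" shows "G m \<in> borel_measurable (gen_alg S)"
proof (rule measurableI)
  fix A :: "real set" assume "A \<in> sets borel"
  then have "G m -` A \<inter> space N \<in> gsig (Inl m)"
    by (auto simp: generated_sigma_def intro: in_vimage_algebra)
  then show "G m -` A \<inter> space (gen_alg S) \<in> sets (gen_alg S)"
    using gsig_gen_alg[OF assms] gen_alg(1)[OF assms(2)] by auto
qed simp

lemma measurable_W:
  assumes "Inr (m, i) \<in> S" "S \<subseteq> idx" "0 \<le> t" shows "W m i t \<in> borel_measurable (gen_alg S)"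
proof (rule measurable_sub_sigma)
  let ?f = "\<lambda>\<omega>. \<lambda>t\<in>{0..}. W m i t \<omega>"
  let ?A = "vimage_algebra (space N) ?f (\<Pi>\<^sub>M t\<in>{0..}. borel :: real measure)"
  have "?f \<in> measurable ?A (\<Pi>\<^sub>M t\<in>{0..}. borel)"
    by (rule measurable_vimage_algebra1) (auto simp: space_PiM)
  then have "(\<lambda>\<omega>. ?f \<omega> t) \<in> borel_measurable ?A"
    by (rule measurable_compose[OF _ measurable_component_singleton]) (use assms in auto)
  then show "W m i t \<in> borel_measurable ?A" using assms by simp
  show "space ?A = space (gen_alg S)" using gen_alg(1)[OF assms(2)] by simp
  show "sets ?A \<subseteq> sets (gen_alg S)" using gsig_gen_alg[OF assms(1,2)] by (simp add: generated_sigma_def)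
qed

lemma W_nonneg: "1 \<le> i \<Longrightarrow> i \<le> m \<Longrightarrow> m \<le> k \<Longrightarrow> 0 \<le> t \<Longrightarrow> \<omega> \<in> space N \<Longrightarrow> 0 \<le> W m i t \<omega>"
  using W_sub[of i m] by (auto simp: subordinator_def)

lemma W_right: "1 \<le> i \<Longrightarrow> i \<le> m \<Longrightarrow> m \<le> k \<Longrightarrow> 0 \<le> t \<Longrightarrow> \<omega> \<in> space N \<Longrightarrow> continuous (at_right t) (\<lambda>u. W m i u \<omega>)"
  using W_sub[of i m] by (auto simp: subordinator_def levy_process_def)

abbreviation X :: "nat \<Rightarrow> nat \<Rightarrow> 'c \<Rightarrow> real" where "X \<equiv> Xvec G W"

lemma X_simps:
  "X m m \<omega> = G m \<omega>" "i < m \<Longrightarrow> X m i \<omega> = W m (i + 1) (X m (i + 1) \<omega>) \<omega>" "m < i \<Longrightarrow> X m i \<omega> = 0"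
  by (subst Xvec.simps, simp)+

lemma X_nonneg:
  assumes "m \<le> k" "\<omega> \<in> space N" shows "0 \<le> X m i \<omega>"
proof (cases "i \<le> m")
  case True
  then show ?thesis
  proof (induction rule: inc_induct)
    case base
    then show ?case using G_nonneg assms by (simp add: X_simps)
  next
    case (step n)
    then show ?case using W_nonneg[of "n + 1" m] assms by (simp add: X_simps(2))
  qed
qed (simp add: X_simps)

text \<open>The sources from which coordinate \<open>i\<close> of vector \<open>m\<close> is built.
  The process with index \<open>l\<close> produces coordinate \<open>l - 1\<close> out of coordinate
  \<open>l\<close>, hence the range excludes \<open>i\<close>.\<close>

definition block :: "nat \<Rightarrow> nat \<Rightarrow> (nat + nat \<times> nat) set" where
  "block m i = insert (Inl m) ((\<lambda>l. Inr (m, l)) ` {i<..m})"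

lemma block_idx: "m \<le> k \<Longrightarrow> block m i \<subseteq> idx"
  by (auto simp: block_def)

lemma X_measurable:
  assumes "m \<le> k" "i \<le> m" shows "X m i \<in> borel_measurable (gen_alg (block m i))"
  using assms(2)
proof (induction rule: inc_induct)
  case base
  have "X m m = G m" by (intro ext) (simp add: X_simps)
  then show ?case using measurable_G[of m "block m m"] block_idx[OF assms(1)] by (simp add: block_def)
next
  case (step n)
  have sp: "space (gen_alg (block m n)) = space N" using gen_alg(1) block_idx[OF assms(1)] by simp
  have "(\<lambda>\<omega>. W m (n + 1) (X m (n + 1) \<omega>) \<omega>) \<in> borel_measurable (gen_alg (block m n))"
  proof (rule measurable_random_time(2)[where V = "W m (n + 1)" and Z = "X m (n + 1)"])
    show "X m (n + 1) \<in> borel_measurable (gen_alg (block m n))"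
    proof -
      have "block m (Suc n) \<subseteq> block m n" by (auto simp: block_def)
      then show ?thesis using measurable_gen_alg_mono[OF step.IH _ block_idx[OF assms(1)]] by simp
    qed
    show "W m (n + 1) t \<in> borel_measurable (gen_alg (block m n))" if "0 \<le> t" for t
      using that step block_idx[OF assms(1)] by (intro measurable_W) (auto simp: block_def)
  qed (use X_nonneg assms step sp in \<open>auto intro!: W_right\<close>)
  moreover have "X m n = (\<lambda>\<omega>. W m (n + 1) (X m (n + 1) \<omega>) \<omega>)"
    using step by (intro ext) (simp add: X_simps(2))
  ultimately show ?case by simp
qed

lemma X_measurable_block0:
  assumes "m \<le> k" shows "X m i \<in> borel_measurable (gen_alg (block m 0))"
proof (cases "i \<le> m")
  case True
  show ?thesis
    by (rule measurable_gen_alg_mono[OF X_measurable[OF assms True]])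
      (use block_idx[OF assms] in \<open>auto simp: block_def\<close>)
next
  case False
  then have "X m i = (\<lambda>_. 0)" by (intro ext) (simp add: X_simps)
  then show ?thesis by simp
qed

lemma X_measurable_N: "m \<le> k \<Longrightarrow> X m i \<in> borel_measurable N"
  by (rule measurable_sub_sigma[OF X_measurable_block0 gen_alg(1)[OF block_idx] gen_alg(3)[OF block_idx]])

lemma G_laplace:
  assumes m: "m \<le> k" and \<theta>: "0 \<le> \<theta>"
  shows "expectation (\<lambda>\<omega>. exp (- (\<theta> * G m \<omega>))) = (1 + \<theta>) powr (- (1 + \<delta>) / b m)"
proof -
  define a where "a = (1 + \<delta>) / b m"
  have a: "0 < a" using delta b_pos[OF m] by (simp add: a_def)
  have Gm: "G m \<in> borel_measurable N" using G_distr[OF m] by (simp add: distributed_def)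
  have "(\<integral>\<^sup>+\<omega>. ennreal (exp (- (\<theta> * G m \<omega>))) \<partial>N)
      = (\<integral>\<^sup>+x. ennreal (gamma_density a x) * ennreal (exp (- (\<theta> * x))) \<partial>lborel)"
    unfolding a_def by (rule distributed_nn_integral[OF G_distr[OF m], symmetric]) measurable
  also have "\<dots> = (\<integral>\<^sup>+x. ennreal (1 / Gamma a) * (ennreal (x powr (a - 1) * exp (- ((1 + \<theta>) * x))) * indicator {0<..} x) \<partial>lborel)"
  proof (rule nn_integral_cong)
    fix x :: real
    show "ennreal (gamma_density a x) * ennreal (exp (- (\<theta> * x))) = ennreal (1 / Gamma a) * (ennreal (x powr (a - 1) * exp (- ((1 + \<theta>) * x))) * indicator {0<..} x)"
    proof (cases "0 < x")
      case True
      have "gamma_density a x * exp (- (\<theta> * x)) = 1 / Gamma a * (x powr (a - 1) * exp (- ((1 + \<theta>) * x)))"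
        using True by (simp add: gamma_density_def exp_add[symmetric] algebra_simps)
      then show ?thesis using True a
        by (simp add: ennreal_mult''[symmetric] ennreal_mult'[symmetric] Gamma_real_pos less_imp_le)
    qed (simp add: gamma_density_def)
  qed
  also have "\<dots> = ennreal (1 / Gamma a) * ennreal (Gamma a * (1 + \<theta>) powr (- a))"
    by (subst nn_integral_cmult, simp, subst nn_integral_gamma) (use a \<theta> in auto)
  also have "\<dots> = ennreal ((1 + \<theta>) powr (- a))"
    using Gamma_real_pos[OF a] by (subst ennreal_mult'[symmetric]) auto
  finally have nn: "(\<integral>\<^sup>+\<omega>. ennreal (exp (- (\<theta> * G m \<omega>))) \<partial>N) = ennreal ((1 + \<theta>) powr (- a))" .
  have "expectation (\<lambda>\<omega>. exp (- (\<theta> * G m \<omega>))) = enn2real (\<integral>\<^sup>+\<omega>. ennreal (exp (- (\<theta> * G m \<omega>))) \<partial>N)"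
    by (rule integral_eq_nn_integral) (use Gm in auto)
  then show ?thesis unfolding nn by (simp add: a_def minus_divide_left)
qed

lemma iter_ge_1:
  assumes "\<And>l. 0 \<le> \<theta> l" shows "l \<le> k \<Longrightarrow> 1 \<le> iter (\<lambda>_. 1) \<theta> l \<and> 1 \<le> iter_arg (\<lambda>_. 1) \<theta> l"
proof (induction l)
  case 0
  then show ?case using assms[of 0] by (simp add: iter_arg_def)
next
  case (Suc l)
  then have "1 \<le> iter (\<lambda>_. 1) \<theta> (Suc l)"
    unfolding iter_Suc using beta_bounds[OF Suc.prems] by (intro ge_one_powr_ge_zero) auto
  then show ?case using assms[of "Suc l"] unfolding iter_arg_def by linarith
qed

text \<open>Coordinates are integrated out from 0 upwards. By \<open>stable_exponent\<close> the
  process started from Laplace variable \<open>?v i - 1\<close> has exponent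
  \<open>iter (\<lambda>_. 1) \<theta> (Suc i) - 1\<close>, which together with the variable
  \<open>\<theta> (Suc i)\<close> of the next coordinate gives \<open>?v (Suc i) - 1\<close>. At
  \<open>m\<close> only the Gamma variable remains.\<close>

lemma X_laplace:
  assumes m: "m \<le> k" and \<theta>: "\<And>l. 0 \<le> \<theta> l"
  shows "expectation (\<lambda>\<omega>. exp (- (\<Sum>l\<le>m. \<theta> l * X m l \<omega>))) = iter_arg (\<lambda>_. 1) \<theta> m powr (- (1 + \<delta>) / b m)"
proof -
  let ?v = "iter_arg (\<lambda>_. 1) \<theta>"
  have v1: "1 \<le> ?v i" if "i \<le> k" for i using iter_ge_1[of \<theta> i] \<theta> that by blast
  let ?F = "\<lambda>i \<omega>. exp (- (\<Sum>l\<in>{i<..m}. \<theta> l * X m l \<omega>))"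
  have step: "expectation (\<lambda>\<omega>. ?F i \<omega> * exp (- ((?v i - 1) * X m i \<omega>)))
      = expectation (\<lambda>\<omega>. ?F (Suc i) \<omega> * exp (- ((?v (Suc i) - 1) * X m (Suc i) \<omega>)))" if i: "i < m" for i
  proof -
    let ?A = "gen_alg (block m (Suc i))" and ?B = "gen_alg {Inr (m, Suc i)}"
    have Bidx: "{Inr (m, Suc i)} \<subseteq> idx" using i m by auto
    have Xm: "X m l \<in> borel_measurable ?A" if "l \<in> {i<..m}" for l
      by (rule measurable_gen_alg_mono[OF X_measurable[OF m]])
        (use that block_idx[OF m] in \<open>auto simp: block_def\<close>)
    have F01: "0 \<le> ?F i \<omega> \<and> ?F i \<omega> \<le> 1" if "\<omega> \<in> space N" for \<omega>
      using X_nonneg[OF m that] \<theta> by (simp add: sum_nonneg)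
    have beta: "0 < b (Suc i) / b i" "b (Suc i) / b i < 1" using beta_bounds[of i] i m by auto
    have yv: "iter (\<lambda>_. 1) \<theta> (Suc i) = ?v i powr (b (Suc i) / b i)" by (rule iter_Suc)
    have y1: "1 \<le> iter (\<lambda>_. 1) \<theta> (Suc i)" using iter_ge_1[of \<theta> "Suc i"] \<theta> i m by auto
    have "expectation (\<lambda>\<omega>. ?F i \<omega> * exp (- ((?v i - 1) * X m i \<omega>)))
      = expectation (\<lambda>\<omega>. ?F i \<omega> * exp (- ((?v i - 1) * W m (Suc i) (X m (Suc i) \<omega>) \<omega>)))"
      using i by (simp add: X_simps(2))
    also have "\<dots> = expectation (\<lambda>\<omega>. ?F i \<omega> * exp (- ((iter (\<lambda>_. 1) \<theta> (Suc i) - 1) * X m (Suc i) \<omega>)))"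
    \<comment> \<open>All coordinates above \<open>i\<close> are built from
      \<open>block m (Suc i)\<close>, which does not contain the process with index
      \<open>Suc i\<close>.\<close>
    proof (rule expectation_random_time[where V = "W m (Suc i)" and Z = "X m (Suc i)"])
      show "indep_set (sets ?A) (sets ?B)"
        by (rule indep_gen_alg[OF block_idx[OF m] Bidx]) (auto simp: block_def)
      show "space ?A = space N" "space ?B = space N" using gen_alg(1) block_idx[OF m] Bidx by auto
      show "X m (Suc i) \<in> borel_measurable ?A" using i by (intro Xm) auto
      show "?F i \<in> borel_measurable ?A" using Xm by measurable
      show "W m (Suc i) t \<in> borel_measurable ?B" if "0 \<le> t" for t
        using that Bidx by (intro measurable_W) auto
      fix t :: real assume t: "0 \<le> t"
      have "expectation (\<lambda>\<omega>. exp (- (?v i - 1) * W m (Suc i) t \<omega>))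
          = exp (- t * (LINT x:{0<..}|lborel. (1 - exp (- (?v i - 1) * x)) * levy_density k \<delta> (Suc i) x))"
        by (rule W_laplace) (use i m t v1[of i] in auto)
      then have "expectation (\<lambda>\<omega>. exp (- ((?v i - 1) * W m (Suc i) t \<omega>)))
          = exp (- t * (LINT x:{0<..}|lborel. (1 - exp (- (?v i - 1) * x)) * levy_density k \<delta> (Suc i) x))"
        by (simp only: minus_mult_left)
      also have "(LINT x:{0<..}|lborel. (1 - exp (- (?v i - 1) * x)) * levy_density k \<delta> (Suc i) x)
         = (1 + (?v i - 1)) powr (b (Suc i) / b i) - 1"
        using stable_exponent[OF beta, of "?v i - 1"] v1[of i] i m by (simp add: levy_density_def)
      finally show "expectation (\<lambda>\<omega>. exp (- ((?v i - 1) * W m (Suc i) t \<omega>))) = exp (- ((iter (\<lambda>_. 1) \<theta> (Suc i) - 1) * t))"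
        unfolding yv by (simp add: mult.commute)
    qed (use X_nonneg[OF m] F01 W_nonneg[of "Suc i" m] W_right[of "Suc i" m] v1[of i] y1 i m in \<open>auto simp del: iter.simps\<close>)
    also have "\<dots> = expectation (\<lambda>\<omega>. ?F (Suc i) \<omega> * exp (- ((?v (Suc i) - 1) * X m (Suc i) \<omega>)))"
    proof (intro Bochner_Integration.integral_cong refl)
      fix \<omega>
      have "{i<..m} = insert (Suc i) {Suc i<..m}" using i by auto
      then have "(\<Sum>l\<in>{i<..m}. \<theta> l * X m l \<omega>) = \<theta> (Suc i) * X m (Suc i) \<omega> + (\<Sum>l\<in>{Suc i<..m}. \<theta> l * X m l \<omega>)"
        by simp
      then show "?F i \<omega> * exp (- ((iter (\<lambda>_. 1) \<theta> (Suc i) - 1) * X m (Suc i) \<omega>))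
          = ?F (Suc i) \<omega> * exp (- ((?v (Suc i) - 1) * X m (Suc i) \<omega>))"
        by (simp add: exp_add[symmetric] iter_arg_def algebra_simps del: iter.simps)
    qed
    finally show ?thesis .
  qed
  have all: "expectation (\<lambda>\<omega>. exp (- (\<Sum>l\<le>m. \<theta> l * X m l \<omega>)))
     = expectation (\<lambda>\<omega>. ?F i \<omega> * exp (- ((?v i - 1) * X m i \<omega>)))" if "i \<le> m" for i
    using that
  proof (induction i)
    case 0
    \<comment> \<open>At index 0 \<open>iter\<close> is 1, so \<open>?v 0 - 1\<close> is just
      \<open>\<theta> 0\<close>.\<close>
    have "{..m} = insert 0 {0<..m}" by auto
    then show ?case by (simp add: exp_add[symmetric] iter_arg_def algebra_simps)
  next
    case (Suc i)
    then show ?case using step[of i] by simp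
  qed
  have "expectation (\<lambda>\<omega>. exp (- (\<Sum>l\<le>m. \<theta> l * X m l \<omega>))) = expectation (\<lambda>\<omega>. exp (- ((?v m - 1) * G m \<omega>)))"
    using all[of m] by (simp add: X_simps)
  also have "\<dots> = (1 + (?v m - 1)) powr (- (1 + \<delta>) / b m)"
    by (rule G_laplace[OF m]) (use v1[OF m] in simp)
  finally show ?thesis by simp
qed

text \<open>The vectors for different \<open>m\<close> draw on disjoint blocks, hence the transform
  is a product over \<open>m\<close>.\<close>

lemma Xsum_laplace:
  assumes \<theta>: "\<And>l. 0 \<le> \<theta> l"
  shows "expectation (\<lambda>\<omega>. exp (- (\<Sum>l\<le>k. \<theta> l * Xsum k G W \<omega> l))) = transf (\<lambda>_. 1) \<theta>"
proof -
  define Y where "Y m \<omega> = exp (- (\<Sum>l\<le>m. \<theta> l * X m l \<omega>))" for m \<omega>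
  have YA: "Y m \<in> borel_measurable (gen_alg (block m 0))" if "m \<in> {..k}" for m
  proof -
    have "m \<le> k" using that by simp
    note [measurable] = X_measurable_block0[OF this]
    show ?thesis unfolding Y_def by measurable
  qed
  have YN: "Y m \<in> borel_measurable N" if "m \<in> {..k}" for m
  proof -
    have idx: "block m 0 \<subseteq> idx" using that by (intro block_idx) simp
    show ?thesis by (rule measurable_sub_sigma[OF YA[OF that] gen_alg(1)[OF idx] gen_alg(3)[OF idx]])
  qed
  have "indep_sets (\<lambda>m. sigma_sets (space N) (\<Union>i\<in>block m 0. gsig i)) {..k}"
  proof (rule indep_sets_collect_sigma)
    show "indep_sets gsig (\<Union>m\<in>{..k}. block m 0)"
      by (rule indep_sets_mono_index[OF _ indep]) (use block_idx in blast)
    show "disjoint_family_on (\<lambda>m. block m 0) {..k}"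
      by (auto simp: disjoint_family_on_def block_def)
  qed (rule Int_stable_gsig)
  then have "indep_sets (\<lambda>m. {Y m -` A \<inter> space N |A. A \<in> sets borel}) {..k}"
  proof (rule indep_sets_mono_sets)
    fix m assume m: "m \<in> {..k}"
    then have "block m 0 \<subseteq> idx" by (intro block_idx) simp
    then show "{Y m -` A \<inter> space N |A. A \<in> sets borel} \<subseteq> sigma_sets (space N) (\<Union>i\<in>block m 0. gsig i)"
      using measurable_sets[OF YA[OF m]] gen_alg(1,2) by auto
  qed
  then have ind: "indep_vars (\<lambda>_. borel) Y {..k}"
    unfolding indep_vars_def2 using YN by blast
  have int: "integrable N (Y m)" if "m \<in> {..k}" for m
    by (rule integrable_const_bound[of _ 1])
      (use YN[OF that] X_nonneg[of m] \<theta> that in \<open>auto simp: Y_def intro!: AE_I2 sum_nonneg\<close>)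
  have "expectation (\<lambda>\<omega>. exp (- (\<Sum>l\<le>k. \<theta> l * Xsum k G W \<omega> l))) = expectation (\<lambda>\<omega>. \<Prod>m\<in>{..k}. Y m \<omega>)"
  proof (intro Bochner_Integration.integral_cong refl)
    fix \<omega>
    have "(\<Sum>l\<le>k. \<theta> l * Xsum k G W \<omega> l) = (\<Sum>l\<le>k. \<Sum>m\<le>k. \<theta> l * X m l \<omega>)"
      by (simp add: Xsum_def sum_distrib_left)
    also have "\<dots> = (\<Sum>m\<le>k. \<Sum>l\<le>k. \<theta> l * X m l \<omega>)" by (rule sum.swap)
    also have "\<dots> = (\<Sum>m\<le>k. \<Sum>l\<le>m. \<theta> l * X m l \<omega>)"
      by (intro sum.cong refl sum.mono_neutral_right) (auto simp: X_simps)
    finally show "exp (- (\<Sum>l\<le>k. \<theta> l * Xsum k G W \<omega> l)) = (\<Prod>m\<in>{..k}. Y m \<omega>)"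
      by (simp add: Y_def exp_sum[symmetric] sum_negf)
  qed
  also have "\<dots> = (\<Prod>m\<in>{..k}. expectation (Y m))"
    by (rule indep_vars_lebesgue_integral[OF _ ind int]) auto
  also have "\<dots> = transf (\<lambda>_. 1) \<theta>"
    unfolding transf_def Y_def by (intro prod.cong refl X_laplace \<theta>) simp
  finally show ?thesis .
qed

end

section \<open>The measure on the half-line and the punctured cube\<close>

lemma sets_restrict_Ioi:
  "sets (restrict_space borel {0<..}) = sigma_sets {0<..} {{x<..} | x :: real. 0 < x}"
proof -
  let ?E = "{{x<..} | x :: real. 0 < x}"
  have Ioi: "{0<..} \<in> sigma_sets {0<..} ?E" by (rule sigma_sets_top)
  have "sets (restrict_space borel {0<..}) = (\<inter>) {0<..} ` sigma_sets UNIV (range (\<lambda>a::real. {a<..}))"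
    by (simp add: sets_restrict_space borel_Ioi)
  also have "\<dots> = sigma_sets {0<..} ((\<inter>) {0<..} ` range (\<lambda>a::real. {a<..}))"
    by (rule sigma_sets_Int) (auto intro: sigma_sets.Basic)
  also have "\<dots> = sigma_sets {0<..} ?E"
  proof (rule sigma_sets_eqI)
    fix A assume "A \<in> (\<inter>) {0<..} ` range (\<lambda>a::real. {a<..})"
    then obtain a where A: "A = {0<..} \<inter> {a<..}" by auto
    show "A \<in> sigma_sets {0<..} ?E"
    proof (cases "0 < a")
      case True
      then have "A = {a<..}" using A by auto
      then show ?thesis using True by (auto intro!: sigma_sets.Basic)
    next
      case False
      then have "A = {0<..}" using A by auto
      then show ?thesis using Ioi by simp
    qed
  next
    fix A assume "A \<in> ?E"
    then obtain x where "0 < x" "A = {x<..}" by auto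
    then have "A = {0<..} \<inter> {x<..}" by auto
    then show "A \<in> sigma_sets {0<..} ((\<inter>) {0<..} ` range (\<lambda>a::real. {a<..}))"
      by (auto intro!: sigma_sets.Basic)
  qed
  finally show ?thesis .
qed

text \<open>Rays are stable under intersection and generate the sigma-algebra, and rays of finite
  mass exhaust the half-line.\<close>

lemma tail_measure_unique:
  fixes \<nu> \<mu> :: "real measure"
  assumes "sets \<nu> = sets (restrict_space borel {0<..})" "sets \<mu> = sets (restrict_space borel {0<..})"
    and "\<And>x. 0 < x \<Longrightarrow> emeasure \<nu> {x<..} = ennreal (f x)" "\<And>x. 0 < x \<Longrightarrow> emeasure \<mu> {x<..} = ennreal (f x)"
  shows "\<nu> = \<mu>"
proof (rule measure_eqI_generator_eq[where \<Omega> = "{0<..}" and E = "{{x<..} | x. 0 < x}" and A = "\<lambda>i. {inverse (real (Suc i))<..}"])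
  show "Int_stable {{x<..} | x :: real. 0 < x}"
  proof (rule Int_stableI)
    fix A B assume "A \<in> {{x<..} | x :: real. 0 < x}" "B \<in> {{x<..} | x :: real. 0 < x}"
    then obtain x y where "A = {x<..}" "B = {y<..}" "0 < x" "0 < y" by auto
    then have "A \<inter> B = {max x y<..} \<and> 0 < max x y" by auto
    then show "A \<inter> B \<in> {{x<..} | x. 0 < x}" by blast
  qed
  show "(\<Union>i. {inverse (real (Suc i))<..}) = {0<..}"
  proof (intro equalityI subsetI)
    fix x :: real assume "x \<in> {0<..}"
    then obtain n where "inverse (real (Suc n)) < x" using reals_Archimedean[of x] by auto
    then show "x \<in> (\<Union>i. {inverse (real (Suc i))<..})" by auto
  next
    fix x assume "x \<in> (\<Union>i. {inverse (real (Suc i))<..})"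
    then obtain i where "inverse (real (Suc i)) < x" by auto
    then show "x \<in> {0<..}" by (simp add: order_less_trans[of 0 "inverse (real (Suc i))"])
  qed
  show "emeasure \<nu> X = emeasure \<mu> X" if "X \<in> {{x<..} | x. 0 < x}" for X using that assms by auto
  show "emeasure \<nu> {inverse (real (Suc i))<..} \<noteq> \<infinity>" for i
    by (subst assms(3)) (simp_all del: of_nat_Suc)
qed (use assms in \<open>auto simp: sets_restrict_Ioi intro: positive_imp_inverse_positive simp del: of_nat_Suc\<close>)

context tree_params
begin

text \<open>Under \<open>x = exp (b 0 * s)\<close> a ray in \<open>x\<close> is a ray in
  \<open>s\<close>, and the exponential tail at \<open>ln x / b 0\<close> is the power tail of
  \<open>\<nu>\<close>.\<close>

lemma nn_integral_nu_exp:
  assumes \<nu>: "sets \<nu> = sets (restrict_space borel {0<..})"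
      "\<And>x. 0 < x \<Longrightarrow> emeasure \<nu> {x<..} = ennreal (x powr (- (\<tau> / b 0)))"
    and f: "f \<in> borel_measurable (restrict_space borel {0<..})"
  shows "(\<integral>\<^sup>+x. f x \<partial>\<nu>) = (\<integral>\<^sup>+s. ennreal (\<tau> * exp (- (\<tau> * s))) * f (exp (b 0 * s)) \<partial>lborel)"
proof -
  let ?D = "density lborel (\<lambda>s. ennreal (\<tau> * exp (- (\<tau> * s))))"
  let ?R = "restrict_space borel {0::real<..}"
  have m: "(\<lambda>s. exp (b 0 * s)) \<in> measurable ?D ?R"
    by (intro measurable_restrict_space2) auto
  have "\<nu> = distr ?D ?R (\<lambda>s. exp (b 0 * s))"
  proof (rule tail_measure_unique[OF \<nu>(1) _ \<nu>(2)])
    fix x :: real assume x: "0 < x"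
    have b0: "0 < b 0" by (simp add: b_pos)
    have xs: "{x<..} \<in> sets ?R"
      using x by (auto simp: sets_restrict_space intro!: image_eqI[of _ _ "{x<..}"])
    have "emeasure (distr ?D ?R (\<lambda>s. exp (b 0 * s))) {x<..} = emeasure ?D ((\<lambda>s. exp (b 0 * s)) -` {x<..} \<inter> space ?D)"
      by (rule emeasure_distr[OF m xs])
    also have "(\<lambda>s. exp (b 0 * s)) -` {x<..} \<inter> space ?D = {ln x / b 0<..}"
    proof -
      have "x < exp (b 0 * s) \<longleftrightarrow> ln x / b 0 < s" for s
      proof -
        have "x < exp (b 0 * s) \<longleftrightarrow> ln x < b 0 * s" using x by (metis exp_less_cancel_iff exp_ln)
        also have "\<dots> \<longleftrightarrow> ln x / b 0 < s" using b0 by (simp add: pos_divide_less_eq mult.commute)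
        finally show ?thesis .
      qed
      then show ?thesis by auto
    qed
    also have "emeasure ?D {ln x / b 0<..} = (\<integral>\<^sup>+s. ennreal (\<tau> * exp (- (\<tau> * s))) * indicator {ln x / b 0<..} s \<partial>lborel)"
      by (rule emeasure_density) auto
    also have "\<dots> = (\<integral>\<^sup>+s. ennreal (\<tau> * exp (- (\<tau> * s))) * indicator {ln x / b 0..} s \<partial>lborel)"
      by (intro nn_integral_cong_AE, use AE_lborel_singleton[of "ln x / b 0"] in eventually_elim) (auto simp: indicator_def)
    also have "\<dots> = ennreal (0 - (- exp (- (\<tau> * (ln x / b 0)))))"
    proof (rule nn_integral_FTC_atLeast)
      show "((\<lambda>s. - exp (- (\<tau> * s))) \<longlongrightarrow> 0) at_top" using tau_pos by real_asymp
    qed (use tau_pos in \<open>auto intro!: derivative_eq_intros\<close>)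
    also have "0 - (- exp (- (\<tau> * (ln x / b 0)))) = x powr (- (\<tau> / b 0))"
      using x by (simp add: powr_def)
    finally show "emeasure (distr ?D ?R (\<lambda>s. exp (b 0 * s))) {x<..} = ennreal (x powr (- (\<tau> / b 0)))" .
  qed simp
  then have "(\<integral>\<^sup>+x. f x \<partial>\<nu>) = (\<integral>\<^sup>+x. f x \<partial>distr ?D ?R (\<lambda>s. exp (b 0 * s)))" by simp
  also have "\<dots> = (\<integral>\<^sup>+s. f (exp (b 0 * s)) \<partial>?D)" by (rule nn_integral_distr[OF m]) (use f in simp)
  also have "\<dots> = (\<integral>\<^sup>+s. ennreal (\<tau> * exp (- (\<tau> * s))) * f (exp (b 0 * s)) \<partial>lborel)"
  proof (rule nn_integral_density)
    have "(\<lambda>s. exp (b 0 * s)) \<in> measurable lborel ?R" using m by simp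
    then show "(\<lambda>s. f (exp (b 0 * s))) \<in> borel_measurable lborel" by (rule measurable_compose[OF _ f])
  qed simp
  finally show ?thesis .
qed

text \<open>The description of \<open>\<nu>\<close> in its original coordinate, used for the
  integral formula for boxes.\<close>

lemma nn_integral_nu_density:
  assumes \<nu>: "sets \<nu> = sets (restrict_space borel {0<..})"
      "\<And>x. 0 < x \<Longrightarrow> emeasure \<nu> {x<..} = ennreal (x powr (- (\<tau> / b 0)))"
    and f: "(\<lambda>x. f x * indicator {0<..} x) \<in> borel_measurable borel"
  shows "(\<integral>\<^sup>+x. f x \<partial>\<nu>) = ennreal (\<tau> / b 0) * (\<integral>\<^sup>+u\<in>{0<..}. f u * ennreal (u powr (- (1 + \<tau> / b 0))) \<partial>lborel)"
proof -
  let ?\<alpha> = "\<tau> / b 0"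
  have \<alpha>: "0 < ?\<alpha>" using tau_pos b_pos[of 0] by simp
  let ?g = "\<lambda>u. ennreal (?\<alpha> * u powr (- (1 + ?\<alpha>)))"
  let ?D = "density lborel ?g"
  let ?R = "restrict_space ?D {0::real<..}"
  have "\<nu> = ?R"
  proof (rule tail_measure_unique[OF \<nu>(1) _ \<nu>(2)])
    show "sets ?R = sets (restrict_space borel {0<..})" by (simp add: sets_restrict_space)
    fix x :: real assume x: "0 < x"
    have "emeasure ?R {x<..} = emeasure ?D {x<..}"
      by (rule emeasure_restrict_space) (use x in auto)
    also have "\<dots> = (\<integral>\<^sup>+u. ?g u * indicator {x<..} u \<partial>lborel)"
      by (rule emeasure_density) auto
    also have "\<dots> = (\<integral>\<^sup>+u. ?g u * indicator {x..} u \<partial>lborel)"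
      by (intro nn_integral_cong_AE, use AE_lborel_singleton[of x] in eventually_elim) (auto simp: indicator_def)
    also have "\<dots> = ennreal (0 - (- (x powr (- ?\<alpha>))))"
    proof (rule nn_integral_FTC_atLeast)
      show "((\<lambda>u. - (u powr (- ?\<alpha>))) \<longlongrightarrow> 0) at_top" using \<alpha> by real_asymp
      fix u assume "x \<le> u"
      then have "0 < u" using x by simp
      then show "((\<lambda>u. - (u powr (- ?\<alpha>))) has_real_derivative ?\<alpha> * u powr (- (1 + ?\<alpha>))) (at u)"
        by (auto intro!: derivative_eq_intros simp: algebra_simps powr_diff powr_minus powr_add field_simps)
    next
      show "0 \<le> ?\<alpha> * u powr (- (1 + ?\<alpha>))" for u
        by (rule mult_nonneg_nonneg[OF less_imp_le[OF \<alpha>] powr_ge_zero])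
    qed auto
    finally show "emeasure ?R {x<..} = ennreal (x powr (- ?\<alpha>))" by simp
  qed
  then have "(\<integral>\<^sup>+x. f x \<partial>\<nu>) = (\<integral>\<^sup>+x. f x \<partial>?R)" by simp
  also have "\<dots> = (\<integral>\<^sup>+x. f x * indicator {0<..} x \<partial>?D)"
    by (rule nn_integral_restrict_space) auto
  also have "\<dots> = (\<integral>\<^sup>+x. ?g x * (f x * indicator {0<..} x) \<partial>lborel)"
    by (rule nn_integral_density) (use f in auto)
  also have "\<dots> = (\<integral>\<^sup>+x. ennreal ?\<alpha> * (f x * ennreal (x powr (- (1 + ?\<alpha>))) * indicator {0<..} x) \<partial>lborel)"
    by (intro nn_integral_cong, subst ennreal_mult'[OF less_imp_le[OF \<alpha>]]) (simp add: mult_ac)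
  also have "\<dots> = ennreal ?\<alpha> * (\<integral>\<^sup>+x. f x * ennreal (x powr (- (1 + ?\<alpha>))) * indicator {0<..} x \<partial>lborel)"
  proof (rule nn_integral_cmult)
    have "(\<lambda>x. (f x * indicator {0<..} x) * ennreal (x powr (- (1 + ?\<alpha>)))) \<in> borel_measurable lborel"
      using f by measurable
    then show "(\<lambda>x. f x * ennreal (x powr (- (1 + ?\<alpha>))) * indicator {0<..} x) \<in> borel_measurable lborel"
      by (simp add: mult_ac)
  qed
  finally show ?thesis .
qed

end

section \<open>Topology and Borel sets of the punctured cube\<close>

lemma topspace_cube: "topspace (cube k) = (\<Pi>\<^sub>E i\<in>{..k}. UNIV)"
  by (simp add: cube_def)

lemma space_borel_of: "space (borel_of X) = topspace X"
  unfolding borel_of_def by (rule space_measure_of) (auto dest: openin_subset)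

lemma sets_borel_of: "sets (borel_of X) = sigma_sets (topspace X) {U. openin X U}"
  unfolding borel_of_def by (rule sets_measure_of) (auto dest: openin_subset)

lemma openin_borel_of: "openin X U \<Longrightarrow> U \<in> sets (borel_of X)"
  by (simp add: sets_borel_of sigma_sets.Basic)

lemma continuous_map_restrict_cube: "continuous_map euclidean (cube k) (\<lambda>y. restrict y {..k})"
  unfolding cube_def continuous_map_componentwise
proof (intro conjI ballI)
  fix i assume i: "i \<in> {..k}"
  have "continuous_on UNIV (\<lambda>y :: nat \<Rightarrow> ennreal. y i)" by (rule continuous_on_product_coordinates)
  then show "continuous_map euclidean euclidean (\<lambda>y. (restrict y {..k} :: nat \<Rightarrow> ennreal) i)"
    using i by simp
qed auto

text \<open>Extension by 0 leads to functions on all naturals, where coordinatewise measurability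
  implies Borel measurability; restricting to \<open>{..k}\<close> is continuous and leads
  back.\<close>

lemma measurable_cube:
  assumes "\<And>i. i \<le> k \<Longrightarrow> (\<lambda>\<omega>. f \<omega> i) \<in> borel_measurable M"
  shows "(\<lambda>\<omega>. \<lambda>i\<in>{..k}. f \<omega> i) \<in> measurable M (borel_of (cube k))"
  unfolding borel_of_def
proof (rule measurable_measure_of)
  let ?f = "\<lambda>\<omega> i. if i \<le> k then f \<omega> i else 0"
  have fm: "?f \<in> measurable M borel"
  proof (rule measurable_coordinatewise_then_product)
    show "(\<lambda>\<omega>. ?f \<omega> i) \<in> borel_measurable M" for i by (cases "i \<le> k") (use assms in auto)
  qed
  fix U assume "U \<in> {U. openin (cube k) U}"
  then have "openin euclidean {y \<in> topspace euclidean. restrict y {..k} \<in> U}"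
    by (intro openin_continuous_map_preimage[OF continuous_map_restrict_cube]) simp
  then have "open {y. restrict y {..k} \<in> U}" by simp
  then have "?f -` {y. restrict y {..k} \<in> U} \<inter> space M \<in> sets M"
    by (intro measurable_sets[OF fm]) auto
  moreover have "restrict (?f \<omega>) {..k} = (\<lambda>i\<in>{..k}. f \<omega> i)" for \<omega> by (auto simp: restrict_def)
  ultimately show "(\<lambda>\<omega>. \<lambda>i\<in>{..k}. f \<omega> i) -` U \<inter> space M \<in> sets M"
    by (simp add: vimage_def)
next
  show "{U. openin (cube k) U} \<subseteq> Pow (topspace (cube k))" using openin_subset by blast
qed (auto simp: topspace_cube)

lemma topspace_E: "topspace (E k) = topspace (cube k) - {\<lambda>i\<in>{..k}. 0}"
  by (auto simp: E_def)

lemma measurable_E: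
  assumes "f \<in> measurable M (borel_of (cube k))" "\<And>\<omega>. \<omega> \<in> space M \<Longrightarrow> f \<omega> \<in> topspace (E k)"
  shows "f \<in> measurable M (borel_of (E k))"
  unfolding borel_of_def
proof (rule measurable_measure_of)
  fix U assume "U \<in> {U. openin (E k) U}"
  then obtain V where V: "openin (cube k) V" "U = V \<inter> topspace (E k)"
    by (auto simp: E_def openin_subtopology)
  have "f -` V \<inter> space M \<in> sets M" using measurable_sets[OF assms(1) openin_borel_of[OF V(1)]] .
  moreover have "f -` U \<inter> space M = f -` V \<inter> space M" using V assms(2) by auto
  ultimately show "f -` U \<inter> space M \<in> sets M" by simp
qed (use assms(2) in \<open>auto dest: openin_subset\<close>)

lemma topspace_E_iff: "x \<in> topspace (E k) \<longleftrightarrow> x \<in> topspace (cube k) \<and> (\<exists>j\<le>k. 0 < x j)"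
  unfolding topspace_E topspace_cube
  by (auto simp: PiE_def extensional_def restrict_def zero_less_iff_neq_zero fun_eq_iff)

lemma openin_cube_coordinate_gt:
  assumes "j \<le> k" shows "openin (cube k) {x \<in> topspace (cube k). c < x j}"
proof -
  have "continuous_map (cube k) euclidean (\<lambda>x. x j)"
    unfolding cube_def using assms by (intro continuous_map_product_projection) auto
  then have "openin (cube k) {x \<in> topspace (cube k). x j \<in> {c<..}}"
    by (rule openin_continuous_map_preimage) simp
  then show ?thesis by simp
qed

lemma openin_topspace_E: "openin (cube k) (topspace (E k))"
proof -
  have "openin (cube k) (\<Union>j\<in>{..k}. {x \<in> topspace (cube k). 0 < x j})"
    by (intro openin_Union) (auto intro: openin_cube_coordinate_gt)
  moreover have "(\<Union>j\<in>{..k}. {x \<in> topspace (cube k). 0 < x j}) = topspace (E k)"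
    by (auto simp: topspace_E_iff)
  ultimately show ?thesis by simp
qed

text \<open>The punctured cube is open and therefore a Borel set, so the trace of the Borel sets is
  generated by the traces of the open sets.\<close>

lemma sets_restrict_borel_of_cube:
  "sets (restrict_space (borel_of (cube k)) (topspace (E k))) = sets (borel_of (E k))"
proof -
  let ?S = "topspace (E k)"
  have "sets (restrict_space (borel_of (cube k)) ?S) = (\<inter>) ?S ` sigma_sets (topspace (cube k)) {U. openin (cube k) U}"
    by (simp add: sets_restrict_space sets_borel_of)
  also have "\<dots> = sigma_sets ?S ((\<inter>) ?S ` {U. openin (cube k) U})"
    by (rule sigma_sets_Int) (use openin_topspace_E[of k] in \<open>auto intro!: sigma_sets.Basic dest: openin_subset\<close>)
  also have "(\<inter>) ?S ` {U. openin (cube k) U} = {U. openin (E k) U}"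
    unfolding E_def openin_subtopology by (auto simp: topspace_cube)
  finally show ?thesis by (simp add: sets_borel_of)
qed

lemma openin_coordinate_gt:
  "openin (E k) {x \<in> topspace (E k). \<exists>j\<le>k. c < x j}"
proof -
  have "openin (E k) {x \<in> topspace (E k). c < x j}" if "j \<le> k" for j
  proof -
    have "continuous_map (E k) euclidean (\<lambda>x. x j)"
      unfolding E_def cube_def using that
      by (intro continuous_map_from_subtopology continuous_map_product_projection) auto
    then have "openin (E k) {x \<in> topspace (E k). x j \<in> {c<..}}"
      by (rule openin_continuous_map_preimage) simp
    then show ?thesis by simp
  qed
  then have "openin (E k) (\<Union>j\<in>{..k}. {x \<in> topspace (E k). c < x j})" by (intro openin_Union) auto
  moreover have "(\<Union>j\<in>{..k}. {x \<in> topspace (E k). c < x j}) = {x \<in> topspace (E k). \<exists>j\<le>k. c < x j}" by auto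
  ultimately show ?thesis by simp
qed

text \<open>The open sets where some coordinate exceeds \<open>inverse (real (Suc n))\<close> cover
  the space, and in a finite subcover the smallest threshold works for the whole compact
  set.\<close>

lemma compactin_E_away:
  assumes "compactin (E k) K"
  shows "\<exists>c>0. \<forall>x\<in>K. \<exists>j\<le>k. ennreal c < x j"
proof -
  define U where "U n = {x \<in> topspace (E k). \<exists>j\<le>k. ennreal (inverse (real (Suc n))) < x j}" for n
  have op: "openin (E k) V" if "V \<in> range U" for V
    using that openin_coordinate_gt[of k] by (auto simp: U_def)
  have cov: "K \<subseteq> \<Union> (range U)"
  proof
    fix x assume "x \<in> K"
    then have xE: "x \<in> topspace (E k)" using compactin_subset_topspace[OF assms] by auto
    then obtain j where j: "j \<le> k" "0 < x j" by (auto simp: topspace_E_iff)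
    obtain r where r: "0 < r" "ennreal r < x j"
    proof (cases "x j")
      case (real s)
      then have "0 < s" using j by (auto simp: ennreal_eq_0_iff)
      then show ?thesis using that[of "s / 2"] real by (simp add: ennreal_less_iff)
    next
      case top
      then show ?thesis using that[of 1] by (simp add: ennreal_less_top)
    qed
    obtain n where "inverse (real (Suc n)) < r" using reals_Archimedean[OF r(1)] by auto
    then have "ennreal (inverse (real (Suc n))) \<le> ennreal r" by (intro ennreal_leI) simp
    then have "ennreal (inverse (real (Suc n))) < x j" using r(2) by (rule order_le_less_trans)
    then have "x \<in> U n" using j(1) xE by (auto simp: U_def)
    then show "x \<in> \<Union> (range U)" by blast
  qed
  obtain F where F: "finite F" "F \<subseteq> range U" "K \<subseteq> \<Union> F"
    using compactinD[where \<U> = "range U", OF assms _ cov] op by blast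
  then obtain I where I: "finite I" "F = U ` I" using finite_subset_image[OF F(1,2)] by blast
  let ?n = "Max (insert 0 I)"
  show ?thesis
  proof (intro exI[of _ "inverse (real (Suc ?n))"] conjI ballI)
    fix x assume "x \<in> K"
    then obtain n j where n: "n \<in> I" "j \<le> k" "ennreal (inverse (real (Suc n))) < x j" using F(3) I(2) by (auto simp: U_def)
    have "n \<le> ?n" by (rule Max_ge) (use n I in auto)
    then have "inverse (real (Suc ?n)) \<le> inverse (real (Suc n))" by (intro le_imp_inverse_le) auto
    then have "ennreal (inverse (real (Suc ?n))) \<le> ennreal (inverse (real (Suc n)))" by (rule ennreal_leI)
    then have "ennreal (inverse (real (Suc ?n))) < x j" using n(3) by (rule order_le_less_trans)
    then show "\<exists>j\<le>k. ennreal (inverse (real (Suc ?n))) < x j" using n(2) by blast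
  next
    show "0 < inverse (real (Suc ?n))" by (rule positive_imp_inverse_positive) simp
  qed
qed

section \<open>Convergence of means\<close>

text \<open>The cube in the variables exp(-x): infinity becomes 0 and the origin becomes the corner
  (1, ..., 1). Fixing the remaining coordinates at 0 makes it a compact subset of a function type,
  the setting of the Stone-Weierstrass theorem.\<close>

definition ycube :: "nat \<Rightarrow> (nat \<Rightarrow> real) set" where
  "ycube k = {y. (\<forall>i\<le>k. 0 \<le> y i \<and> y i \<le> 1) \<and> (\<forall>i>k. y i = 0)}"

lemma ycube_iff: "y \<in> ycube k \<longleftrightarrow> (\<forall>i\<le>k. 0 \<le> y i \<and> y i \<le> 1) \<and> (\<forall>i>k. y i = 0)"
  by (simp add: ycube_def)

lemma compact_ycube: "compact (ycube k)"
proof -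
  define B :: "nat \<Rightarrow> real set" where "B i = (if i \<le> k then {0..1} else {0})" for i
  have "ycube k = (\<Pi>\<^sub>E i\<in>UNIV. B i)"
  proof (intro set_eqI iffI)
    fix y assume "y \<in> ycube k"
    then show "y \<in> (\<Pi>\<^sub>E i\<in>UNIV. B i)" by (simp add: PiE_iff B_def ycube_iff)
  next
    fix y assume "y \<in> (\<Pi>\<^sub>E i\<in>UNIV. B i)"
    then have y: "y i \<in> B i" for i by (simp add: PiE_iff)
    have "0 \<le> y i \<and> y i \<le> 1" if "i \<le> k" for i using y[of i] that by (simp add: B_def)
    moreover have "y i = 0" if "k < i" for i using y[of i] that by (simp add: B_def)
    ultimately show "y \<in> ycube k" by (simp add: ycube_iff)
  qed
  moreover have "compactin (product_topology (\<lambda>i. euclidean) (UNIV :: nat set)) (\<Pi>\<^sub>E i\<in>UNIV. B i)"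
    by (subst compactin_PiE) (simp add: B_def)
  ultimately show ?thesis by (simp add: euclidean_product_topology)
qed

inductive_set monom_span :: "nat \<Rightarrow> ((nat \<Rightarrow> real) \<Rightarrow> real) set" for k where
  monom: "(\<lambda>y. c * mono_x k y x) \<in> monom_span k"
| add: "f \<in> monom_span k \<Longrightarrow> g \<in> monom_span k \<Longrightarrow> (\<lambda>y. f y + g y) \<in> monom_span k"

lemma monom_span_mult_monom: "f \<in> monom_span k \<Longrightarrow> (\<lambda>y. f y * (c * mono_x k y x)) \<in> monom_span k"
proof (induction rule: monom_span.induct)
  case (monom c' x')
  have "(\<lambda>y. c' * mono_x k y x' * (c * mono_x k y x)) = (\<lambda>y. (c' * c) * mono_x k y (\<lambda>l. x' l + x l))"
    by (simp add: mono_x_add mult_ac)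
  then show ?case by (simp only: monom_span.monom)
next
  case (add f g)
  have "(\<lambda>y. (f y + g y) * (c * mono_x k y x)) = (\<lambda>y. f y * (c * mono_x k y x) + g y * (c * mono_x k y x))"
    by (simp add: distrib_right)
  then show ?case using monom_span.add[OF add.IH] by simp
qed

lemma monom_span_mult:
  assumes f: "f \<in> monom_span k" and g: "g \<in> monom_span k" shows "(\<lambda>y. f y * g y) \<in> monom_span k"
  using g
proof (induction rule: monom_span.induct)
  case (monom c x)
  then show ?case by (rule monom_span_mult_monom[OF f])
next
  case (add g h)
  have "(\<lambda>y. f y * (g y + h y)) = (\<lambda>y. f y * g y + f y * h y)" by (simp add: distrib_left)
  then show ?case using monom_span.add[OF add.IH] by simp
qed

lemma continuous_on_coord: "continuous_on S (\<lambda>y :: nat \<Rightarrow> real. y i)"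
  by (rule continuous_on_subset[OF continuous_on_product_coordinates subset_UNIV])

lemma continuous_on_mono_x: "continuous_on S (\<lambda>y. mono_x k y x)"
  unfolding mono_x_def by (intro continuous_intros continuous_on_coord)

lemma continuous_on_monom_span: "f \<in> monom_span k \<Longrightarrow> continuous_on S f"
  by (induction rule: monom_span.induct) (intro continuous_intros continuous_on_mono_x | assumption)+

lemma function_ring_monom_span: "function_ring_on (monom_span k) (ycube k)"
proof
  show "compact (ycube k)" by (rule compact_ycube)
  show "(\<lambda>_. c) \<in> monom_span k" for c
    using monom_span.monom[of c k "\<lambda>_. 0"] by (simp add: mono_x_def)
  fix x y assume xy: "x \<in> ycube k" "y \<in> ycube k" "x \<noteq> y"
  then obtain j where j: "x j \<noteq> y j" by auto
  have "j \<le> k"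
  proof (rule ccontr)
    assume "\<not> j \<le> k"
    then have "x j = 0" "y j = 0" using xy(1,2) by (simp_all add: ycube_iff)
    then show False using j by simp
  qed
  then have "(\<lambda>y. y j) \<in> monom_span k" using monom_span.monom[of 1 k "\<lambda>l. if l = j then 1 else 0"] by (simp add: mono_x_unit)
  then show "\<exists>f\<in>monom_span k. f x \<noteq> f y" by (rule bexI[rotated]) (rule j)
next
  fix f g assume f: "f \<in> monom_span k" and g: "g \<in> monom_span k"
  show "continuous_on (ycube k) f" by (rule continuous_on_monom_span[OF f])
  show "(\<lambda>x. f x + g x) \<in> monom_span k" by (rule monom_span.add[OF f g])
  show "(\<lambda>x. f x * g x) \<in> monom_span k" by (rule monom_span_mult[OF f g])
qed

text \<open>Plays the part of a distance to the corner that represents the origin; its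
  \<open>n\<close>-th powers are the factors for which the limit measure is under control.\<close>

definition corner :: "nat \<Rightarrow> nat \<Rightarrow> (nat \<Rightarrow> real) \<Rightarrow> real" where
  "corner k n y = (\<Sum>j\<le>k. (1 - y j) ^ n)"

lemma corner_nonneg: "y \<in> ycube k \<Longrightarrow> 0 \<le> corner k n y"
  unfolding corner_def by (intro sum_nonneg) (auto simp: ycube_iff)

lemma corner_less:
  assumes "y \<in> ycube k" "corner k n y < c ^ n" "j \<le> k" "0 \<le> c" shows "1 - y j < c"
proof -
  have "(1 - y j) ^ n \<le> corner k n y"
    unfolding corner_def by (rule member_le_sum[where f = "\<lambda>j. (1 - y j) ^ n"]) (use assms in \<open>auto simp: ycube_iff\<close>)
  then have "(1 - y j) ^ n < c ^ n" using assms by simp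
  then show ?thesis by (rule power_less_imp_less_base) (use assms in auto)
qed

text \<open>A function vanishing near the corner \<open>(1, \<dots>, 1)\<close> is, up to a small multiple of \<open>corner\<close>, a
  polynomial multiple of \<open>corner\<close>; only the latter is needed from the Laplace transforms.\<close>

lemma approx_by_corner_poly:
  assumes \<phi>: "continuous_on (ycube k) \<phi>" and c: "0 < c"
    and van: "\<And>y. y \<in> ycube k \<Longrightarrow> (\<And>j. j \<le> k \<Longrightarrow> 1 - y j < c) \<Longrightarrow> \<phi> y = 0"
    and e: "0 < e"
  shows "\<exists>P\<in>monom_span k. \<forall>y\<in>ycube k. \<bar>\<phi> y - corner k n y * P y\<bar> \<le> e * corner k n y"
proof -
  \<comment> \<open>The maximum keeps the quotient continuous. Where it differs from
    \<open>corner k n y\<close>, every \<open>1 - y j\<close> is below \<open>c\<close> and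
    \<open>\<phi>\<close> vanishes, so \<open>\<phi>\<close> is \<open>corner k n\<close> times this
    quotient throughout.\<close>
  let ?\<psi> = "\<lambda>y. \<phi> y / max (corner k n y) (c ^ n)"
  have "corner k n = (\<lambda>y. \<Sum>j\<le>k. (1 - y j) ^ n)" by (simp add: fun_eq_iff corner_def)
  then have "continuous_on (ycube k) (corner k n)"
    by (simp only:) (intro continuous_intros continuous_on_coord)
  then have "continuous_on (ycube k) ?\<psi>"
    using c by (intro continuous_intros \<phi>) (auto simp: max_def)
  then obtain P where P: "P \<in> monom_span k" "\<And>y. y \<in> ycube k \<Longrightarrow> \<bar>?\<psi> y - P y\<bar> < e"
    using function_ring_on.Stone_Weierstrass_basic[OF function_ring_monom_span _ e] by blast
  have "\<bar>\<phi> y - corner k n y * P y\<bar> \<le> e * corner k n y" if y: "y \<in> ycube k" for y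
  proof -
    have r0: "0 \<le> corner k n y" by (rule corner_nonneg[OF y])
    define z where "z = ?\<psi> y"
    have "\<phi> y = corner k n y * z"
    proof (cases "corner k n y < c ^ n")
      case True
      then have "\<phi> y = 0" using corner_less[OF y True] c by (intro van y) auto
      then show ?thesis by (simp add: z_def)
    next
      case False
      moreover have "0 < c ^ n" using c by simp
      ultimately show ?thesis by (simp add: z_def max_def)
    qed
    then have "\<phi> y - corner k n y * P y = corner k n y * (z - P y)" by (simp add: right_diff_distrib)
    then have "\<bar>\<phi> y - corner k n y * P y\<bar> = corner k n y * \<bar>z - P y\<bar>"
      using r0 by (simp add: abs_mult)
    also have "\<dots> \<le> corner k n y * e" using P(2)[OF y] r0 unfolding z_def by (intro mult_left_mono) auto
    finally show ?thesis by (simp add: mult.commute)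
  qed
  then show ?thesis using P(1) by blast
qed

lemma (in tree_params) exists_n: "\<exists>n. \<tau> < real n"
  using reals_Archimedean2 by blast

section \<open>Means under the scaled law and under the limit measure\<close>

locale tail_setup = tree_law k \<delta> p q + limit_vars k \<delta> N G W
  for k \<delta> p q and N :: "'c measure" and G W
begin

definition y_deg :: "real \<Rightarrow> (nat \<Rightarrow> nat) \<Rightarrow> nat \<Rightarrow> real" where
  "y_deg h i l = (if l \<le> k then exp (- (deg_scale h l * real (i l))) else 0)"

text \<open>With radial coordinate \<open>x = exp (b 0 * s)\<close>, the power
  \<open>x powr (b l / b 0)\<close> in \<open>chi\<close> is \<open>exp (b l * s)\<close>.\<close>

definition y_lim :: "real \<Rightarrow> 'c \<Rightarrow> nat \<Rightarrow> real" where
  "y_lim s \<omega> l = (if l \<le> k then exp (- (exp (b l * s) * Xsum k G W \<omega> l)) else 0)"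

definition exp_wt :: "real \<Rightarrow> real" where "exp_wt s = \<tau> * exp (- (\<tau> * s))"

lemma Xsum_nonneg: "\<omega> \<in> space N \<Longrightarrow> l \<le> k \<Longrightarrow> 0 \<le> Xsum k G W \<omega> l"
  unfolding Xsum_def using X_nonneg by (auto intro: sum_nonneg)

lemma Xsum_measurable: "l \<le> k \<Longrightarrow> (\<lambda>\<omega>. Xsum k G W \<omega> l) \<in> borel_measurable N"
  unfolding Xsum_def using X_measurable_N by (auto intro!: borel_measurable_sum)

lemma y_deg_ycube: "y_deg h i \<in> ycube k"
  by (simp add: ycube_iff y_deg_def deg_scale_def)

lemma y_lim_ycube: "\<omega> \<in> space N \<Longrightarrow> y_lim s \<omega> \<in> ycube k"
  using Xsum_nonneg by (simp add: ycube_iff y_lim_def)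

lemma y_lim_measurable: "(\<lambda>(s, \<omega>). y_lim s \<omega>) \<in> measurable (lborel \<Otimes>\<^sub>M N) (restrict_space borel (ycube k))"
proof (rule measurable_restrict_space2)
  show "(\<lambda>(s, \<omega>). y_lim s \<omega>) \<in> space (lborel \<Otimes>\<^sub>M N) \<rightarrow> ycube k"
    using y_lim_ycube by (auto simp: space_pair_measure)
  show "(\<lambda>(s, \<omega>). y_lim s \<omega>) \<in> borel_measurable (lborel \<Otimes>\<^sub>M N)"
  proof (rule measurable_coordinatewise_then_product)
    fix l
    show "(\<lambda>z. (case z of (s, \<omega>) \<Rightarrow> y_lim s \<omega>) l) \<in> borel_measurable (lborel \<Otimes>\<^sub>M N)"
    proof (cases "l \<le> k")
      case True
      note [measurable] = Xsum_measurable[OF True]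
      show ?thesis using True by (simp add: y_lim_def split_beta')
    next
      case False
      then show ?thesis by (simp add: y_lim_def split_beta')
    qed
  qed
qed

lemma phi_measurable:
  assumes "continuous_on (ycube k) \<phi>"
  shows "(\<lambda>(s, \<omega>). \<phi> (y_lim s \<omega>)) \<in> borel_measurable (lborel \<Otimes>\<^sub>M N)"
  using measurable_compose[OF y_lim_measurable borel_measurable_continuous_on_restrict[OF assms]]
  by (simp add: split_beta')

definition mean_deg :: "((nat \<Rightarrow> real) \<Rightarrow> real) \<Rightarrow> real \<Rightarrow> real" where
  "mean_deg f h = h * measure_pmf.expectation q (\<lambda>i. f (y_deg h i))"

definition mean_lim :: "((nat \<Rightarrow> real) \<Rightarrow> real) \<Rightarrow> real" where
  "mean_lim f = (LINT z|(lborel \<Otimes>\<^sub>M N). exp_wt (fst z) * f (y_lim (fst z) (snd z)))"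

text \<open>Integrability belongs to the notion because the limit measure is infinite and a Bochner
  integral defaults to 0; boundedness makes the means under \<open>q\<close> additive.\<close>

definition means_converge :: "((nat \<Rightarrow> real) \<Rightarrow> real) \<Rightarrow> bool" where
  "means_converge f \<longleftrightarrow> integrable (lborel \<Otimes>\<^sub>M N) (\<lambda>z. exp_wt (fst z) * f (y_lim (fst z) (snd z)))
     \<and> (\<exists>B. \<forall>y\<in>ycube k. \<bar>f y\<bar> \<le> B) \<and> (mean_deg f \<longlongrightarrow> mean_lim f) at_top"

lemma integrable_mean_deg:
  fixes f :: "(nat \<Rightarrow> real) \<Rightarrow> real"
  shows "\<exists>B. \<forall>y\<in>ycube k. \<bar>f y\<bar> \<le> B \<Longrightarrow> integrable (measure_pmf q) (\<lambda>i. f (y_deg h i))"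
proof -
  assume "\<exists>B. \<forall>y\<in>ycube k. \<bar>f y\<bar> \<le> B"
  then obtain B where "\<And>y. y \<in> ycube k \<Longrightarrow> \<bar>f y\<bar> \<le> B" by blast
  then show ?thesis
    by (intro measure_pmf.integrable_const_bound[where B = B] AE_I2) (simp_all add: y_deg_ycube)
qed

lemma means_converge_add:
  assumes "means_converge f" "means_converge g" shows "means_converge (\<lambda>y. f y + g y)"
proof -
  obtain B C where B: "\<And>y. y \<in> ycube k \<Longrightarrow> \<bar>f y\<bar> \<le> B" and C: "\<And>y. y \<in> ycube k \<Longrightarrow> \<bar>g y\<bar> \<le> C"
    using assms unfolding means_converge_def by metis
  have "mean_deg (\<lambda>y. f y + g y) h = mean_deg f h + mean_deg g h" for h
  proof -
    have "\<exists>B. \<forall>y\<in>ycube k. \<bar>f y\<bar> \<le> B" "\<exists>B. \<forall>y\<in>ycube k. \<bar>g y\<bar> \<le> B"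
      using assms by (simp_all add: means_converge_def)
    note i = this[THEN integrable_mean_deg]
    show ?thesis by (simp add: mean_deg_def Bochner_Integration.integral_add[OF i] distrib_left)
  qed
  then have "mean_deg (\<lambda>y. f y + g y) = (\<lambda>h. mean_deg f h + mean_deg g h)" by blast
  moreover have "mean_lim (\<lambda>y. f y + g y) = mean_lim f + mean_lim g"
    unfolding mean_lim_def distrib_left using assms unfolding means_converge_def by (intro Bochner_Integration.integral_add) auto
  moreover have "\<bar>f y + g y\<bar> \<le> B + C" if "y \<in> ycube k" for y using B[OF that] C[OF that] by linarith
  ultimately show ?thesis
    using assms unfolding means_converge_def distrib_left
    by (auto intro!: tendsto_add Bochner_Integration.integrable_add)
qed

lemma means_converge_cmult:
  assumes "means_converge f" shows "means_converge (\<lambda>y. c * f y)"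
proof -
  obtain B where B: "\<And>y. y \<in> ycube k \<Longrightarrow> \<bar>f y\<bar> \<le> B"
    using assms unfolding means_converge_def by metis
  have "mean_deg (\<lambda>y. c * f y) = (\<lambda>h. c * mean_deg f h)" unfolding mean_deg_def by (simp add: mult_ac)
  moreover have "mean_lim (\<lambda>y. c * f y) = c * mean_lim f"
    unfolding mean_lim_def by (simp add: mult.left_commute[of _ c])
  moreover have "\<bar>c * f y\<bar> \<le> \<bar>c\<bar> * B" if "y \<in> ycube k" for y
    using B[OF that] by (simp add: abs_mult mult_left_mono)
  ultimately show ?thesis
    using assms unfolding means_converge_def mult.left_commute[of _ c]
    by (auto intro!: tendsto_mult_left integrable_mult_right)
qed

lemma means_converge_zero: "means_converge (\<lambda>y. 0)"
proof -
  have "mean_deg (\<lambda>y. 0) = (\<lambda>h. 0)" by (simp add: mean_deg_def fun_eq_iff)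
  then show ?thesis by (auto simp: means_converge_def mean_lim_def)
qed

lemma means_converge_sum: "(\<And>i. i \<in> I \<Longrightarrow> means_converge (f i)) \<Longrightarrow> means_converge (\<lambda>y. \<Sum>i\<in>I. f i y)"
  by (induction I rule: infinite_finite_induct) (auto intro: means_converge_zero means_converge_add)

lemma mono_x_y_lim:
  "mono_x k (y_lim s \<omega>) x = exp (- (\<Sum>l\<le>k. (real (x l) * exp (b l * s)) * Xsum k G W \<omega> l))"
  unfolding mono_x_def sum_negf[symmetric] exp_sum[OF finite_atMost]
  by (intro prod.cong refl) (auto simp: y_lim_def exp_of_nat_mult[symmetric])

text \<open>Binomial expansion of the power turns the mean into an alternating sum of Laplace
  transforms, each given by \<open>Xsum_laplace\<close>.\<close>

lemma expectation_limit_diff: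
  assumes j: "j \<le> k"
  shows "expectation (\<lambda>\<omega>. (1 - y_lim s \<omega> j) ^ n * mono_x k (y_lim s \<omega>) x) = limit_diff j n (\<lambda>l. real (x l)) s"
proof -
  let ?\<theta> = "\<lambda>c l. (real (x l) + (if l = j then real c else 0)) * exp (b l * s)"
  let ?Y = "\<lambda>c \<omega>. exp (- (\<Sum>l\<le>k. ?\<theta> c l * Xsum k G W \<omega> l))"
  have e: "(1 - y_lim s \<omega> j) ^ n * mono_x k (y_lim s \<omega>) x = alt_sum n (\<lambda>c. ?Y c \<omega>)" for \<omega>
  proof -
    have Y: "?Y c \<omega> = mono_x k (y_lim s \<omega>) x * y_lim s \<omega> j ^ c" for c
    proof -
      have "(\<Sum>l\<le>k. ?\<theta> c l * Xsum k G W \<omega> l) = (\<Sum>l\<le>k. real (x l) * exp (b l * s) * Xsum k G W \<omega> l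
          + (if l = j then real c * (exp (b l * s) * Xsum k G W \<omega> l) else 0))"
        by (intro sum.cong refl) (auto simp: algebra_simps)
      also have "\<dots> = (\<Sum>l\<le>k. real (x l) * exp (b l * s) * Xsum k G W \<omega> l) + real c * (exp (b j * s) * Xsum k G W \<omega> j)"
        using j by (simp add: sum.distrib)
      finally show ?thesis
        using j by (simp add: mono_x_y_lim y_lim_def exp_of_nat_mult[symmetric] exp_add[symmetric])
    qed
    have "(1 - y_lim s \<omega> j) ^ n = (- y_lim s \<omega> j + 1) ^ n" by simp
    also have "\<dots> = (\<Sum>c\<le>n. (-1) ^ c * real (n choose c) * y_lim s \<omega> j ^ c)"
      by (subst binomial_ring) (simp add: power_minus[of "y_lim s \<omega> j"] mult_ac)
    finally have bin: "(1 - y_lim s \<omega> j) ^ n = (\<Sum>c\<le>n. (-1) ^ c * real (n choose c) * y_lim s \<omega> j ^ c)" .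
    show ?thesis unfolding alt_sum_def Y bin by (simp add: sum_distrib_left mult_ac)
  qed
  have int: "integrable N (?Y c)" for c
  proof (rule integrable_const_bound[of _ 1])
    show "AE \<omega> in N. norm (?Y c \<omega>) \<le> 1"
      using Xsum_nonneg by (intro AE_I2) (auto intro!: sum_nonneg)
    show "?Y c \<in> borel_measurable N" using Xsum_measurable by (auto intro!: borel_measurable_sum)
  qed
  have "expectation (\<lambda>\<omega>. (1 - y_lim s \<omega> j) ^ n * mono_x k (y_lim s \<omega>) x) = alt_sum n (\<lambda>c. expectation (?Y c))"
    unfolding e alt_sum_def by (subst Bochner_Integration.integral_sum) (auto intro!: integrable_mult_right int)
  also have "\<dots> = limit_diff j n (\<lambda>l. real (x l)) s"
    unfolding limit_diff_def by (subst Xsum_laplace) auto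
  finally show ?thesis .
qed

lemma exp_wt_nonneg: "0 \<le> exp_wt s"
  using tau_pos by (simp add: exp_wt_def)

text \<open>Both means are expressed by \<open>limit_diff\<close>: the one under the degrees by
  \<open>expectation_limit\<close>, the limiting one by Fubini. Since the function is nonnegative,
  the iterated integral also settles integrability on the product.\<close>

lemma means_converge_monom:
  assumes j: "j \<le> k" and n: "\<tau> < real n"
  shows "means_converge (\<lambda>y. (1 - y j) ^ n * mono_x k y x)"
proof -
  let ?f = "\<lambda>y. (1 - y j) ^ n * mono_x k y x"
  interpret P: pair_sigma_finite lborel N ..
  have f01: "0 \<le> ?f y" "?f y \<le> 1" if "y \<in> ycube k" for y
  proof -
    have "0 \<le> mono_x k y x" "mono_x k y x \<le> 1" using that mono_x_bounds[of k y x] by (auto simp: ycube_iff)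
    moreover have "0 \<le> (1 - y j) ^ n" "(1 - y j) ^ n \<le> 1" using that j by (auto simp: ycube_iff power_le_one)
    ultimately show "0 \<le> ?f y" "?f y \<le> 1" by (auto intro: mult_le_one)
  qed
  have cont: "continuous_on (ycube k) ?f"
    by (intro continuous_intros continuous_on_mono_x continuous_on_coord)
  have fm [measurable]: "(\<lambda>z. ?f (y_lim (fst z) (snd z))) \<in> borel_measurable (lborel \<Otimes>\<^sub>M N)"
    using phi_measurable[OF cont] by (simp add: split_beta')
  have [measurable]: "exp_wt \<in> borel_measurable borel" unfolding exp_wt_def by measurable
  have fN: "(\<lambda>\<omega>. ?f (y_lim s \<omega>)) \<in> borel_measurable N" for s
    using measurable_compose[OF measurable_Pair1' fm, of s] by simp
  have intN: "integrable N (\<lambda>\<omega>. ?f (y_lim s \<omega>))" for s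
    by (rule integrable_const_bound[of _ 1]) (use f01 y_lim_ycube fN in \<open>auto intro!: AE_I2\<close>)
  have EF: "expectation (\<lambda>\<omega>. ?f (y_lim s \<omega>)) = limit_diff j n (\<lambda>l. real (x l)) s" for s
    by (rule expectation_limit_diff[OF j])
  note lim = alt_sum_integral_limit[OF j _ n, of "\<lambda>l. real (x l)"]
  have int: "integrable (lborel \<Otimes>\<^sub>M N) (\<lambda>z. exp_wt (fst z) * ?f (y_lim (fst z) (snd z)))"
  proof (rule P.Fubini_integrable)
    show "(\<lambda>z. exp_wt (fst z) * ?f (y_lim (fst z) (snd z))) \<in> borel_measurable (lborel \<Otimes>\<^sub>M N)" by measurable
    have "(LINT \<omega>|N. norm (exp_wt s * ?f (y_lim s \<omega>))) = \<tau> * exp (- (\<tau> * s)) * limit_diff j n (\<lambda>l. real (x l)) s" for s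
    proof -
      have "(LINT \<omega>|N. norm (exp_wt s * ?f (y_lim s \<omega>))) = (LINT \<omega>|N. exp_wt s * ?f (y_lim s \<omega>))"
        by (intro Bochner_Integration.integral_cong refl) (subst real_norm_def, rule abs_of_nonneg, rule mult_nonneg_nonneg[OF exp_wt_nonneg f01(1)[OF y_lim_ycube]])
      then show ?thesis using EF by (simp add: exp_wt_def)
    qed
    then show "integrable lborel (\<lambda>s. LINT \<omega>|N. norm (exp_wt (fst (s, \<omega>)) * ?f (y_lim (fst (s, \<omega>)) (snd (s, \<omega>)))))"
      using lim(2) by simp
    show "AE s in lborel. integrable N (\<lambda>\<omega>. exp_wt (fst (s, \<omega>)) * ?f (y_lim (fst (s, \<omega>)) (snd (s, \<omega>))))"
      using intN by simp
  qed
  have "mean_lim ?f = (LINT s|lborel. LINT \<omega>|N. exp_wt s * ?f (y_lim s \<omega>))"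
    unfolding mean_lim_def using P.integral_fst'[OF int] by simp
  also have "\<dots> = (LINT s|lborel. \<tau> * exp (- (\<tau> * s)) * limit_diff j n (\<lambda>l. real (x l)) s)"
    using EF by (simp add: exp_wt_def)
  finally have B: "mean_lim ?f = (LINT s|lborel. \<tau> * exp (- (\<tau> * s)) * limit_diff j n (\<lambda>l. real (x l)) s)" .
  have "mean_deg ?f = (\<lambda>h. h * measure_pmf.expectation q (\<lambda>i. (\<Prod>l\<le>k. exp (- (real (x l) * (deg_scale h l * real (i l)))))
         * (1 - exp (- (deg_scale h j * real (i j)))) ^ n))"
  proof
    fix h
    have "mono_x k (y_deg h i) x = (\<Prod>l\<le>k. exp (- (real (x l) * (deg_scale h l * real (i l)))))" for i
      unfolding mono_x_def by (intro prod.cong refl) (auto simp: y_deg_def exp_of_nat_mult[symmetric])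
    then show "mean_deg ?f h = h * measure_pmf.expectation q (\<lambda>i. (\<Prod>l\<le>k. exp (- (real (x l) * (deg_scale h l * real (i l)))))
         * (1 - exp (- (deg_scale h j * real (i j)))) ^ n)"
      unfolding mean_deg_def using j by (simp add: y_deg_def mult.commute)
  qed
  then have "(mean_deg ?f \<longlongrightarrow> mean_lim ?f) at_top"
    unfolding B using expectation_limit[OF j _ n, of "\<lambda>l. real (x l)"] by simp
  moreover have "\<exists>B. \<forall>y\<in>ycube k. \<bar>?f y\<bar> \<le> B"
    using f01 by (intro exI[of _ 1]) (auto simp: abs_le_iff intro: order_trans[of _ 0])
  ultimately show ?thesis using int by (simp add: means_converge_def)
qed

lemma means_converge_corner_poly:
  assumes n: "\<tau> < real n" and P: "P \<in> monom_span k" shows "means_converge (\<lambda>y. corner k n y * P y)"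
  using P
proof (induction rule: monom_span.induct)
  case (monom c x)
  have "(\<lambda>y. corner k n y * (c * mono_x k y x)) = (\<lambda>y. c * (\<Sum>j\<le>k. (1 - y j) ^ n * mono_x k y x))"
    unfolding corner_def sum_distrib_right[symmetric] by (simp add: mult_ac)
  moreover have "means_converge (\<lambda>y. c * (\<Sum>j\<le>k. (1 - y j) ^ n * mono_x k y x))"
    by (intro means_converge_cmult means_converge_sum means_converge_monom n) simp
  ultimately show ?case by simp
next
  case (add f g)
  then show ?case using means_converge_add[OF add.IH] by (simp add: distrib_left)
qed

lemma means_converge_corner: "\<tau> < real n \<Longrightarrow> means_converge (corner k n)"
  using means_converge_corner_poly[of n "\<lambda>y. 1 * mono_x k y (\<lambda>_. 0)", OF _ monom_span.monom] by (simp add: mono_x_def)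

text \<open>Uniform approximation would be useless against measures of unbounded total mass; here
  the error is a small multiple of \<open>corner\<close>, whose means converge and hence stay
  bounded.\<close>

lemma means_converge_of_vanishing:
  assumes \<phi>: "continuous_on (ycube k) \<phi>" and c: "0 < c"
    and van: "\<And>y. y \<in> ycube k \<Longrightarrow> (\<And>j. j \<le> k \<Longrightarrow> 1 - y j < c) \<Longrightarrow> \<phi> y = 0"
  shows "means_converge \<phi>"
proof -
  obtain n where n: "\<tau> < real n" using exists_n by blast
  have approx: "\<exists>P\<in>monom_span k. \<forall>y\<in>ycube k. \<bar>\<phi> y - corner k n y * P y\<bar> \<le> e * corner k n y" if "0 < e" for e
    by (rule approx_by_corner_poly[OF \<phi> c _ that]) (rule van)
  let ?\<rho> = "corner k n"
  have gr: "means_converge ?\<rho>" by (rule means_converge_corner[OF n])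
  have bnd: "\<exists>B. \<forall>y\<in>ycube k. \<bar>\<phi> y\<bar> \<le> B"
    using compact_imp_bounded[OF compact_continuous_image[OF \<phi> compact_ycube]] by (auto simp: bounded_iff)
  have [measurable]: "(\<lambda>z. \<phi> (y_lim (fst z) (snd z))) \<in> borel_measurable (lborel \<Otimes>\<^sub>M N)"
    using phi_measurable[OF \<phi>] by (simp add: split_beta')
  have [measurable]: "exp_wt \<in> borel_measurable borel" unfolding exp_wt_def by measurable
  have ySy: "y_lim (fst z) (snd z) \<in> ycube k" if "z \<in> space (lborel \<Otimes>\<^sub>M N)" for z
    using that y_lim_ycube by (auto simp: space_pair_measure)
  have int: "integrable (lborel \<Otimes>\<^sub>M N) (\<lambda>z. exp_wt (fst z) * \<phi> (y_lim (fst z) (snd z)))"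
  proof -
    obtain P where P: "P \<in> monom_span k" "\<And>y. y \<in> ycube k \<Longrightarrow> \<bar>\<phi> y - ?\<rho> y * P y\<bar> \<le> 1 * ?\<rho> y"
      using approx[of 1] by auto
    have i1: "integrable (lborel \<Otimes>\<^sub>M N) (\<lambda>z. exp_wt (fst z) * (?\<rho> (y_lim (fst z) (snd z)) * P (y_lim (fst z) (snd z))))"
      using means_converge_corner_poly[OF n P(1)] by (simp add: means_converge_def)
    have i2: "integrable (lborel \<Otimes>\<^sub>M N) (\<lambda>z. exp_wt (fst z) * ?\<rho> (y_lim (fst z) (snd z)))"
      using gr by (simp add: means_converge_def)
    have "integrable (lborel \<Otimes>\<^sub>M N) (\<lambda>z. exp_wt (fst z) * (\<phi> (y_lim (fst z) (snd z)) - ?\<rho> (y_lim (fst z) (snd z)) * P (y_lim (fst z) (snd z))))"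
    proof (rule Bochner_Integration.integrable_bound[OF i2])
      have "(\<lambda>z. exp_wt (fst z) * \<phi> (y_lim (fst z) (snd z)) - exp_wt (fst z) * (?\<rho> (y_lim (fst z) (snd z)) * P (y_lim (fst z) (snd z)))) \<in> borel_measurable (lborel \<Otimes>\<^sub>M N)"
        using borel_measurable_integrable[OF i1] by measurable
      then show "(\<lambda>z. exp_wt (fst z) * (\<phi> (y_lim (fst z) (snd z)) - ?\<rho> (y_lim (fst z) (snd z)) * P (y_lim (fst z) (snd z)))) \<in> borel_measurable (lborel \<Otimes>\<^sub>M N)"
        by (simp add: right_diff_distrib)
      show "AE z in (lborel \<Otimes>\<^sub>M N). norm (exp_wt (fst z) * (\<phi> (y_lim (fst z) (snd z)) - ?\<rho> (y_lim (fst z) (snd z)) * P (y_lim (fst z) (snd z))))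
          \<le> norm (exp_wt (fst z) * ?\<rho> (y_lim (fst z) (snd z)))"
        using P(2)[OF ySy] corner_nonneg[OF ySy] exp_wt_nonneg by (intro AE_I2) (simp add: abs_mult mult_left_mono)
    qed
    from Bochner_Integration.integrable_add[OF this i1] show ?thesis by (simp add: algebra_simps)
  qed
  have "(mean_deg \<phi> \<longlongrightarrow> mean_lim \<phi>) at_top"
  proof (rule tendstoI)
    fix e :: real assume e: "0 < e"
    have Br: "0 \<le> mean_lim ?\<rho>" unfolding mean_lim_def
      using exp_wt_nonneg corner_nonneg[OF ySy] by (intro integral_nonneg_AE AE_I2) auto
    \<comment> \<open>Once the mean of \<open>?\<rho>\<close> is within 1 of its limit, each of the
      two approximation errors is at most \<open>e / 4\<close>; the polynomial part contributes
      another \<open>e / 4\<close>.\<close>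
    define \<epsilon> where "\<epsilon> = e / (4 * (mean_lim ?\<rho> + 1))"
    have \<epsilon>: "0 < \<epsilon>" using e Br by (simp add: \<epsilon>_def)
    obtain P where P: "P \<in> monom_span k" "\<And>y. y \<in> ycube k \<Longrightarrow> \<bar>\<phi> y - ?\<rho> y * P y\<bar> \<le> \<epsilon> * ?\<rho> y"
      using approx[OF \<epsilon>] by auto
    let ?f = "\<lambda>y. ?\<rho> y * P y"
    have gf: "means_converge ?f" by (rule means_converge_corner_poly[OF n P(1)])
    have A: "\<bar>mean_deg \<phi> h - mean_deg ?f h\<bar> \<le> \<epsilon> * mean_deg ?\<rho> h" if "0 < h" for h
    proof -
      have i: "integrable (measure_pmf q) (\<lambda>i. \<phi> (y_deg h i))" "integrable (measure_pmf q) (\<lambda>i. ?f (y_deg h i))"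
          "integrable (measure_pmf q) (\<lambda>i. ?\<rho> (y_deg h i))"
        using integrable_mean_deg[OF bnd] integrable_mean_deg[of ?f] integrable_mean_deg[of ?\<rho>] gf gr by (auto simp: means_converge_def)
      have "mean_deg \<phi> h - mean_deg ?f h = h * measure_pmf.expectation q (\<lambda>i. \<phi> (y_deg h i) - ?f (y_deg h i))"
        unfolding mean_deg_def using i by (simp add: right_diff_distrib)
      also have "\<bar>\<dots>\<bar> \<le> h * measure_pmf.expectation q (\<lambda>i. \<epsilon> * ?\<rho> (y_deg h i))"
      proof -
        have "\<bar>measure_pmf.expectation q (\<lambda>i. \<phi> (y_deg h i) - ?f (y_deg h i))\<bar> \<le> measure_pmf.expectation q (\<lambda>i. \<bar>\<phi> (y_deg h i) - ?f (y_deg h i)\<bar>)"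
          by (rule integral_abs_bound)
        also have "\<dots> \<le> measure_pmf.expectation q (\<lambda>i. \<epsilon> * ?\<rho> (y_deg h i))"
          using i P(2)[OF y_deg_ycube] by (intro integral_mono integrable_abs Bochner_Integration.integrable_diff integrable_mult_right) auto
        finally show ?thesis using that by (simp add: abs_mult mult_left_mono)
      qed
      finally show ?thesis by (simp add: mean_deg_def mult_ac)
    qed
    have B: "\<bar>mean_lim \<phi> - mean_lim ?f\<bar> \<le> \<epsilon> * mean_lim ?\<rho>"
    proof -
      define L where "L = (lborel :: real measure) \<Otimes>\<^sub>M N"
      define A1 where "A1 z = exp_wt (fst z) * \<phi> (y_lim (fst z) (snd z))" for z
      define A2 where "A2 z = exp_wt (fst z) * ?f (y_lim (fst z) (snd z))" for z
      define A3 where "A3 z = exp_wt (fst z) * ?\<rho> (y_lim (fst z) (snd z))" for z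
      have i: "integrable L A1" "integrable L A2" "integrable L A3"
        using int gf gr by (simp_all add: means_converge_def A1_def[abs_def] A2_def[abs_def] A3_def[abs_def] L_def)
      have mean_lim: "mean_lim \<phi> = integral\<^sup>L L A1" "mean_lim ?f = integral\<^sup>L L A2" "mean_lim ?\<rho> = integral\<^sup>L L A3"
        by (simp_all add: mean_lim_def A1_def[abs_def] A2_def[abs_def] A3_def[abs_def] L_def)
      have pw: "\<bar>A1 z - A2 z\<bar> \<le> \<epsilon> * A3 z" if "z \<in> space L" for z
      proof -
        have "z \<in> space (lborel \<Otimes>\<^sub>M N)" using that by (simp add: L_def)
        from P(2)[OF ySy[OF this]]
        have "exp_wt (fst z) * \<bar>\<phi> (y_lim (fst z) (snd z)) - ?f (y_lim (fst z) (snd z))\<bar> \<le> exp_wt (fst z) * (\<epsilon> * ?\<rho> (y_lim (fst z) (snd z)))"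
          by (intro mult_left_mono exp_wt_nonneg)
        moreover have "\<bar>A1 z - A2 z\<bar> = exp_wt (fst z) * \<bar>\<phi> (y_lim (fst z) (snd z)) - ?f (y_lim (fst z) (snd z))\<bar>"
          unfolding A1_def A2_def right_diff_distrib[symmetric] abs_mult abs_of_nonneg[OF exp_wt_nonneg] ..
        ultimately show ?thesis by (simp add: A3_def mult.left_commute)
      qed
      have "\<bar>mean_lim \<phi> - mean_lim ?f\<bar> = \<bar>LINT z|L. A1 z - A2 z\<bar>"
        unfolding mean_lim Bochner_Integration.integral_diff[OF i(1,2)] ..
      also have "\<dots> \<le> (LINT z|L. \<bar>A1 z - A2 z\<bar>)" by (rule integral_abs_bound)
      also have "\<dots> \<le> (LINT z|L. \<epsilon> * A3 z)"
        by (rule integral_mono[OF integrable_abs[OF Bochner_Integration.integrable_diff[OF i(1,2)]] integrable_mult_right[OF i(3)] pw])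
      finally show ?thesis unfolding mean_lim by simp
    qed
    have lims: "(mean_deg ?\<rho> \<longlongrightarrow> mean_lim ?\<rho>) at_top" "(mean_deg ?f \<longlongrightarrow> mean_lim ?f) at_top"
      using gr gf unfolding means_converge_def by blast+
    have e1: "\<forall>\<^sub>F h in at_top. dist (mean_deg ?\<rho> h) (mean_lim ?\<rho>) < 1"
      by (rule tendstoD[OF lims(1)]) simp
    have e2: "\<forall>\<^sub>F h in at_top. dist (mean_deg ?f h) (mean_lim ?f) < e / 4"
      by (rule tendstoD[OF lims(2)]) (use e in simp)
    show "\<forall>\<^sub>F h in at_top. dist (mean_deg \<phi> h) (mean_lim \<phi>) < e"
      using e1 e2 eventually_gt_at_top[of "0::real"]
    proof eventually_elim
      case (elim h)
      have e4: "\<epsilon> * (mean_lim ?\<rho> + 1) = e / 4" using Br by (simp add: \<epsilon>_def field_simps)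
      have "\<epsilon> * mean_deg ?\<rho> h \<le> \<epsilon> * (mean_lim ?\<rho> + 1)" using elim(1) \<epsilon> by (intro mult_left_mono) (auto simp: dist_real_def)
      moreover have "\<epsilon> * mean_lim ?\<rho> \<le> \<epsilon> * (mean_lim ?\<rho> + 1)" using \<epsilon> by (intro mult_left_mono) auto
      ultimately show ?case using A[OF elim(3)] B elim(2) e4 e unfolding dist_real_def by linarith
    qed
  qed
  then show ?thesis using int bnd by (simp add: means_converge_def)
qed

end

section \<open>Vague convergence\<close>

text \<open>Inverse of the map exp(-x) from the extended half-line to [0, 1]; the first case sends 0
  to infinity.\<close>

definition neg_ln :: "real \<Rightarrow> ennreal" where
  "neg_ln y = (if y \<le> 0 then \<top> else ennreal (- ln y))"

lemma neg_ln_exp: "neg_ln (exp (- z)) = ennreal z"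
  by (simp add: neg_ln_def)

lemma continuous_on_neg_ln: "continuous_on {0..1} neg_ln"
proof (rule continuous_on_eq_continuous_within[THEN iffD2], rule ballI)
  fix y :: real assume y: "y \<in> {0..1}"
  show "continuous (at y within {0..1}) neg_ln"
  proof (cases "y = 0")
    case True
    have "(neg_ln \<longlongrightarrow> \<top>) (at 0 within {0..1})"
    proof (subst tendsto_top_iff_ennreal, intro allI impI)
      fix l :: real
      have "\<forall>\<^sub>F x in at 0 within {0..1}. x < exp (- max l 0 - 1)"
        by (rule order_tendstoD(2)[of "\<lambda>x. x" 0]) (auto intro: tendsto_ident_at)
      moreover have "\<forall>\<^sub>F x in at 0 within {0..1}. (x::real) \<in> {0..1} \<and> x \<noteq> 0"
        by (simp add: eventually_at_filter)
      ultimately show "\<forall>\<^sub>F x in at 0 within {0..1}. ennreal l < neg_ln x"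
      proof eventually_elim
        case (elim x)
        then have "0 < x" by auto
        then have "ln x < - max l 0 - 1" using elim(1) by (metis exp_less_cancel_iff exp_ln)
        then have l: "l < - ln x" "0 < - ln x" by linarith+
        show ?case using \<open>0 < x\<close> ennreal_lessI[OF l(2,1)] by (simp add: neg_ln_def)
      qed
    qed
    then show ?thesis using True by (simp add: continuous_within neg_ln_def)
  next
    case False
    then have y0: "0 < y" using y by simp
    have "((\<lambda>x. ennreal (- ln x)) \<longlongrightarrow> ennreal (- ln y)) (at y within {0..1})"
      using y0 by (intro tendsto_intros tendsto_ennrealI) auto
    moreover have "\<forall>\<^sub>F x in at y within {0..1}. ennreal (- ln x) = neg_ln x"
    proof -
      have "\<forall>\<^sub>F x in at y within {0..1}. 0 < x"
        by (rule order_tendstoD(1)[of "\<lambda>x. x" y]) (auto intro: tendsto_ident_at y0)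
      then show ?thesis by eventually_elim (simp add: neg_ln_def)
    qed
    ultimately have "(neg_ln \<longlongrightarrow> ennreal (- ln y)) (at y within {0..1})"
      by (rule Lim_transform_eventually)
    then show ?thesis using y0 by (simp add: continuous_within neg_ln_def)
  qed
qed

definition neg_ln_vec :: "nat \<Rightarrow> (nat \<Rightarrow> real) \<Rightarrow> nat \<Rightarrow> ennreal" where
  "neg_ln_vec k y = (\<lambda>i\<in>{..k}. neg_ln (y i))"

lemma neg_ln_eq_0_iff: "0 \<le> y \<Longrightarrow> y \<le> 1 \<Longrightarrow> neg_ln y = 0 \<longleftrightarrow> y = 1"
  by (auto simp: neg_ln_def ennreal_eq_0_iff ln_ge_zero_iff)

lemma neg_ln_vec_E_iff: "y \<in> ycube k \<Longrightarrow> neg_ln_vec k y \<in> topspace (E k) \<longleftrightarrow> (\<exists>j\<le>k. y j \<noteq> 1)"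
  by (auto simp: topspace_E_iff topspace_cube neg_ln_vec_def zero_less_iff_neq_zero neg_ln_eq_0_iff ycube_iff)

lemma continuous_map_neg_ln_vec: "continuous_map (top_of_set {y \<in> ycube k. \<exists>j\<le>k. y j \<noteq> 1}) (E k) (neg_ln_vec k)"
proof -
  let ?A = "{y \<in> ycube k. \<exists>j\<le>k. y j \<noteq> 1}"
  have "continuous_map (top_of_set ?A) euclidean (\<lambda>y. neg_ln (y i))" if "i \<le> k" for i
  proof -
    have "continuous_on ?A (\<lambda>y. neg_ln (y i))"
      by (rule continuous_on_compose2[OF continuous_on_neg_ln continuous_on_coord]) (use that in \<open>auto simp: ycube_iff\<close>)
    then show ?thesis by simp
  qed
  then have "continuous_map (top_of_set ?A) (cube k) (neg_ln_vec k)"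
    unfolding cube_def neg_ln_vec_def continuous_map_componentwise by auto
  moreover have "neg_ln_vec k \<in> ?A \<rightarrow> topspace (E k)" using neg_ln_vec_E_iff by auto
  ultimately show ?thesis
    unfolding E_def continuous_map_in_subtopology
    by (auto simp: E_def topspace_cube)
qed

text \<open>The origin is not a point of \<open>E k\<close> but its image, the corner, is a point of
  \<open>ycube k\<close>; a compactly supported \<open>g\<close> extends there by 0.\<close>

definition ext0 :: "nat \<Rightarrow> ((nat \<Rightarrow> ennreal) \<Rightarrow> real) \<Rightarrow> (nat \<Rightarrow> ennreal) \<Rightarrow> real" where
  "ext0 k g x = (if x \<in> topspace (E k) then g x else 0)"

lemma compact_support_away:
  assumes K: "compactin (E k) (E k closure_of {x \<in> topspace (E k). g x \<noteq> (0::real)})"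
  shows "\<exists>c>0. \<forall>x\<in>topspace (E k). (\<forall>j\<le>k. x j \<le> ennreal c) \<longrightarrow> g x = 0"
proof -
  obtain c where c: "0 < c" "\<And>x. x \<in> E k closure_of {x \<in> topspace (E k). g x \<noteq> 0} \<Longrightarrow> \<exists>j\<le>k. ennreal c < x j"
    using compactin_E_away[OF K] by blast
  have "g x = 0" if x: "x \<in> topspace (E k)" "\<forall>j\<le>k. x j \<le> ennreal c" for x
  proof (rule ccontr)
    assume "g x \<noteq> 0"
    then have "x \<in> E k closure_of {x \<in> topspace (E k). g x \<noteq> 0}"
      using x closure_of_subset[of "{x \<in> topspace (E k). g x \<noteq> 0}" "E k"] by auto
    then obtain j where "j \<le> k" "ennreal c < x j" using c(2) by blast
    then show False using x(2) by (auto simp: not_le[symmetric])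
  qed
  then show ?thesis using c(1) by blast
qed

lemma ext0_vanish:
  assumes c: "\<forall>x\<in>topspace (E k). (\<forall>j\<le>k. x j \<le> ennreal c) \<longrightarrow> g x = 0" "0 < c"
    and y: "y \<in> ycube k" "\<And>j. j \<le> k \<Longrightarrow> 1 - y j < 1 - exp (- c)"
  shows "ext0 k g (neg_ln_vec k y) = 0"
proof -
  have "neg_ln_vec k y j \<le> ennreal c" if "j \<le> k" for j
  proof -
    have "exp (- c) < y j" using y(2)[OF that] by simp
    moreover have yp: "0 < y j" using calculation exp_gt_zero[of "- c"] by linarith
    ultimately have "ln (exp (- c)) < ln (y j)" by (subst ln_less_cancel_iff) simp_all
    then have "- ln (y j) \<le> c" by simp
    then show ?thesis using yp that by (simp add: neg_ln_vec_def neg_ln_def ennreal_leI)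
  qed
  then show ?thesis using c by (simp add: ext0_def)
qed

text \<open>Two relatively open pieces cover the cube: off the corner the function is a composition
  with \<open>neg_ln_vec\<close>, and near the corner it is identically 0.\<close>

lemma continuous_on_ext0:
  assumes g: "continuous_map (E k) euclideanreal g"
    and c: "\<forall>x\<in>topspace (E k). (\<forall>j\<le>k. x j \<le> ennreal c) \<longrightarrow> g x = 0" "0 < c"
  shows "continuous_on (ycube k) (\<lambda>y. ext0 k g (neg_ln_vec k y))"
proof -
  let ?A = "{y \<in> ycube k. \<exists>j\<le>k. y j \<noteq> 1}" and ?B = "{y \<in> ycube k. \<forall>j\<le>k. exp (- c) < y j}"
  have AB: "ycube k = ?A \<union> ?B" using c(2) by (auto simp: not_less)
  have A: "openin (top_of_set (ycube k)) ?A"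
  proof -
    have o: "open (\<Union>j\<in>{..k}. {y :: nat \<Rightarrow> real. y j \<noteq> 1})"
      by (intro open_UN ballI open_Collect_neq continuous_on_coord continuous_on_const)
    have eq: "?A = ycube k \<inter> (\<Union>j\<in>{..k}. {y :: nat \<Rightarrow> real. y j \<noteq> 1})" by blast
    show ?thesis unfolding eq by (rule openin_open_Int[OF o])
  qed
  have B: "openin (top_of_set (ycube k)) ?B"
  proof -
    have o: "open (\<Inter>j\<in>{..k}. {y :: nat \<Rightarrow> real. exp (- c) < y j})"
      by (intro open_INT ballI open_Collect_less continuous_on_coord continuous_on_const) auto
    have eq: "?B = ycube k \<inter> (\<Inter>j\<in>{..k}. {y :: nat \<Rightarrow> real. exp (- c) < y j})" by blast
    show ?thesis unfolding eq by (rule openin_open_Int[OF o])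
  qed
  have cA: "continuous_on ?A (\<lambda>y. ext0 k g (neg_ln_vec k y))"
  proof -
    have "continuous_map (top_of_set ?A) euclideanreal (g \<circ> neg_ln_vec k)"
      by (rule continuous_map_compose[OF continuous_map_neg_ln_vec g])
    then have "continuous_on ?A (g \<circ> neg_ln_vec k)" by simp
    then show ?thesis
      by (rule continuous_on_eq) (use neg_ln_vec_E_iff in \<open>auto simp: ext0_def\<close>)
  qed
  have cB: "continuous_on ?B (\<lambda>y. ext0 k g (neg_ln_vec k y))"
    by (rule continuous_on_eq[OF continuous_on_const[of _ 0]]) (use ext0_vanish[OF c] in auto)
  have "continuous_on (?A \<union> ?B) (\<lambda>y. ext0 k g (neg_ln_vec k y))"
    by (rule continuous_on_Un_local_open) (use A B cA cB AB in auto)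
  then show ?thesis using AB by simp
qed

section \<open>The law of the limit vector and integrals against the limit measure\<close>

context tail_setup
begin

definition Xlaw :: "(nat \<Rightarrow> real) measure" where
  "Xlaw = restrict_space (distr N (\<Pi>\<^sub>M i\<in>{..k}. borel) (Xsum k G W)) (punctured_orthant k)"

lemma Xsum_PiM: "Xsum k G W \<in> measurable N (\<Pi>\<^sub>M i\<in>{..k}. borel)"
proof (rule measurable_PiM_single')
  show "(\<lambda>\<omega>. Xsum k G W \<omega> i) \<in> borel_measurable N" if "i \<in> {..k}" for i
    using that Xsum_measurable by simp
  show "Xsum k G W \<in> space N \<rightarrow> (\<Pi>\<^sub>E i\<in>{..k}. space borel)"
    by (auto simp: Xsum_def)
qed

lemma punctured_sets: "punctured_orthant k \<in> sets (\<Pi>\<^sub>M i\<in>{..k}. borel)"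
proof -
  have 1: "(\<Pi>\<^sub>E i\<in>{..k}. {0..}) \<in> sets (\<Pi>\<^sub>M i\<in>{..k}. borel :: real measure)"
    by (rule sets_PiM_I_finite) auto
  have "(\<Pi>\<^sub>E i\<in>{..k}. {0}) \<in> sets (\<Pi>\<^sub>M i\<in>{..k}. borel :: real measure)"
    by (rule sets_PiM_I_finite) auto
  moreover have "(\<Pi>\<^sub>E i\<in>{..k}. {0}) = {\<lambda>i\<in>{..k}. 0::real}"
    by (auto simp: PiE_iff extensional_def fun_eq_iff restrict_def)
  ultimately show ?thesis unfolding punctured_orthant_def using 1 by (intro sets.Diff) auto
qed

end

lemma continuous_map_measurable:
  assumes "continuous_map (E k) euclideanreal g" shows "g \<in> borel_measurable (borel_of (E k))"
proof (rule borel_measurableI)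
  fix S :: "real set" assume "open S"
  then have "openin (E k) {x \<in> topspace (E k). g x \<in> S}"
    by (intro openin_continuous_map_preimage[OF assms]) simp
  moreover have "g -` S \<inter> space (borel_of (E k)) = {x \<in> topspace (E k). g x \<in> S}"
    by (auto simp: space_borel_of)
  ultimately show "g -` S \<inter> space (borel_of (E k)) \<in> sets (borel_of (E k))"
    by (simp add: openin_borel_of)
qed

context tail_setup
begin

lemma Xsum_space: "\<omega> \<in> space N \<Longrightarrow> Xsum k G W \<omega> \<in> (\<Pi>\<^sub>E i\<in>{..k}. {0..})"
  using Xsum_nonneg by (auto simp: Xsum_def PiE_iff)

lemma Xsum_punctured_iff:
  "\<omega> \<in> space N \<Longrightarrow> Xsum k G W \<omega> \<in> punctured_orthant k \<longleftrightarrow> (\<exists>j\<le>k. Xsum k G W \<omega> j \<noteq> 0)"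
  using Xsum_space[of \<omega>] unfolding punctured_orthant_def
  by (auto simp: fun_eq_iff PiE_iff extensional_def restrict_def)

lemma space_Xlaw: "space Xlaw = punctured_orthant k"
  unfolding Xlaw_def space_restrict_space punctured_orthant_def by (auto simp: space_PiM)

lemma punctured_Int: "punctured_orthant k \<inter> space (distr N (\<Pi>\<^sub>M i\<in>{..k}. borel) (Xsum k G W)) \<in> sets (distr N (\<Pi>\<^sub>M i\<in>{..k}. borel) (Xsum k G W))"
  unfolding sets_distr space_distr by (rule sets.Int[OF punctured_sets sets.top])

lemma sigma_finite_Xlaw: "sigma_finite_measure Xlaw"
proof -
  interpret D: prob_space "distr N (\<Pi>\<^sub>M i\<in>{..k}. borel) (Xsum k G W)"
    by (rule prob_space_distr[OF Xsum_PiM])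
  have "sigma_finite_measure (distr N (\<Pi>\<^sub>M i\<in>{..k}. borel) (Xsum k G W))"
    by (rule D.sigma_finite_measure_axioms)
  then show ?thesis
    unfolding Xlaw_def by (rule sigma_finite_measure_restrict_space) (simp only: sets_distr punctured_sets)
qed

lemma nn_integral_Xlaw:
  assumes f: "f \<in> borel_measurable Xlaw"
  shows "(\<integral>\<^sup>+y. f y \<partial>Xlaw) = (\<integral>\<^sup>+\<omega>. f (Xsum k G W \<omega>) * indicator (punctured_orthant k) (Xsum k G W \<omega>) \<partial>N)"
proof -
  let ?D = "distr N (\<Pi>\<^sub>M i\<in>{..k}. borel) (Xsum k G W)"
  have fm: "(\<lambda>y. f y * indicator (punctured_orthant k) y) \<in> borel_measurable ?D"
    using f unfolding Xlaw_def by (subst (asm) borel_measurable_restrict_space_iff_ennreal[OF punctured_Int])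
  have "(\<integral>\<^sup>+y. f y \<partial>Xlaw) = (\<integral>\<^sup>+y. f y * indicator (punctured_orthant k) y \<partial>?D)"
    unfolding Xlaw_def by (rule nn_integral_restrict_space[OF punctured_Int])
  also have "\<dots> = (\<integral>\<^sup>+\<omega>. f (Xsum k G W \<omega>) * indicator (punctured_orthant k) (Xsum k G W \<omega>) \<partial>N)"
    by (rule nn_integral_distr[OF Xsum_PiM]) (use fm in simp)
  finally show ?thesis .
qed

lemma Xlaw_coord: "i \<le> k \<Longrightarrow> (\<lambda>y. y i) \<in> borel_measurable Xlaw"
  unfolding Xlaw_def
  by (rule measurable_restrict_space1) (simp add: measurable_component_singleton)

lemma exp_powr_b: "exp (b 0 * s) powr (b i / b 0) = exp (b i * s)"
  using b_pos[of 0] by (simp add: powr_def)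

lemma chi_neg_ln_vec: "chi k \<delta> (exp (b 0 * s), Xsum k G W \<omega>) = neg_ln_vec k (y_lim s \<omega>)"
  unfolding chi_def neg_ln_vec_def by (auto simp: y_lim_def neg_ln_exp exp_powr_b fun_eq_iff)

lemma neg_ln_vec_y_lim_E_iff:
  assumes "\<omega> \<in> space N"
  shows "neg_ln_vec k (y_lim s \<omega>) \<in> topspace (E k) \<longleftrightarrow> Xsum k G W \<omega> \<in> punctured_orthant k"
  unfolding neg_ln_vec_E_iff[OF y_lim_ycube[OF assms]] Xsum_punctured_iff[OF assms] by (auto simp: y_lim_def)

lemma measurable_chi:
  assumes \<nu>: "sets \<nu> = sets (restrict_space borel {0::real<..})"
  shows "chi k \<delta> \<in> measurable (\<nu> \<Otimes>\<^sub>M Xlaw) (borel_of (E k))"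
proof (rule measurable_E)
  have sp: "space \<nu> = {0<..}" using sets_eq_imp_space_eq[OF \<nu>] by (simp add: space_restrict_space)
  have "(\<lambda>z. ennreal (fst z powr (b i / b 0) * snd z i)) \<in> borel_measurable (\<nu> \<Otimes>\<^sub>M Xlaw)" if "i \<le> k" for i
  proof -
    have "(\<lambda>x. x) \<in> borel_measurable (restrict_space borel {0::real<..})" by (rule measurable_restrict_space1) simp
    then have "(\<lambda>x. x) \<in> borel_measurable \<nu>" using measurable_cong_sets[OF \<nu> refl] by blast
    then have [measurable]: "fst \<in> borel_measurable (\<nu> \<Otimes>\<^sub>M Xlaw)"
      using measurable_compose[OF measurable_fst[of \<nu> Xlaw]] by simp
    have [measurable]: "(\<lambda>z. snd z i) \<in> borel_measurable (\<nu> \<Otimes>\<^sub>M Xlaw)"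
      by (rule measurable_compose[OF measurable_snd Xlaw_coord[OF that]])
    show ?thesis by measurable
  qed
  then have "(\<lambda>z. \<lambda>i\<in>{..k}. ennreal (fst z powr (b i / b 0) * snd z i)) \<in> measurable (\<nu> \<Otimes>\<^sub>M Xlaw) (borel_of (cube k))"
    by (rule measurable_cube)
  moreover have "chi k \<delta> = (\<lambda>z. \<lambda>i\<in>{..k}. ennreal (fst z powr (b i / b 0) * snd z i))"
    by (auto simp: chi_def fun_eq_iff)
  ultimately show "chi k \<delta> \<in> measurable (\<nu> \<Otimes>\<^sub>M Xlaw) (borel_of (cube k))" by simp
  fix z assume "z \<in> space (\<nu> \<Otimes>\<^sub>M Xlaw)"
  then obtain x y where z: "z = (x, y)" "0 < x" "y \<in> punctured_orthant k"
    by (auto simp: space_pair_measure sp space_Xlaw)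
  have "\<exists>j\<le>k. y j \<noteq> 0"
  proof (rule ccontr)
    assume "\<not> (\<exists>j\<le>k. y j \<noteq> 0)"
    moreover have "y \<in> extensional {..k}" using z(3) by (simp add: punctured_orthant_def PiE_iff)
    ultimately have "y = (\<lambda>i\<in>{..k}. 0)" by (intro ext) (auto simp: extensional_def)
    then show False using z(3) by (simp add: punctured_orthant_def)
  qed
  then obtain j where j: "j \<le> k" "y j \<noteq> 0" by blast
  moreover have "0 \<le> y j" using z(3) j(1) by (simp add: punctured_orthant_def PiE_iff)
  ultimately have "0 < chi k \<delta> z j" using z(1,2) by (simp add: chi_def)
  moreover have "chi k \<delta> z \<in> topspace (cube k)" by (simp add: z(1) chi_def topspace_cube)
  ultimately show "chi k \<delta> z \<in> topspace (E k)" using j(1) unfolding topspace_E_iff by blast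
qed

context
  fixes \<nu> :: "real measure"
  assumes \<nu>: "sets \<nu> = sets (restrict_space borel {0<..})"
    and \<nu>_tail: "\<And>x. 0 < x \<Longrightarrow> emeasure \<nu> {x<..} = ennreal (x powr (- (\<tau> / b 0)))"
begin

lemma m_tail_eq: "m_tail k \<delta> \<nu> N G W = distr (\<nu> \<Otimes>\<^sub>M Xlaw) (borel_of (E k)) (chi k \<delta>)"
  by (simp add: m_tail_def Xlaw_def)

text \<open>The inner integral at a fixed radial coordinate. Isolating it allows the outer integral
  to be taken in \<open>s\<close> for the convergence and in \<open>u\<close> for the boxes.\<close>

definition cond_int :: "((nat \<Rightarrow> ennreal) \<Rightarrow> ennreal) \<Rightarrow> real \<Rightarrow> ennreal" where
  "cond_int f x = (\<integral>\<^sup>+\<omega>. f (chi k \<delta> (x, Xsum k G W \<omega>)) * indicator (punctured_orthant k) (Xsum k G W \<omega>) \<partial>N)"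

lemma nn_integral_m_tail:
  assumes f: "f \<in> borel_measurable (borel_of (E k))"
  shows "(\<integral>\<^sup>+x. f x \<partial>m_tail k \<delta> \<nu> N G W) = (\<integral>\<^sup>+x. cond_int f x \<partial>\<nu>)"
    and "cond_int f \<in> borel_measurable (restrict_space borel {0<..})"
proof -
  interpret L: sigma_finite_measure Xlaw by (rule sigma_finite_Xlaw)
  have fc: "(\<lambda>z. f (chi k \<delta> z)) \<in> borel_measurable (\<nu> \<Otimes>\<^sub>M Xlaw)"
    by (rule measurable_compose[OF measurable_chi[OF \<nu>] f])
  have sp: "space \<nu> = {0<..}" using sets_eq_imp_space_eq[OF \<nu>] by (simp add: space_restrict_space)
  have in_eq: "(\<integral>\<^sup>+y. f (chi k \<delta> (x, y)) \<partial>Xlaw) = cond_int f x" if "x \<in> space \<nu>" for x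
    unfolding cond_int_def
    by (rule nn_integral_Xlaw) (rule measurable_compose[OF measurable_Pair1'[OF that] fc])
  have "(\<integral>\<^sup>+x. f x \<partial>m_tail k \<delta> \<nu> N G W) = (\<integral>\<^sup>+z. f (chi k \<delta> z) \<partial>(\<nu> \<Otimes>\<^sub>M Xlaw))"
    unfolding m_tail_eq by (rule nn_integral_distr[OF measurable_chi[OF \<nu>]]) (use f in simp)
  also have "\<dots> = (\<integral>\<^sup>+x. (\<integral>\<^sup>+y. f (chi k \<delta> (x, y)) \<partial>Xlaw) \<partial>\<nu>)"
    by (rule L.nn_integral_fst[OF fc, symmetric])
  also have "\<dots> = (\<integral>\<^sup>+x. cond_int f x \<partial>\<nu>)" by (rule nn_integral_cong) (rule in_eq)
  finally show "(\<integral>\<^sup>+x. f x \<partial>m_tail k \<delta> \<nu> N G W) = (\<integral>\<^sup>+x. cond_int f x \<partial>\<nu>)" .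
  have "(\<lambda>x. \<integral>\<^sup>+y. f (chi k \<delta> (x, y)) \<partial>Xlaw) \<in> borel_measurable \<nu>"
    by (rule L.borel_measurable_nn_integral_fst[OF fc])
  then have "cond_int f \<in> borel_measurable \<nu>"
    by (subst measurable_cong[of \<nu> "cond_int f"]) (auto simp: in_eq)
  then show "cond_int f \<in> borel_measurable (restrict_space borel {0<..})"
    using measurable_cong_sets[OF \<nu> refl] by blast
qed

lemma nn_integral_m_tail_s:
  assumes f: "f \<in> borel_measurable (borel_of (E k))"
  shows "(\<integral>\<^sup>+x. f x \<partial>m_tail k \<delta> \<nu> N G W)
    = (\<integral>\<^sup>+s. ennreal (exp_wt s) * (\<integral>\<^sup>+\<omega>. (if neg_ln_vec k (y_lim s \<omega>) \<in> topspace (E k) then f (neg_ln_vec k (y_lim s \<omega>)) else 0) \<partial>N) \<partial>lborel)"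
proof -
  have 1: "cond_int f (exp (b 0 * s)) = (\<integral>\<^sup>+\<omega>. (if neg_ln_vec k (y_lim s \<omega>) \<in> topspace (E k) then f (neg_ln_vec k (y_lim s \<omega>)) else 0) \<partial>N)" for s
    unfolding cond_int_def
    by (rule nn_integral_cong) (simp add: chi_neg_ln_vec neg_ln_vec_y_lim_E_iff indicator_def)
  have "(\<integral>\<^sup>+x. cond_int f x \<partial>\<nu>) = (\<integral>\<^sup>+s. ennreal (\<tau> * exp (- (\<tau> * s))) * cond_int f (exp (b 0 * s)) \<partial>lborel)"
    by (rule nn_integral_nu_exp[OF \<nu> \<nu>_tail nn_integral_m_tail(2)[OF f]])
  then show ?thesis unfolding nn_integral_m_tail(1)[OF f] 1 exp_wt_def .
qed

text \<open>Links the Bochner integrals of the approximation argument with the nonnegative integrals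
  in the definition of vague convergence.\<close>

lemma mean_lim_nn:
  assumes \<phi>: "means_converge \<phi>" "\<And>y. y \<in> ycube k \<Longrightarrow> 0 \<le> \<phi> y"
  shows "(\<integral>\<^sup>+s. ennreal (exp_wt s) * (\<integral>\<^sup>+\<omega>. ennreal (\<phi> (y_lim s \<omega>)) \<partial>N) \<partial>lborel) = ennreal (mean_lim \<phi>)" "0 \<le> mean_lim \<phi>"
proof -
  define F where "F = (\<lambda>z. exp_wt (fst z) * \<phi> (y_lim (fst z) (snd z)))"
  have int: "integrable (lborel \<Otimes>\<^sub>M N) F" using \<phi>(1) by (simp add: means_converge_def F_def)
  then have Fm: "F \<in> borel_measurable (lborel \<Otimes>\<^sub>M N)" by (rule borel_measurable_integrable)
  have F0: "0 \<le> F z" if "z \<in> space (lborel \<Otimes>\<^sub>M N)" for z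
    using that \<phi>(2)[OF y_lim_ycube] exp_wt_nonneg by (auto simp: F_def space_pair_measure)
  have "ennreal (mean_lim \<phi>) = (\<integral>\<^sup>+z. ennreal (F z) \<partial>(lborel \<Otimes>\<^sub>M N))"
    unfolding mean_lim_def F_def[symmetric]
    by (rule nn_integral_eq_integral[OF int, symmetric]) (use F0 in \<open>intro AE_I2\<close>)
  also have "\<dots> = (\<integral>\<^sup>+s. (\<integral>\<^sup>+\<omega>. ennreal (F (s, \<omega>)) \<partial>N) \<partial>lborel)"
    by (rule nn_integral_fst[symmetric]) (use Fm in measurable)
  also have "\<dots> = (\<integral>\<^sup>+s. ennreal (exp_wt s) * (\<integral>\<^sup>+\<omega>. ennreal (\<phi> (y_lim s \<omega>)) \<partial>N) \<partial>lborel)"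
  proof (rule nn_integral_cong)
    fix s :: real
    have w: "0 < exp_wt s" using tau_pos by (simp add: exp_wt_def)
    have "(\<lambda>\<omega>. F (s, \<omega>)) \<in> borel_measurable N"
      using measurable_compose[OF measurable_Pair1' Fm, of s] by simp
    then have "(\<lambda>\<omega>. F (s, \<omega>) / exp_wt s) \<in> borel_measurable N" by measurable
    then have m: "(\<lambda>\<omega>. \<phi> (y_lim s \<omega>)) \<in> borel_measurable N" using w by (simp add: F_def)
    have "(\<integral>\<^sup>+\<omega>. ennreal (F (s, \<omega>)) \<partial>N) = (\<integral>\<^sup>+\<omega>. ennreal (exp_wt s) * ennreal (\<phi> (y_lim s \<omega>)) \<partial>N)"
      by (rule nn_integral_cong) (simp add: F_def ennreal_mult'[OF exp_wt_nonneg])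
    also have "\<dots> = ennreal (exp_wt s) * (\<integral>\<^sup>+\<omega>. ennreal (\<phi> (y_lim s \<omega>)) \<partial>N)"
      by (rule nn_integral_cmult) (use m in measurable)
    finally show "(\<integral>\<^sup>+\<omega>. ennreal (F (s, \<omega>)) \<partial>N) = ennreal (exp_wt s) * (\<integral>\<^sup>+\<omega>. ennreal (\<phi> (y_lim s \<omega>)) \<partial>N)" .
  qed
  finally show "(\<integral>\<^sup>+s. ennreal (exp_wt s) * (\<integral>\<^sup>+\<omega>. ennreal (\<phi> (y_lim s \<omega>)) \<partial>N) \<partial>lborel) = ennreal (mean_lim \<phi>)" ..
  show "0 \<le> mean_lim \<phi>" unfolding mean_lim_def F_def[symmetric] by (rule integral_nonneg_AE) (use F0 in \<open>intro AE_I2\<close>)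
qed

text \<open>On a compact set some coordinate exceeds \<open>c\<close>, so \<open>corner\<close> is
  at least \<open>(1 - exp (- c)) ^ n\<close> there; the mass is then at most a multiple of the
  finite limiting mean of \<open>corner\<close>.\<close>

lemma radon_m_tail: "radon_measure_on (E k) (m_tail k \<delta> \<nu> N G W)"
  unfolding radon_measure_on_def
proof (intro conjI allI impI)
  show "sets (m_tail k \<delta> \<nu> N G W) = sets (borel_of (E k))" by (simp add: m_tail_def)
  fix K assume K: "compactin (E k) K"
  obtain c where c: "0 < c" "\<And>x. x \<in> K \<Longrightarrow> \<exists>j\<le>k. ennreal c < x j"
    using compactin_E_away[OF K] by blast
  define U where "U = {x \<in> topspace (E k). \<exists>j\<le>k. ennreal c < x j}"
  have Us: "U \<in> sets (borel_of (E k))"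
    unfolding U_def by (rule openin_borel_of[OF openin_coordinate_gt])
  have KU: "K \<subseteq> U" using c(2) compactin_subset_topspace[OF K] by (auto simp: U_def)
  obtain n where n: "\<tau> < real n" using exists_n by blast
  define a where "a = (1 - exp (- c)) ^ n"
  have a: "0 < a" using c by (simp add: a_def)
  have g: "means_converge (\<lambda>y. (1 / a) * corner k n y)" by (rule means_converge_cmult[OF means_converge_corner[OF n]])
  have le: "(if neg_ln_vec k y \<in> topspace (E k) then indicator U (neg_ln_vec k y) else 0) \<le> ennreal ((1 / a) * corner k n y)" if y: "y \<in> ycube k" for y
  proof (cases "neg_ln_vec k y \<in> U")
    case True
    then obtain j where j: "j \<le> k" "ennreal c < neg_ln (y j)" by (auto simp: U_def neg_ln_vec_def)
    have yj: "0 \<le> y j" "y j \<le> 1" using y j by (auto simp: ycube_iff)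
    have "1 - exp (- c) \<le> 1 - y j"
    proof (cases "y j = 0")
      case False
      then have "0 < y j" using yj by simp
      then have "ennreal c < ennreal (- ln (y j))" using j by (simp add: neg_ln_def)
      then have "c < - ln (y j)" using c by (simp add: ennreal_less_iff)
      then have "ln (y j) < - c" by simp
      then have "y j < exp (- c)" using \<open>0 < y j\<close> by (metis exp_less_cancel_iff exp_ln)
      then show ?thesis by simp
    qed simp
    then have "a \<le> (1 - y j) ^ n" unfolding a_def using c by (intro power_mono) auto
    also have "\<dots> \<le> corner k n y"
      unfolding corner_def by (rule member_le_sum[where f = "\<lambda>j. (1 - y j) ^ n"]) (use y j in \<open>auto simp: ycube_iff\<close>)
    finally have "1 \<le> (1 / a) * corner k n y" using a by (simp add: field_simps)
    then have "ennreal 1 \<le> ennreal ((1 / a) * corner k n y)" by (rule ennreal_leI)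
    then show ?thesis by (auto simp: indicator_def)
  next
    case False
    then show ?thesis by simp
  qed
  have "emeasure (m_tail k \<delta> \<nu> N G W) K \<le> emeasure (m_tail k \<delta> \<nu> N G W) U"
    by (rule emeasure_mono[OF KU]) (use Us in \<open>simp add: m_tail_def\<close>)
  also have "\<dots> = (\<integral>\<^sup>+x. indicator U x \<partial>m_tail k \<delta> \<nu> N G W)"
    by (rule nn_integral_indicator[symmetric]) (use Us in \<open>simp add: m_tail_def\<close>)
  also have "\<dots> = (\<integral>\<^sup>+s. ennreal (exp_wt s) * (\<integral>\<^sup>+\<omega>. (if neg_ln_vec k (y_lim s \<omega>) \<in> topspace (E k) then indicator U (neg_ln_vec k (y_lim s \<omega>)) else 0) \<partial>N) \<partial>lborel)"
    by (rule nn_integral_m_tail_s) (use Us in measurable)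
  also have "\<dots> \<le> (\<integral>\<^sup>+s. ennreal (exp_wt s) * (\<integral>\<^sup>+\<omega>. ennreal ((1 / a) * corner k n (y_lim s \<omega>)) \<partial>N) \<partial>lborel)"
    by (intro nn_integral_mono mult_left_mono le y_lim_ycube) auto
  also have "\<dots> = ennreal (mean_lim (\<lambda>y. (1 / a) * corner k n y))"
    by (rule mean_lim_nn(1)[OF g]) (use a corner_nonneg in auto)
  also have "\<dots> < \<infinity>" by simp
  finally show "emeasure (m_tail k \<delta> \<nu> N G W) K < \<infinity>" .
qed

lemma nn_integral_m_tail_g:
  assumes g: "continuous_map (E k) euclideanreal g" "\<And>x. x \<in> topspace (E k) \<Longrightarrow> 0 \<le> g x"
    and means_converge: "means_converge (\<lambda>y. ext0 k g (neg_ln_vec k y))"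
  shows "(\<integral>\<^sup>+x. ennreal (g x) \<partial>m_tail k \<delta> \<nu> N G W) = ennreal (mean_lim (\<lambda>y. ext0 k g (neg_ln_vec k y)))"
proof -
  have m: "(\<lambda>x. ennreal (g x)) \<in> borel_measurable (borel_of (E k))"
    using continuous_map_measurable[OF g(1)] by measurable
  have "(\<integral>\<^sup>+x. ennreal (g x) \<partial>m_tail k \<delta> \<nu> N G W)
    = (\<integral>\<^sup>+s. ennreal (exp_wt s) * (\<integral>\<^sup>+\<omega>. ennreal (ext0 k g (neg_ln_vec k (y_lim s \<omega>))) \<partial>N) \<partial>lborel)"
    unfolding nn_integral_m_tail_s[OF m]
    by (intro nn_integral_cong arg_cong2[where f = "(*)"] refl) (simp add: ext0_def)
  also have "\<dots> = ennreal (mean_lim (\<lambda>y. ext0 k g (neg_ln_vec k y)))"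
    by (rule mean_lim_nn(1)[OF means_converge]) (use g(2) in \<open>simp add: ext0_def\<close>)
  finally show ?thesis .
qed

text \<open>A point of the box has a positive coordinate 0, so the box is an open set avoiding the
  origin and the indicator of the punctured orthant is automatically 1 on it.\<close>

lemma m_tail_box:
  fixes x :: "nat \<Rightarrow> real"
  assumes x: "\<forall>i\<le>k. 0 \<le> x i"
  shows "emeasure (m_tail k \<delta> \<nu> N G W) (\<Pi>\<^sub>E i\<in>{..k}. {ennreal (x i)<..})
          = ennreal (\<tau> / b 0)
            * (\<integral>\<^sup>+u\<in>{0<..}. ennreal
                 (measure N {\<omega> \<in> space N. \<forall>i\<le>k.
                     (\<Sum>m\<le>k. Xvec G W m i \<omega>) > x i / u powr (b i / b 0)}
                  * u powr (- (1 + \<tau> / b 0))) \<partial>lborel)"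
proof -
  define B where "B = (\<Pi>\<^sub>E i\<in>{..k}. {ennreal (x i)<..})"
  define S where "S u = {\<omega> \<in> space N. \<forall>i\<le>k. (\<Sum>m\<le>k. Xvec G W m i \<omega>) > x i / u powr (b i / b 0)}" for u
  have Bset: "B \<in> sets (borel_of (E k))"
  proof -
    have "openin (cube k) B"
      unfolding cube_def B_def by (subst openin_PiE) auto
    moreover have "B \<subseteq> topspace (E k)"
      by (auto simp: B_def topspace_E_iff topspace_cube PiE_iff intro!: exI[of _ 0] order_le_less_trans[OF zero_le])
    ultimately have "openin (E k) B"
      unfolding E_def openin_subtopology topspace_E[unfolded E_def] by (intro exI[of _ B]) (auto simp: topspace_cube E_def)
    then show ?thesis by (rule openin_borel_of)
  qed
  have m: "indicator B \<in> borel_measurable (borel_of (E k))" using Bset by measurable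
  have inn: "cond_int (indicator B) u = ennreal (measure N (S u))" if u: "0 < u" for u
  proof -
    have iff: "chi k \<delta> (u, Xsum k G W \<omega>) \<in> B \<and> Xsum k G W \<omega> \<in> punctured_orthant k \<longleftrightarrow> \<omega> \<in> S u" if \<omega>: "\<omega> \<in> space N" for \<omega>
    proof -
      have up: "0 < u powr (b i / b 0)" for i using u by simp
      have "chi k \<delta> (u, Xsum k G W \<omega>) \<in> B \<longleftrightarrow> (\<forall>i\<le>k. x i < u powr (b i / b 0) * Xsum k G W \<omega> i)"
        using x by (auto simp: B_def chi_def PiE_iff ennreal_less_iff)
      also have "\<dots> \<longleftrightarrow> \<omega> \<in> S u"
        using \<omega> up by (auto simp: S_def Xsum_def pos_divide_less_eq mult.commute)
      finally have 1: "chi k \<delta> (u, Xsum k G W \<omega>) \<in> B \<longleftrightarrow> \<omega> \<in> S u" .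
      have "Xsum k G W \<omega> \<in> punctured_orthant k" if "\<omega> \<in> S u"
      proof -
        have "x 0 / u powr (b 0 / b 0) < Xsum k G W \<omega> 0" using that by (auto simp: S_def Xsum_def)
        moreover have "0 \<le> x 0 / u powr (b 0 / b 0)" using x by simp
        ultimately have "Xsum k G W \<omega> 0 \<noteq> 0" by linarith
        then show ?thesis unfolding Xsum_punctured_iff[OF \<omega>] by blast
      qed
      then show ?thesis using 1 by blast
    qed
    have Xs: "(\<lambda>\<omega>. \<Sum>m\<le>k. Xvec G W m i \<omega>) \<in> borel_measurable N" for i
      using X_measurable_N by (intro borel_measurable_sum) auto
    have Sm: "S u \<in> sets N"
    proof -
      have "S u = (\<Inter>i\<in>{..k}. {\<omega> \<in> space N. (\<Sum>m\<le>k. Xvec G W m i \<omega>) > x i / u powr (b i / b 0)})" by (auto simp: S_def)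
      also have "\<dots> \<in> sets N"
        by (intro sets.finite_INT) (use Xs in \<open>auto intro!: borel_measurable_less\<close>)
      finally show ?thesis .
    qed
    have "cond_int (indicator B) u = (\<integral>\<^sup>+\<omega>. indicator (S u) \<omega> \<partial>N)"
      unfolding cond_int_def
    proof (rule nn_integral_cong)
      fix \<omega> assume w: "\<omega> \<in> space N"
      show "indicator B (chi k \<delta> (u, Xsum k G W \<omega>)) * indicator (punctured_orthant k) (Xsum k G W \<omega>) = (indicator (S u) \<omega> :: ennreal)"
        using iff[OF w] by (auto simp: indicator_def)
    qed
    also have "\<dots> = emeasure N (S u)" using Sm by simp
    finally show ?thesis by (simp add: emeasure_eq_measure)
  qed
  have "emeasure (m_tail k \<delta> \<nu> N G W) B = (\<integral>\<^sup>+x. indicator B x \<partial>m_tail k \<delta> \<nu> N G W)"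
    by (rule nn_integral_indicator[symmetric]) (use Bset in \<open>simp add: m_tail_def\<close>)
  also have "\<dots> = (\<integral>\<^sup>+u. cond_int (indicator B) u \<partial>\<nu>)" by (rule nn_integral_m_tail(1)[OF m])
  also have "\<dots> = ennreal (\<tau> / b 0) * (\<integral>\<^sup>+u\<in>{0<..}. cond_int (indicator B) u * ennreal (u powr (- (1 + \<tau> / b 0))) \<partial>lborel)"
  proof (rule nn_integral_nu_density[OF \<nu> \<nu>_tail])
    show "(\<lambda>u. cond_int (indicator B) u * indicator {0<..} u) \<in> borel_measurable borel"
      using nn_integral_m_tail(2)[OF m] by (subst (asm) borel_measurable_restrict_space_iff_ennreal) auto
  qed
  also have "(\<integral>\<^sup>+u\<in>{0<..}. cond_int (indicator B) u * ennreal (u powr (- (1 + \<tau> / b 0))) \<partial>lborel)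
     = (\<integral>\<^sup>+u\<in>{0<..}. ennreal (measure N (S u) * u powr (- (1 + \<tau> / b 0))) \<partial>lborel)"
    by (rule nn_integral_cong) (auto simp: indicator_def inn ennreal_mult')
  finally show ?thesis unfolding B_def S_def .
qed

end

end

section \<open>The degree vector as a discrete random variable, and the conclusion\<close>

definition zero_ext :: "nat \<Rightarrow> (nat \<Rightarrow> 'a \<Rightarrow> nat) \<Rightarrow> 'a \<Rightarrow> nat \<Rightarrow> nat" where
  "zero_ext k D \<omega> = (\<lambda>l. if l \<le> k then D l \<omega> else 0)"

lemma countable_zero_ext: "countable {i :: nat \<Rightarrow> nat. \<forall>l>k. i l = 0}"
proof -
  have "countable (\<Pi>\<^sub>E l\<in>{..k}. (UNIV :: nat set))" by (intro countable_PiE) auto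
  then have "countable ((\<lambda>f l. if l \<le> k then f l else 0) ` (\<Pi>\<^sub>E l\<in>{..k}. (UNIV :: nat set)))"
    by (rule countable_image)
  moreover have "{i :: nat \<Rightarrow> nat. \<forall>l>k. i l = 0} \<subseteq> (\<lambda>f l. if l \<le> k then f l else 0) ` (\<Pi>\<^sub>E l\<in>{..k}. (UNIV :: nat set))"
  proof
    fix i :: "nat \<Rightarrow> nat" assume "i \<in> {i. \<forall>l>k. i l = 0}"
    then have "i = (\<lambda>l. if l \<le> k then restrict i {..k} l else 0)" by (auto simp: fun_eq_iff)
    then show "i \<in> (\<lambda>f l. if l \<le> k then f l else 0) ` (\<Pi>\<^sub>E l\<in>{..k}. (UNIV :: nat set))"
      by (rule image_eqI[where x = "restrict i {..k}"]) auto
  qed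
  ultimately show ?thesis by (rule countable_subset[rotated])
qed

lemma measurable_zero_ext:
  assumes D: "\<And>m. m \<le> k \<Longrightarrow> D m \<in> measurable M (count_space UNIV)"
  shows "zero_ext k D \<in> measurable M (count_space UNIV)"
proof -
  let ?A = "{i :: nat \<Rightarrow> nat. \<forall>l>k. i l = 0}"
  have "zero_ext k D -` {i} \<inter> space M \<in> sets M" if i: "i \<in> ?A" for i
  proof -
    have "zero_ext k D -` {i} \<inter> space M = space M \<inter> (\<Inter>l\<in>{..k}. D l -` {i l} \<inter> space M)"
      using i by (auto simp: zero_ext_def fun_eq_iff)
    also have "\<dots> \<in> sets M"
      using D by (intro sets.Int sets.top sets.finite_INT measurable_sets[where A = "count_space UNIV"]) auto
    finally show ?thesis .
  qed
  moreover have "zero_ext k D \<in> space M \<rightarrow> ?A" by (auto simp: zero_ext_def)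
  ultimately have "zero_ext k D \<in> measurable M (count_space ?A)"
    by (simp add: measurable_count_space_eq_countable[OF countable_zero_ext])
  from measurable_compose[OF this, of "\<lambda>x. x" "count_space UNIV"] show ?thesis by simp
qed

text \<open>The extended vector takes values in a countable set, so its law is carried by
  atoms.\<close>

lemma exists_pmf:
  assumes M: "prob_space M" and D: "\<And>m. m \<le> k \<Longrightarrow> D m \<in> measurable M (count_space UNIV)"
  shows "\<exists>q. measure_pmf q = distr M (count_space UNIV) (zero_ext k D)"
proof -
  let ?P = "distr M (count_space UNIV) (zero_ext k D)"
  have m: "zero_ext k D \<in> measurable M (count_space UNIV)" by (rule measurable_zero_ext) (rule D)
  interpret M: prob_space M by (rule M)
  interpret P: prob_space ?P by (rule M.prob_space_distr[OF m])
  have sU: "sets ?P = UNIV" by simp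
  have "zero_ext k D \<omega> \<in> {i. \<forall>l>k. i l = 0}" for \<omega> by (simp add: zero_ext_def)
  then have "AE x in ?P. x \<in> {i. \<forall>l>k. i l = 0}"
    by (subst AE_distr_iff[OF m]) (simp_all add: zero_ext_def)
  then have "AE x in ?P. measure ?P {x} \<noteq> 0"
    unfolding P.AE_support_countable[OF sU] using countable_zero_ext[of k] by blast
  then have "?P \<in> {M. prob_space M \<and> sets M = UNIV \<and> (AE x in M. measure M {x} \<noteq> 0)}"
    using P.prob_space_axioms sU by blast
  then have "measure_pmf (Abs_pmf ?P) = ?P" by (rule Abs_pmf_inverse)
  then show ?thesis by blast
qed

context tail_setup
begin

context
  fixes M :: "'a measure" and D :: "nat \<Rightarrow> 'a \<Rightarrow> nat"
  assumes M: "prob_space M" and D: "\<And>m. m \<le> k \<Longrightarrow> D m \<in> measurable M (count_space UNIV)"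
    and qD: "measure_pmf q = distr M (count_space UNIV) (zero_ext k D)"
begin

definition scaled_deg :: "real \<Rightarrow> 'a \<Rightarrow> nat \<Rightarrow> ennreal" where
  "scaled_deg h \<omega> = (\<lambda>m\<in>{..k}. ennreal (real (D m \<omega>) / h powr (b m / \<tau>)))"

lemma scaled_Xlaw_eq: "scaled_law k \<delta> M D h = scale_measure (ennreal h)
    (restrict_space (distr M (borel_of (cube k)) (scaled_deg h)) (topspace (E k)))"
  unfolding scaled_law_def scaled_deg_def[abs_def] ..

lemma scaled_deg_measurable: "scaled_deg h \<in> measurable M (borel_of (cube k))"
  unfolding scaled_deg_def[abs_def]
proof (rule measurable_cube)
  fix i assume "i \<le> k"
  note [measurable] = D[OF this]
  show "(\<lambda>\<omega>. ennreal (real (D i \<omega>) / h powr (b i / \<tau>))) \<in> borel_measurable M" by measurable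
qed

lemma scaled_deg_neg_ln_vec: "scaled_deg h \<omega> = neg_ln_vec k (y_deg h (zero_ext k D \<omega>))"
proof -
  have "neg_ln (exp (- (deg_scale h m * real (D m \<omega>)))) = ennreal (real (D m \<omega>) / h powr (b m / \<tau>))" for m
    by (simp add: neg_ln_exp deg_scale_def powr_minus field_simps)
  then show ?thesis by (auto simp: scaled_deg_def neg_ln_vec_def y_deg_def zero_ext_def fun_eq_iff)
qed

lemma topE_Int: "topspace (E k) \<inter> space (distr M (borel_of (cube k)) (scaled_deg h)) \<in> sets (distr M (borel_of (cube k)) (scaled_deg h))"
  unfolding sets_distr space_distr by (rule sets.Int[OF openin_borel_of[OF openin_topspace_E] sets.top])

lemma sets_scaled_Xlaw: "sets (scaled_law k \<delta> M D h) = sets (borel_of (E k))"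
proof -
  have "sets (restrict_space (distr M (borel_of (cube k)) (scaled_deg h)) (topspace (E k)))
      = sets (restrict_space (borel_of (cube k)) (topspace (E k)))"
    by (rule sets_restrict_space_cong) simp
  then show ?thesis by (simp add: scaled_Xlaw_eq sets_restrict_borel_of_cube)
qed

lemma nn_integral_scaled_Xlaw:
  assumes f: "f \<in> borel_measurable (borel_of (E k))"
  shows "(\<integral>\<^sup>+x. f x \<partial>scaled_law k \<delta> M D h) = ennreal h * (\<integral>\<^sup>+\<omega>. f (scaled_deg h \<omega>) * indicator (topspace (E k)) (scaled_deg h \<omega>) \<partial>M)"
proof -
  let ?D = "distr M (borel_of (cube k)) (scaled_deg h)" and ?T = "topspace (E k)"
  have "sets (restrict_space ?D ?T) = sets (borel_of (E k))"
    using sets_scaled_Xlaw[of h] by (simp add: scaled_Xlaw_eq)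
  then have fr: "f \<in> borel_measurable (restrict_space ?D ?T)"
    using f measurable_cong_sets[OF _ refl] by blast
  then have fm: "(\<lambda>x. f x * indicator ?T x) \<in> borel_measurable ?D"
    by (subst (asm) borel_measurable_restrict_space_iff_ennreal[OF topE_Int])
  have "(\<integral>\<^sup>+x. f x \<partial>scaled_law k \<delta> M D h) = ennreal h * (\<integral>\<^sup>+x. f x \<partial>restrict_space ?D ?T)"
    unfolding scaled_Xlaw_eq by (rule nn_integral_scale_measure[OF fr])
  also have "(\<integral>\<^sup>+x. f x \<partial>restrict_space ?D ?T) = (\<integral>\<^sup>+x. f x * indicator ?T x \<partial>?D)"
    by (rule nn_integral_restrict_space[OF topE_Int])
  also have "\<dots> = (\<integral>\<^sup>+\<omega>. f (scaled_deg h \<omega>) * indicator ?T (scaled_deg h \<omega>) \<partial>M)"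
    by (rule nn_integral_distr[OF scaled_deg_measurable]) (use fm in simp)
  finally show ?thesis .
qed

lemma radon_scaled_Xlaw: "radon_measure_on (E k) (scaled_law k \<delta> M D h)"
  unfolding radon_measure_on_def
proof (intro conjI allI impI sets_scaled_Xlaw)
  fix K
  interpret M: prob_space M by (rule M)
  have "emeasure (scaled_law k \<delta> M D h) K \<le> emeasure (scaled_law k \<delta> M D h) (space (scaled_law k \<delta> M D h))"
    by (rule emeasure_space)
  also have "\<dots> = (\<integral>\<^sup>+x. 1 \<partial>scaled_law k \<delta> M D h)" by simp
  also have "\<dots> = ennreal h * (\<integral>\<^sup>+\<omega>. 1 * indicator (topspace (E k)) (scaled_deg h \<omega>) \<partial>M)"
    by (rule nn_integral_scaled_Xlaw) simp
  also have "\<dots> \<le> ennreal h * (\<integral>\<^sup>+\<omega>. 1 \<partial>M)"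
    by (intro mult_left_mono nn_integral_mono) (auto simp: indicator_def)
  also have "\<dots> < \<infinity>" by (simp add: M.emeasure_space_1)
  finally show "emeasure (scaled_law k \<delta> M D h) K < \<infinity>" .
qed

text \<open>A scaled vector at the origin contributes nothing on either side: the restriction to
  \<open>E k\<close> removes it on the left, \<open>ext0\<close> on the right.\<close>

lemma nn_integral_scaled_Xlaw_g:
  assumes g: "continuous_map (E k) euclideanreal g" "\<And>x. x \<in> topspace (E k) \<Longrightarrow> 0 \<le> g x"
    and means_converge: "means_converge (\<lambda>y. ext0 k g (neg_ln_vec k y))" and h: "0 < h"
  shows "(\<integral>\<^sup>+x. ennreal (g x) \<partial>scaled_law k \<delta> M D h) = ennreal (mean_deg (\<lambda>y. ext0 k g (neg_ln_vec k y)) h)"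
proof -
  let ?\<phi> = "\<lambda>y. ext0 k g (neg_ln_vec k y)"
  have m: "(\<lambda>x. ennreal (g x)) \<in> borel_measurable (borel_of (E k))"
    using continuous_map_measurable[OF g(1)] by measurable
  have Dm: "zero_ext k D \<in> measurable M (count_space UNIV)" by (rule measurable_zero_ext) (rule D)
  have \<phi>0: "0 \<le> ?\<phi> y" for y using g(2) by (simp add: ext0_def)
  have "\<exists>B. \<forall>y\<in>ycube k. \<bar>?\<phi> y\<bar> \<le> B" using means_converge unfolding means_converge_def by blast
  note i = integrable_mean_deg[OF this, of h]
  have "(\<integral>\<^sup>+\<omega>. ennreal (g (scaled_deg h \<omega>)) * indicator (topspace (E k)) (scaled_deg h \<omega>) \<partial>M)
     = (\<integral>\<^sup>+\<omega>. ennreal (?\<phi> (y_deg h (zero_ext k D \<omega>))) \<partial>M)"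
    unfolding scaled_deg_neg_ln_vec by (rule nn_integral_cong) (simp add: ext0_def indicator_def)
  also have "\<dots> = (\<integral>\<^sup>+i. ennreal (?\<phi> (y_deg h i)) \<partial>distr M (count_space UNIV) (zero_ext k D))"
    by (rule nn_integral_distr[OF Dm, symmetric]) simp
  also have "\<dots> = (\<integral>\<^sup>+i. ennreal (?\<phi> (y_deg h i)) \<partial>measure_pmf q)" unfolding qD ..
  also have "\<dots> = ennreal (measure_pmf.expectation q (\<lambda>i. ?\<phi> (y_deg h i)))"
    by (rule nn_integral_eq_integral[OF i]) (simp add: \<phi>0)
  finally have e: "(\<integral>\<^sup>+\<omega>. ennreal (g (scaled_deg h \<omega>)) * indicator (topspace (E k)) (scaled_deg h \<omega>) \<partial>M)
     = ennreal (measure_pmf.expectation q (\<lambda>i. ?\<phi> (y_deg h i)))" .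
  show ?thesis
    unfolding nn_integral_scaled_Xlaw[OF m] e mean_deg_def
    using h by (simp add: ennreal_mult')
qed

text \<open>In the variables exp(-x) compact support becomes vanishing near the corner, and
  continuity up to infinite coordinates becomes continuity on the compact cube, so
  \<open>means_converge_of_vanishing\<close> applies to every test function.\<close>

lemma vague_limit:
  assumes \<nu>: "sets \<nu> = sets (restrict_space borel {0<..})"
    and \<nu>_tail: "\<And>x. 0 < x \<Longrightarrow> emeasure \<nu> {x<..} = ennreal (x powr (- (\<tau> / b 0)))"
  shows "vaguely_converges (E k) (scaled_law k \<delta> M D) (m_tail k \<delta> \<nu> N G W) at_top"
  unfolding vaguely_converges_def
proof (intro conjI allI impI)
  show "\<forall>\<^sub>F h in at_top. radon_measure_on (E k) (scaled_law k \<delta> M D h)"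
    by (intro always_eventually allI radon_scaled_Xlaw)
  show "radon_measure_on (E k) (m_tail k \<delta> \<nu> N G W)" by (rule radon_m_tail[OF \<nu>]) (rule \<nu>_tail)
  fix g :: "(nat \<Rightarrow> ennreal) \<Rightarrow> real"
  assume "continuous_map (E k) euclideanreal g \<and> (\<forall>x\<in>topspace (E k). 0 \<le> g x) \<and>
     compactin (E k) (E k closure_of {x \<in> topspace (E k). g x \<noteq> 0})"
  then have g: "continuous_map (E k) euclideanreal g" "\<And>x. x \<in> topspace (E k) \<Longrightarrow> 0 \<le> g x"
    and K: "compactin (E k) (E k closure_of {x \<in> topspace (E k). g x \<noteq> 0})" by auto
  obtain c where c: "0 < c" "\<forall>x\<in>topspace (E k). (\<forall>j\<le>k. x j \<le> ennreal c) \<longrightarrow> g x = 0"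
    using compact_support_away[OF K] by blast
  have means_converge: "means_converge (\<lambda>y. ext0 k g (neg_ln_vec k y))"
  proof (rule means_converge_of_vanishing)
    show "continuous_on (ycube k) (\<lambda>y. ext0 k g (neg_ln_vec k y))" by (rule continuous_on_ext0[OF g(1) c(2,1)])
    show "0 < 1 - exp (- c)" using c(1) by simp
  qed (rule ext0_vanish[OF c(2,1)])
  have eq: "(\<integral>\<^sup>+x. ennreal (g x) \<partial>m_tail k \<delta> \<nu> N G W) = ennreal (mean_lim (\<lambda>y. ext0 k g (neg_ln_vec k y)))"
    by (rule nn_integral_m_tail_g[OF \<nu> _ g(1) _ means_converge]) (simp_all add: \<nu>_tail g(2))
  from means_converge have "(mean_deg (\<lambda>y. ext0 k g (neg_ln_vec k y)) \<longlongrightarrow> mean_lim (\<lambda>y. ext0 k g (neg_ln_vec k y))) at_top"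
    unfolding means_converge_def by blast
  then have "((\<lambda>h. ennreal (mean_deg (\<lambda>y. ext0 k g (neg_ln_vec k y)) h)) \<longlongrightarrow> ennreal (mean_lim (\<lambda>y. ext0 k g (neg_ln_vec k y)))) at_top"
    by (rule tendsto_ennrealI)
  moreover have "\<forall>\<^sub>F h in at_top. ennreal (mean_deg (\<lambda>y. ext0 k g (neg_ln_vec k y)) h) = (\<integral>\<^sup>+x. ennreal (g x) \<partial>scaled_law k \<delta> M D h)"
    using eventually_gt_at_top[of "0::real"]
    by eventually_elim (rule nn_integral_scaled_Xlaw_g[OF g means_converge, symmetric])
  ultimately show "((\<lambda>h. \<integral>\<^sup>+x. ennreal (g x) \<partial>scaled_law k \<delta> M D h) \<longlongrightarrow> (\<integral>\<^sup>+x. ennreal (g x) \<partial>m_tail k \<delta> \<nu> N G W)) at_top"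
    unfolding eq by (rule Lim_transform_eventually)
qed

end

end

theorem theorem2p5:
  fixes k :: nat and \<delta> :: real
    and M :: "'a measure" and D :: "nat \<Rightarrow> 'a \<Rightarrow> nat" and p :: "(nat \<Rightarrow> nat) \<Rightarrow> real"
    and N :: "'c measure" and G :: "nat \<Rightarrow> 'c \<Rightarrow> real"
    and W :: "nat \<Rightarrow> nat \<Rightarrow> real \<Rightarrow> 'c \<Rightarrow> real"
    and \<nu> :: "real measure"
  assumes "\<delta> > -1"
    and "satisfies_recursion k \<delta> p"
    and "prob_space M"
    and "\<And>m. m \<le> k \<Longrightarrow> D m \<in> measurable M (count_space UNIV)"
    and "\<And>i. measure M {\<omega> \<in> space M. \<forall>m\<le>k. D m \<omega> = i m} = p i"
    and "prob_space N"
    and "\<And>m. m \<le> k \<Longrightarrow>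
           distributed N lborel (G m) (\<lambda>x. ennreal (gamma_density ((1 + \<delta>) / bpar k \<delta> m) x))"
    and "\<And>m \<omega>. m \<le> k \<Longrightarrow> \<omega> \<in> space N \<Longrightarrow> 0 \<le> G m \<omega>"
    and "\<And>m i. 1 \<le> i \<Longrightarrow> i \<le> m \<Longrightarrow> m \<le> k \<Longrightarrow> subordinator N (W m i)"
    and "\<And>m i \<theta> t. 1 \<le> i \<Longrightarrow> i \<le> m \<Longrightarrow> m \<le> k \<Longrightarrow> 0 \<le> \<theta> \<Longrightarrow> 0 \<le> t \<Longrightarrow>
           (LINT \<omega>|N. exp (- \<theta> * W m i t \<omega>))
             = exp (- t * (LINT x:{0<..}|lborel. (1 - exp (- \<theta> * x)) * levy_density k \<delta> i x))"
    and "prob_space.indep_sets N (generated_sigma N G W)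
           ({..k} <+> {(m, i). 1 \<le> i \<and> i \<le> m \<and> m \<le> k})"
    and "sets \<nu> = sets (restrict_space borel {0<..})"
    and "\<And>x. 0 < x \<Longrightarrow> emeasure \<nu> {x<..} = ennreal (x powr (- (tau k \<delta> / bpar k \<delta> 0)))"
  shows "vaguely_converges (E k) (scaled_law k \<delta> M D) (m_tail k \<delta> \<nu> N G W) at_top
    \<and> (\<forall>x :: nat \<Rightarrow> real. (\<forall>i\<le>k. 0 \<le> x i) \<and> (\<exists>i\<le>k. x i \<noteq> 0) \<longrightarrow>
        emeasure (m_tail k \<delta> \<nu> N G W) (\<Pi>\<^sub>E i\<in>{..k}. {ennreal (x i)<..})
          = ennreal (tau k \<delta> / bpar k \<delta> 0)
            * (\<integral>\<^sup>+u\<in>{0<..}. ennreal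
                 (measure N {\<omega> \<in> space N. \<forall>i\<le>k.
                     (\<Sum>m\<le>k. Xvec G W m i \<omega>) > x i / u powr (bpar k \<delta> i / bpar k \<delta> 0)}
                  * u powr (- (1 + tau k \<delta> / bpar k \<delta> 0))) \<partial>lborel))"
proof -
  let ?q = "\<lambda>i. if \<forall>l>k. i l = 0 then p i else 0"
  have "\<exists>q. measure_pmf q = distr M (count_space UNIV) (zero_ext k D)"
    by (rule exists_pmf[OF assms(3)]) (rule assms(4))
  then obtain q where qM: "measure_pmf q = distr M (count_space UNIV) (zero_ext k D)" by blast
  have Dm: "zero_ext k D \<in> measurable M (count_space UNIV)" by (rule measurable_zero_ext) (rule assms(4))
  \<comment> \<open>\<open>p\<close> is given on all functions, whereas \<open>q\<close> charges
    only those that vanish beyond \<open>k\<close>; hence the case distinction in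
    \<open>?q\<close>.\<close>
  have pmf_q: "pmf q i = ?q i" for i
  proof -
    have "pmf q i = measure (distr M (count_space UNIV) (zero_ext k D)) {i}"
      by (simp add: pmf.rep_eq qM)
    also have "\<dots> = measure M (zero_ext k D -` {i} \<inter> space M)"
      by (rule measure_distr[OF Dm]) auto
    also have "\<dots> = ?q i"
    proof (cases "\<forall>l>k. i l = 0")
      case True
      have "zero_ext k D -` {i} \<inter> space M = {\<omega> \<in> space M. \<forall>m\<le>k. D m \<omega> = i m}"
      proof (intro set_eqI iffI)
        fix \<omega> assume "\<omega> \<in> {\<omega> \<in> space M. \<forall>m\<le>k. D m \<omega> = i m}"
        then have "zero_ext k D \<omega> l = i l" "\<omega> \<in> space M" for l
          using True by (cases "l \<le> k"; simp add: zero_ext_def)+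
        then show "\<omega> \<in> zero_ext k D -` {i} \<inter> space M" by (simp add: fun_eq_iff)
      next
        fix \<omega> assume w: "\<omega> \<in> zero_ext k D -` {i} \<inter> space M"
        then have "D m \<omega> = i m" if "m \<le> k" for m
          using that by (auto simp: zero_ext_def)
        then show "\<omega> \<in> {\<omega> \<in> space M. \<forall>m\<le>k. D m \<omega> = i m}" using w by simp
      qed
      then show ?thesis using True assms(5) by simp
    next
      case False
      then obtain l where "k < l" "i l \<noteq> 0" by blast
      then have "zero_ext k D \<omega> l \<noteq> i l" for \<omega> by (simp add: zero_ext_def)
      then have "zero_ext k D -` {i} \<inter> space M = {}" by auto
      then show ?thesis unfolding if_not_P[OF False] by simp
    qed
    finally show ?thesis .
  qed
  interpret N: prob_space N by (rule assms(6))
  interpret tail_setup k \<delta> p q N G W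
    by (intro tail_setup.intro tree_law.intro tree_law_axioms.intro limit_vars.intro
      limit_vars_axioms.intro tree_params.intro pmf_q assms(1,2,6,7,8,9,10,11))
  have 1: "vaguely_converges (E k) (scaled_law k \<delta> M D) (m_tail k \<delta> \<nu> N G W) at_top"
    by (rule vague_limit[OF assms(3) _ qM assms(12)]) (rule assms(4), assumption, rule assms(13))
  show ?thesis
  proof (intro conjI 1 allI impI)
    fix x :: "nat \<Rightarrow> real" assume "(\<forall>i\<le>k. 0 \<le> x i) \<and> (\<exists>i\<le>k. x i \<noteq> 0)"
    then have x: "\<forall>i\<le>k. 0 \<le> x i" by blast
    show "emeasure (m_tail k \<delta> \<nu> N G W) (\<Pi>\<^sub>E i\<in>{..k}. {ennreal (x i)<..})
          = ennreal (tau k \<delta> / bpar k \<delta> 0)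
            * (\<integral>\<^sup>+u\<in>{0<..}. ennreal
                 (measure N {\<omega> \<in> space N. \<forall>i\<le>k.
                     (\<Sum>m\<le>k. Xvec G W m i \<omega>) > x i / u powr (bpar k \<delta> i / bpar k \<delta> 0)}
                  * u powr (- (1 + tau k \<delta> / bpar k \<delta> 0))) \<partial>lborel)"
      by (rule m_tail_box[OF assms(12) _ x]) (rule assms(13))
  qed
qed

end
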